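(* For every $n\ge 2$, every group generated by an irreducible geometrically fast set of $n$ positive bumps is isomorphic to Thompson's group $F_n$. Equivalently, the class $\mathcal C_n$ consists of a single isomorphism class, represented by $F_n$.
   Context: Let $I\subseteq\mathbb R$ be an interval. The support of an orientation-preserving homeomorphism $f$ of $I$ is $\{x\in I: f(x)\ne x\}$. A positive bump is an orientation-preserving homeomorphism $b$ of $I$ whose support is a single open interval $(a_b,c_b)$ and which satisfies $b(x)>x$ for all $x\in(a_b,c_b)$. A marker for $b$ is a point $m_b\in(a_b,c_b)$; it determines the left foot $L_b=(a_b,m_b)$ and the right foot $R_b=[b(m_b),c_b)$ of $b$. A finite set $B$ of positive bumps (of a common interval $I$) is geometrically fast if markers can be chosen for all $b\in B$ so that the $2|B|$ feet are pairwise disjoint. The feet then carry a left-to-right order, which does not depend on the choice of such markers. Two bumps $x,y\in B$ cross if $L_x<L_y<R_x<R_y$ or $L_y<L_x<R_y<R_x$ (equivalently, their supports overlap and neither contains the other). The crossing graph of $B$ has vertex set $B$ and an edge for each crossing pair. $B$ is irreducible if its crossing graph is connected. $\mathcal C_n$ denotes the class of groups $\langle B\rangle$ generated by irreducible geometrically fast sets $B$ of $n$ positive bumps. $F_n$ denotes the $n$-ary Thompson group: the group of piecewise-linear orientation-preserving homeomorphisms of $[0,1]$ with finitely many breakpoints, all in $\mathbb Z[1/n]$, and with all slopes integral powers of $n$. *)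

theory Defs
  imports "HOL-Analysis.Analysis" "HOL-Algebra.Algebra"
begin

(* As in HOL-Algebra.Bij, self-maps of I are extensional functions, so that a homeomorphism
   of I is represented by exactly one function real => real. *)

definition homeo_plus :: "real set \<Rightarrow> (real \<Rightarrow> real) set" where
  "homeo_plus I = {f \<in> Bij I. strict_mono_on I f \<and> (\<exists>g. homeomorphism I I f g)}"

definition homeo_group :: "real set \<Rightarrow> (real \<Rightarrow> real) monoid" where
  "homeo_group I = (BijGroup I)\<lparr>carrier := homeo_plus I\<rparr>"

(* The set of moved points, without taking the closure. *)
definition supp :: "real set \<Rightarrow> (real \<Rightarrow> real) \<Rightarrow> real set" where
  "supp I f = {x \<in> I. f x \<noteq> x}"

(* The endpoints of the support may be infinite and need not lie in I, so the open interval
   is described without naming them. *)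
definition positive_bump :: "real set \<Rightarrow> (real \<Rightarrow> real) \<Rightarrow> bool" where
  "positive_bump I b \<longleftrightarrow>
     b \<in> homeo_plus I \<and>
     supp I b \<noteq> {} \<and> open (supp I b) \<and> is_interval (supp I b) \<and>
     (\<forall>x\<in>supp I b. x < b x)"

(* If the support is (a, c), then left_foot I b m = (a, m) and right_foot I b m = [b m, c)
   for every m in (a, c). *)
definition left_foot :: "real set \<Rightarrow> (real \<Rightarrow> real) \<Rightarrow> real \<Rightarrow> real set" where
  "left_foot I b m = {x \<in> supp I b. x < m}"

definition right_foot :: "real set \<Rightarrow> (real \<Rightarrow> real) \<Rightarrow> real \<Rightarrow> real set" where
  "right_foot I b m = {x \<in> supp I b. b m \<le> x}"

(* The disjoint sum B <+> B indexes the 2|B| feet. *)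
definition fast_marking ::
  "real set \<Rightarrow> (real \<Rightarrow> real) set \<Rightarrow> ((real \<Rightarrow> real) \<Rightarrow> real) \<Rightarrow> bool" where
  "fast_marking I B m \<longleftrightarrow>
     (\<forall>b\<in>B. m b \<in> supp I b) \<and>
     disjoint_family_on
       (case_sum (\<lambda>b. left_foot I b (m b)) (\<lambda>b. right_foot I b (m b))) (B <+> B)"

definition geometrically_fast :: "real set \<Rightarrow> (real \<Rightarrow> real) set \<Rightarrow> bool" where
  "geometrically_fast I B \<longleftrightarrow>
     finite B \<and> (\<forall>b\<in>B. positive_bump I b) \<and> (\<exists>m. fast_marking I B m)"

definition left_of :: "real set \<Rightarrow> real set \<Rightarrow> bool" where
  "left_of S T \<longleftrightarrow> (\<forall>s\<in>S. \<forall>t\<in>T. s < t)"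

(* The order of the feet is the same for all fast markings, so quantifying existentially
   over the marking involves no choice. *)
definition crosses ::
  "real set \<Rightarrow> (real \<Rightarrow> real) set \<Rightarrow> (real \<Rightarrow> real) \<Rightarrow> (real \<Rightarrow> real) \<Rightarrow> bool" where
  "crosses I B x y \<longleftrightarrow>
     (\<exists>m. fast_marking I B m \<and>
       (let Lx = left_foot I x (m x); Rx = right_foot I x (m x);
            Ly = left_foot I y (m y); Ry = right_foot I y (m y)
        in left_of Lx Ly \<and> left_of Ly Rx \<and> left_of Rx Ry \<or>
           left_of Ly Lx \<and> left_of Lx Ry \<and> left_of Ry Rx))"

definition crossing_edges ::
  "real set \<Rightarrow> (real \<Rightarrow> real) set \<Rightarrow> ((real \<Rightarrow> real) \<times> (real \<Rightarrow> real)) set" where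
  "crossing_edges I B = {(x, y). x \<in> B \<and> y \<in> B \<and> crosses I B x y}"

definition bumps_irreducible :: "real set \<Rightarrow> (real \<Rightarrow> real) set \<Rightarrow> bool" where
  "bumps_irreducible I B \<longleftrightarrow> (\<forall>x\<in>B. \<forall>y\<in>B. (x, y) \<in> (crossing_edges I B)\<^sup>*)"

definition bump_group :: "real set \<Rightarrow> (real \<Rightarrow> real) set \<Rightarrow> (real \<Rightarrow> real) monoid" where
  "bump_group I B = subgroup_generated (homeo_group I) B"

definition bump_group_class :: "nat \<Rightarrow> (real \<Rightarrow> real) monoid set" where
  "bump_group_class n =
     {bump_group I B | I B. is_interval I \<and> geometrically_fast I B \<and>
        bumps_irreducible I B \<and> card B = n}"

(* The subring Z[1/n] of the reals. *)
definition Z_inverse :: "nat \<Rightarrow> real set" where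
  "Z_inverse n = {of_int a / of_nat n ^ k | a k. True}"

(* The finite set P contains all breakpoints: f is affine, with slope a power of n, on every
   subinterval [s, t] of [0, 1] having no point of P in its interior. *)
definition thompson_carrier :: "nat \<Rightarrow> (real \<Rightarrow> real) set" where
  "thompson_carrier n =
     {f \<in> homeo_plus {0..1}.
        \<exists>P. finite P \<and> P \<subseteq> Z_inverse n \<and>
          (\<forall>s t. 0 \<le> s \<and> s < t \<and> t \<le> 1 \<and> {s<..<t} \<inter> P = {} \<longrightarrow>
             (\<exists>(k::int) c. \<forall>x\<in>{s..t}. f x = of_nat n powi k * x + c))}"

definition thompson_group :: "nat \<Rightarrow> (real \<Rightarrow> real) monoid" where
  "thompson_group n = (homeo_group {0..1})\<lparr>carrier := thompson_carrier n\<rparr>"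

end

theory Submission
  imports Defs
begin

text \<open>A group is determined by generators \<open>y\<^sub>0, y\<^sub>1, \<dots>\<close> with \<open>y\<^sub>i y\<^sub>j = y\<^sub>j\<^sub>+\<^sub>N y\<^sub>i\<close> for \<open>i < j\<close> as soon as
  different nonincreasing words have different values, because every element is then a fraction of
  two such words. Increasing bijections of the line satisfy all this if \<open>y\<^sub>k\<close> is the identity up to
  a point \<open>s\<^sub>k\<close> and agrees with \<open>y\<^sub>0\<close> beyond the next gap \<open>[t\<^sub>k\<^sub>+\<^sub>1, s\<^sub>k\<^sub>+\<^sub>1]\<close>, the gaps being permuted by
  \<open>y\<^sub>0\<close> with period \<open>N\<close>. Thompson's group \<open>F\<^sub>n\<close> is of this kind with \<open>N = n - 1\<close>.

  An irreducible fast family is built up from two crossing bumps, one of them with the greatest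
  right endpoint, by adding one crossing bump at a time. An element of the group generated so far
  brings the feet of the next bump into gaps (or its left foot stays on the left of everything), and
  then there is an explicit new sequence of generators, with \<open>N\<close> increased by one. The induction needs
  control over the positions in the gaps of all the feet that are still to be added.\<close>

section \<open>Groups generated by a shift sequence\<close>

text \<open>The period decides the isomorphism type. A crossing pair \<open>b\<close>,
  \<open>p\<close> gives \<open>N = 1\<close>, with first letters \<open>b \<circ> p\<close> and
  \<open>b \<circ> p \<circ> fun_inv b\<close>, and each further bump raises \<open>N\<close> by
  one, so \<open>n\<close> bumps end at \<open>n - 1\<close>. The obstacle is the position of the
  remaining feet. The intervals between used feet reach a common gap only through different group
  elements, and an interval further to the left has to travel longer and ends up beyond the others.
  For the pair, the three intervals between consecutive feet are carried by
  \<open>p \<circ> b\<close>, \<open>p\<close> and the identity to adjacent intervals in the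
  opposite order. So inside a gap the order is reversed between feet separated by a used foot and
  kept otherwise, and every new bump has to preserve this rule with its own two feet now counted as
  used. A foot to the right of the whole support could never be brought into a gap; this is why the
  greatest right endpoint comes first. The same cannot be arranged on the left as well, so a left
  foot outside the support needs its own kind of step.\<close>

definition word_prod :: "('a, 'b) monoid_scheme \<Rightarrow> (nat \<Rightarrow> 'a) \<Rightarrow> nat list \<Rightarrow> 'a" where
  "word_prod G y xs = foldr (\<lambda>k a. y k \<otimes>\<^bsub>G\<^esub> a) xs \<one>\<^bsub>G\<^esub>"

text \<open>The relation of a shift sequence as a rewriting rule: the letter \<open>i\<close>
  travels to the right past every larger letter, which it raises by \<open>N\<close>, and stops at
  the first one that is not larger.\<close>

fun insert_letter :: "nat \<Rightarrow> nat \<Rightarrow> nat list \<Rightarrow> nat list" where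
  "insert_letter N i [] = [i]"
| "insert_letter N i (k # r) = (if k \<le> i then i # k # r else (k + N) # insert_letter N i r)"

abbreviation nonincreasing :: "nat list \<Rightarrow> bool" where
  "nonincreasing \<equiv> sorted_wrt (\<ge>)"

text \<open>A passed head becomes \<open>k + N\<close>, and the letters behind it, raised at most by
  \<open>N\<close>, cannot exceed that; this keeps the word nonincreasing.\<close>

lemma insert_letter_bound:
  "\<forall>x\<in>set p. x \<le> B \<Longrightarrow> \<forall>x\<in>set (insert_letter N i p). x \<le> max i (B + N)"
  by (induction p) (auto simp: max_def le_add1 intro: le_trans)

lemma nonincreasing_insert_letter: "nonincreasing p \<Longrightarrow> nonincreasing (insert_letter N i p)"
proof (induction p)
  case (Cons k r)
  have "\<forall>x\<in>set (insert_letter N i r). x \<le> max i (k + N)"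
    using Cons.prems by (intro insert_letter_bound) auto
  with Cons show ?case by (auto simp: max_def split: if_splits)
qed simp

locale shift_sequence = group G for G (structure) +
  fixes y :: "nat \<Rightarrow> 'a" and N :: nat
  assumes y_closed: "y k \<in> carrier G"
    and y_rel: "i < j \<Longrightarrow> y i \<otimes> y j = y (j + N) \<otimes> y i"
begin

abbreviation wp :: "nat list \<Rightarrow> 'a" where "wp \<equiv> word_prod G y"

lemma wp_Nil [simp]: "wp [] = \<one>" and wp_Cons [simp]: "wp (k # xs) = y k \<otimes> wp xs"
  by (simp_all add: word_prod_def)

lemma wp_closed [simp]: "wp xs \<in> carrier G"
  by (induction xs) (auto simp: y_closed)

lemma wp_append: "wp (xs @ zs) = wp xs \<otimes> wp zs"
  by (induction xs) (auto simp: y_closed m_assoc)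

lemma wp_insert_letter: "wp (insert_letter N i p) = y i \<otimes> wp p"
proof (induction p)
  case (Cons k r)
  show ?case
  proof (cases "k \<le> i")
    case False
    then have "y i \<otimes> y k = y (k + N) \<otimes> y i" by (simp add: y_rel)
    then show ?thesis using False Cons by (simp add: y_closed m_assoc[symmetric])
  qed simp
qed simp

lemma wp_normal_form: "\<exists>q. nonincreasing q \<and> wp q = wp p"
proof (induction p)
  case (Cons k r)
  then obtain q where "nonincreasing q" "wp q = wp r" by blast
  then show ?case
    using nonincreasing_insert_letter[of q N k] wp_insert_letter[of k q] by (intro exI[of _ "insert_letter N k q"]) simp
qed (intro exI[of _ "[]"], simp)

text \<open>An inverse letter passes a positive letter at the cost of raising the larger index by
  \<open>N\<close>. It therefore crosses the whole word as a single inverse letter unless it cancels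
  on the way, which is what makes fractions closed under right multiplication.\<close>

lemma wp_mult_inv_letter:
  "(\<exists>p'. wp p \<otimes> inv (y i) = wp p') \<or> (\<exists>p' j. wp p \<otimes> inv (y i) = inv (y j) \<otimes> wp p')"
proof (induction p)
  case Nil
  have "wp [] \<otimes> inv (y i) = inv (y i) \<otimes> wp []" by (simp add: y_closed)
  then show ?case by blast
next
  case (Cons k r)
  have assoc: "wp (k # r) \<otimes> inv (y i) = y k \<otimes> (wp r \<otimes> inv (y i))"
    by (simp add: y_closed m_assoc)
  from Cons show ?case
  proof
    assume "\<exists>p'. wp r \<otimes> inv (y i) = wp p'"
    then obtain p' where "wp r \<otimes> inv (y i) = wp p'" by blast
    then have "wp (k # r) \<otimes> inv (y i) = wp (k # p')" using assoc by simp
    then show ?thesis by blast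
  next
    assume "\<exists>p' j. wp r \<otimes> inv (y i) = inv (y j) \<otimes> wp p'"
    then obtain p' j where pj: "wp r \<otimes> inv (y i) = inv (y j) \<otimes> wp p'" by blast
    have e: "wp (k # r) \<otimes> inv (y i) = (y k \<otimes> inv (y j)) \<otimes> wp p'"
      using assoc pj by (simp add: y_closed m_assoc)
    consider "k = j" | "k < j" | "j < k" by linarith
    then show ?thesis
    proof cases
      case 1
      then have "wp (k # r) \<otimes> inv (y i) = wp p'" using e by (simp add: y_closed)
      then show ?thesis by blast
    next
      case 2
      have "y k \<otimes> inv (y j) = inv (y (j + N)) \<otimes> y k"
        using y_rel[OF 2] by (metis inv_closed inv_solve_left inv_solve_right' m_closed m_assoc y_closed)
      then have "wp (k # r) \<otimes> inv (y i) = inv (y (j + N)) \<otimes> wp (k # p')"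
        using e by (simp add: y_closed m_assoc)
      then show ?thesis by blast
    next
      case 3
      have "y k \<otimes> inv (y j) = inv (y j) \<otimes> y (k + N)"
        using y_rel[OF 3] by (metis inv_closed inv_solve_left inv_solve_right' m_closed m_assoc y_closed)
      then have "wp (k # r) \<otimes> inv (y i) = inv (y j) \<otimes> wp ((k + N) # p')"
        using e by (simp add: y_closed m_assoc)
      then show ?thesis by blast
    qed
  qed
qed

definition fractions :: "'a set" where
  "fractions = {inv (wp q) \<otimes> wp p | q p. True}"

lemma fractions_mult_letter: "u \<in> fractions \<Longrightarrow> u \<otimes> y i \<in> fractions"
proof -
  assume "u \<in> fractions"
  then obtain q p where "u = inv (wp q) \<otimes> wp p" by (auto simp: fractions_def)
  then have "u \<otimes> y i = inv (wp q) \<otimes> wp (p @ [i])" by (simp add: wp_append y_closed m_assoc)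
  then show ?thesis unfolding fractions_def by blast
qed

lemma fractions_mult_inv_letter: "u \<in> fractions \<Longrightarrow> u \<otimes> inv (y i) \<in> fractions"
proof -
  assume "u \<in> fractions"
  then obtain q p where u: "u = inv (wp q) \<otimes> wp p" by (auto simp: fractions_def)
  then have e: "u \<otimes> inv (y i) = inv (wp q) \<otimes> (wp p \<otimes> inv (y i))" by (simp add: y_closed m_assoc)
  from wp_mult_inv_letter[of p i] show ?thesis
  proof
    assume "\<exists>p'. wp p \<otimes> inv (y i) = wp p'"
    then obtain p' where "u \<otimes> inv (y i) = inv (wp q) \<otimes> wp p'" using e by auto
    then show ?thesis unfolding fractions_def by blast
  next
    assume "\<exists>p' j. wp p \<otimes> inv (y i) = inv (y j) \<otimes> wp p'"
    then obtain p' j where "wp p \<otimes> inv (y i) = inv (y j) \<otimes> wp p'" by blast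
    then have "u \<otimes> inv (y i) = inv (wp (j # q)) \<otimes> wp p'"
      using e by (simp add: y_closed m_assoc inv_mult_group)
    then show ?thesis unfolding fractions_def by blast
  qed
qed

lemma generate_fractions: "generate G (range y) \<subseteq> fractions"
proof
  fix h assume h: "h \<in> generate G (range y)"
  have sub: "range y \<subseteq> carrier G" using y_closed by auto
  have fr: "fractions \<subseteq> carrier G" unfolding fractions_def by auto
  \<comment> \<open>Strengthened to right multiplication of all fractions, so that the product case
    only performs two such multiplications in turn.\<close>
  from h have "\<forall>u\<in>fractions. u \<otimes> h \<in> fractions"
  proof (induction rule: generate.induct)
    case one
    then show ?case using fr by auto
  next
    case (incl h)
    then show ?case using fractions_mult_letter by auto
  next
    case (inv h)
    then show ?case using fractions_mult_inv_letter by auto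
  next
    case (eng h1 h2)
    have "h1 \<in> carrier G" "h2 \<in> carrier G"
      using eng generate_in_carrier[OF sub] by auto
    then show ?case using eng fr by (metis m_assoc subsetD)
  qed
  moreover have "\<one> \<in> fractions"
    unfolding fractions_def by (intro CollectI exI[of _ "[]"]) simp
  ultimately show "h \<in> fractions"
    using generate_in_carrier[OF sub h] by (metis l_one)
qed

lemma generate_normal_form:
  assumes "h \<in> generate G (range y)"
  obtains q p where "nonincreasing q" "nonincreasing p" "h = inv (wp q) \<otimes> wp p"
proof -
  obtain q p where "h = inv (wp q) \<otimes> wp p"
    using assms generate_fractions unfolding fractions_def by blast
  moreover obtain q' where "nonincreasing q'" "wp q' = wp q" using wp_normal_form by blast
  moreover obtain p' where "nonincreasing p'" "wp p' = wp p" using wp_normal_form by blast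
  ultimately show ?thesis using that[of q' p'] by simp
qed

end

locale faithful_shift_sequence = shift_sequence +
  assumes wp_inject: "nonincreasing p \<Longrightarrow> nonincreasing q \<Longrightarrow> word_prod G y p = word_prod G y q \<Longrightarrow> p = q"

section \<open>Isomorphism of two groups through the graph in their product\<close>

lemma word_prod_DirProd:
  "word_prod (G \<times>\<times> H) (\<lambda>k. (y k, z k)) p = (word_prod G y p, word_prod H z p)"
  by (induction p) (auto simp: word_prod_def)

text \<open>The subgroup of the product generated by the pairs \<open>(y k, z k)\<close> is the graph of an
  isomorphism: a fraction of normal words is trivial in one factor only if the two words agree.\<close>

lemma fst_iso_pairs:
  assumes G: "faithful_shift_sequence G y N" and H: "shift_sequence H z N"
  defines "K \<equiv> generate (G \<times>\<times> H) (range (\<lambda>k. (y k, z k)))"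
  shows "fst \<in> iso ((G \<times>\<times> H)\<lparr>carrier := K\<rparr>) (G\<lparr>carrier := generate G (range y)\<rparr>)"
proof -
  interpret G: faithful_shift_sequence G y N by fact
  interpret H: shift_sequence H z N by fact
  interpret P: group "G \<times>\<times> H" by (intro DirProd_group G.group_axioms H.group_axioms)
  interpret P: shift_sequence "G \<times>\<times> H" "\<lambda>k. (y k, z k)" N
    by unfold_locales (auto simp: G.y_closed H.y_closed G.y_rel H.y_rel)
  have sub: "range (\<lambda>k. (y k, z k)) \<subseteq> carrier (G \<times>\<times> H)" using P.y_closed by auto
  have KC: "K \<subseteq> carrier (G \<times>\<times> H)" unfolding K_def using P.generate_incl[OF sub] .
  have KS: "subgroup K (G \<times>\<times> H)" unfolding K_def by (rule P.generate_is_subgroup[OF sub])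
  have fsth: "group_hom (G \<times>\<times> H) G fst"
    by (intro group_hom.intro group_hom_axioms.intro) (auto simp: hom_def P.group_axioms G.group_axioms)
  have inj: "inj_on fst K"
  proof (rule inj_onI)
    fix a b assume ab: "a \<in> K" "b \<in> K" "fst a = fst b"
    define c where "c = a \<otimes>\<^bsub>G \<times>\<times> H\<^esub> inv\<^bsub>G \<times>\<times> H\<^esub> b"
    have aC: "a \<in> carrier (G \<times>\<times> H)" and bC: "b \<in> carrier (G \<times>\<times> H)" using ab KC by auto
    have "c \<in> K" unfolding c_def using ab KS by (simp add: subgroup.m_closed subgroup.m_inv_closed)
    then obtain q p where qp: "nonincreasing q" "nonincreasing p"
      "c = inv\<^bsub>G \<times>\<times> H\<^esub> (P.wp q) \<otimes>\<^bsub>G \<times>\<times> H\<^esub> P.wp p"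
      unfolding K_def by (rule P.generate_normal_form)
    have "fst c = fst a \<otimes>\<^bsub>G\<^esub> inv\<^bsub>G\<^esub> (fst b)"
      unfolding c_def using aC bC
      using group_hom.hom_mult[OF fsth, of a "inv\<^bsub>G \<times>\<times> H\<^esub> b"] group_hom.hom_inv[OF fsth, of b] P.inv_closed[of b]
      by (simp del: mult_DirProd carrier_DirProd)
    then have c1: "fst c = \<one>\<^bsub>G\<^esub>" using ab aC by (auto simp: DirProd_def)
    have "fst c = inv\<^bsub>G\<^esub> (G.wp q) \<otimes>\<^bsub>G\<^esub> G.wp p"
      using qp by (simp add: word_prod_DirProd inv_DirProd[OF G.group_axioms H.group_axioms])
    with c1 have "G.wp p = G.wp q"
      by (metis G.inv_closed G.inv_equality G.inv_inv G.wp_closed)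
    then have "p = q" using G.wp_inject qp by blast
    then have "c = \<one>\<^bsub>G \<times>\<times> H\<^esub>" using qp P.l_inv[OF P.wp_closed[of q]] by (simp del: one_DirProd mult_DirProd)
    then show "a = b" unfolding c_def using aC bC
      by (metis P.inv_closed P.inv_equality P.inv_inv)
  qed
  have img: "fst ` K = generate G (range y)"
    unfolding K_def using group_hom.generate_img[OF fsth sub]
    by (simp add: image_image)
  have "fst \<in> hom ((G \<times>\<times> H)\<lparr>carrier := K\<rparr>) (G\<lparr>carrier := generate G (range y)\<rparr>)"
    using img by (auto simp: hom_def)
  then show ?thesis using inj img by (simp add: iso_def bij_betw_def)
qed

text \<open>The graph projects isomorphically to both factors. The second projection is the first
  one for the swapped pair, so the two graphs are identified by \<open>prod.swap\<close>.\<close>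

lemma iso_of_faithful_shift_sequences:
  assumes G: "faithful_shift_sequence G y N" and H: "faithful_shift_sequence H z N"
  shows "G\<lparr>carrier := generate G (range y)\<rparr> \<cong> H\<lparr>carrier := generate H (range z)\<rparr>"
proof -
  interpret G: faithful_shift_sequence G y N by fact
  interpret H: faithful_shift_sequence H z N by fact
  interpret P: group "G \<times>\<times> H" by (intro DirProd_group G.group_axioms H.group_axioms)
  interpret Q: group "H \<times>\<times> G" by (intro DirProd_group G.group_axioms H.group_axioms)
  let ?A = "range (\<lambda>k. (y k, z k))" and ?B = "range (\<lambda>k. (z k, y k))"
  let ?K = "(G \<times>\<times> H)\<lparr>carrier := generate (G \<times>\<times> H) ?A\<rparr>"
  let ?L = "(H \<times>\<times> G)\<lparr>carrier := generate (H \<times>\<times> G) ?B\<rparr>"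
  have A: "?A \<subseteq> carrier (G \<times>\<times> H)" and B: "?B \<subseteq> carrier (H \<times>\<times> G)"
    using G.y_closed H.y_closed by auto
  have K: "group ?K"
    by (rule subgroup.subgroup_is_group[OF P.generate_is_subgroup[OF A] P.group_axioms])
  have "group_hom (G \<times>\<times> H) (H \<times>\<times> G) prod.swap"
    by (intro group_hom.intro group_hom_axioms.intro) (auto simp: hom_def P.group_axioms Q.group_axioms)
  from group_hom.generate_img[OF this A]
  have "prod.swap ` generate (G \<times>\<times> H) ?A = generate (H \<times>\<times> G) ?B"
    by (simp add: image_image)
  then have "prod.swap \<in> iso ?K ?L"
    by (auto simp: iso_def hom_def bij_betw_def)
  then have KL: "?K \<cong> ?L" by (rule is_isoI)
  have KG: "?K \<cong> G\<lparr>carrier := generate G (range y)\<rparr>"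
    using fst_iso_pairs[OF G H.shift_sequence_axioms] by (rule is_isoI)
  have LH: "?L \<cong> H\<lparr>carrier := generate H (range z)\<rparr>"
    using fst_iso_pairs[OF H G.shift_sequence_axioms] by (rule is_isoI)
  show ?thesis
    using iso_trans[OF group.iso_sym[OF K KG] iso_trans[OF KL LH]] .
qed

section \<open>Increasing bijections of the line\<close>

text \<open>HOL-Algebra reserves the token \<open>inv\<close> for inverses in groups.\<close>

abbreviation fun_inv :: "(real \<Rightarrow> real) \<Rightarrow> real \<Rightarrow> real" where
  "fun_inv f \<equiv> inv_into UNIV f"

text \<open>A strictly increasing surjection of the line is automatically a homeomorphism, and total
  functions make the product plain composition.\<close>

definition line_group :: "(real \<Rightarrow> real) monoid" where
  "line_group = \<lparr>carrier = {f. strict_mono f \<and> surj f}, mult = (\<circ>), one = id\<rparr>"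

lemma line_group_simps [simp]:
  "x \<otimes>\<^bsub>line_group\<^esub> y = x \<circ> y" "\<one>\<^bsub>line_group\<^esub> = id"
  "f \<in> carrier line_group \<longleftrightarrow> strict_mono f \<and> surj f"
  by (auto simp: line_group_def)

lemma strict_mono_fun_inv:
  assumes "strict_mono (f :: real \<Rightarrow> real)" "surj f" shows "strict_mono (fun_inv f)"
proof (rule strict_monoI)
  fix x y :: real assume "x < y"
  then have "f (fun_inv f x) < f (fun_inv f y)" using assms(2) by (simp add: surj_f_inv_f)
  then show "fun_inv f x < fun_inv f y" using strict_mono_less[OF assms(1)] by simp
qed

lemma inj_line: "strict_mono (f :: real \<Rightarrow> real) \<Longrightarrow> inj f"
  by (rule strict_mono_on_imp_inj_on)

lemma surj_fun_inv: "strict_mono (f :: real \<Rightarrow> real) \<Longrightarrow> surj (fun_inv f)"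
  by (rule inj_imp_surj_inv[OF inj_line])

lemma group_line: "group line_group"
proof (rule groupI)
  fix f assume "f \<in> carrier line_group"
  then have f: "strict_mono f" "surj f" by auto
  show "\<exists>g\<in>carrier line_group. g \<otimes>\<^bsub>line_group\<^esub> f = \<one>\<^bsub>line_group\<^esub>"
  proof (rule bexI[of _ "fun_inv f"])
    show "fun_inv f \<otimes>\<^bsub>line_group\<^esub> f = \<one>\<^bsub>line_group\<^esub>"
      using f by (simp add: inj_line)
    show "fun_inv f \<in> carrier line_group"
      using f strict_mono_fun_inv surj_fun_inv by simp
  qed
next
  fix f g assume "f \<in> carrier line_group" "g \<in> carrier line_group"
  then show "f \<otimes>\<^bsub>line_group\<^esub> g \<in> carrier line_group"
    using comp_surj[of g f] by (simp add: strict_mono_def)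
qed (simp_all add: comp_assoc strict_mono_def)

interpretation line: group line_group by (rule group_line)

lemma inv_line [simp]:
  assumes f: "strict_mono f" "surj f" shows "inv\<^bsub>line_group\<^esub> f = fun_inv f"
  using f strict_mono_fun_inv[OF f] surj_fun_inv by (intro line.inv_equality) (simp_all add: inj_line)

locale incr_bij =
  fixes f :: "real \<Rightarrow> real"
  assumes smono: "strict_mono f" and surj: "surj f"
begin

lemma less_iff [simp]: "f x < f y \<longleftrightarrow> x < y"
  using smono by (rule strict_mono_less)
lemma le_iff [simp]: "f x \<le> f y \<longleftrightarrow> x \<le> y"
  using smono by (rule strict_mono_less_eq)
lemma eq_iff [simp]: "f x = f y \<longleftrightarrow> x = y"
  using smono by (rule strict_mono_eq)
lemma f_inv [simp]: "f (fun_inv f x) = x"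
  using surj by (simp add: surj_f_inv_f)
lemma inv_f [simp]: "fun_inv f (f x) = x"
  using eq_iff[of "fun_inv f (f x)" x] by simp
lemma inv_le_iff [simp]: "fun_inv f x \<le> fun_inv f y \<longleftrightarrow> x \<le> y"
  using le_iff[of "fun_inv f x" "fun_inv f y"] by simp
lemma inv_less: "fun_inv f x < y \<longleftrightarrow> x < f y"
  using less_iff[of "fun_inv f x" y] by simp
lemma less_inv: "x < fun_inv f y \<longleftrightarrow> f x < y"
  using less_iff[of x "fun_inv f y"] by simp
lemma inv_le: "fun_inv f x \<le> y \<longleftrightarrow> x \<le> f y"
  using le_iff[of "fun_inv f x" y] by simp
lemma le_inv: "x \<le> fun_inv f y \<longleftrightarrow> f x \<le> y"
  using le_iff[of x "fun_inv f y"] by simp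
lemma inv_eq: "fun_inv f x = y \<longleftrightarrow> x = f y"
  using eq_iff[of "fun_inv f x" y] by auto
lemma incr_bij_inv: "incr_bij (fun_inv f)"
  using strict_mono_fun_inv[OF smono surj] surj_fun_inv[OF smono] by (rule incr_bij.intro)
lemma m_inv: "inv\<^bsub>line_group\<^esub> f = fun_inv f"
  using smono surj by simp

end

lemma incr_bij_line: "incr_bij f \<longleftrightarrow> f \<in> carrier line_group"
  by (simp add: incr_bij_def)

lemma incr_bij_comp: "incr_bij f \<Longrightarrow> incr_bij g \<Longrightarrow> incr_bij (f \<circ> g)"
  using line.m_closed by (simp add: incr_bij_line del: line_group_simps(3))

lemma incr_bij_id: "incr_bij id"
  by (simp add: incr_bij_def strict_mono_def)

lemma incr_bij_funpow: "incr_bij f \<Longrightarrow> incr_bij (f ^^ n)"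
  by (induction n) (auto intro: incr_bij_comp incr_bij_id)

lemma incr_bij_conj: "incr_bij q \<Longrightarrow> incr_bij b \<Longrightarrow> incr_bij (q \<circ> b \<circ> fun_inv q)"
  by (intro incr_bij_comp incr_bij.incr_bij_inv)

lemma generate_incr_bij:
  assumes "\<And>f. f \<in> A \<Longrightarrow> incr_bij f" and "g \<in> generate line_group A"
  shows "incr_bij g"
proof -
  have "A \<subseteq> carrier line_group" using assms(1) by (auto simp: incr_bij_line simp del: line_group_simps)
  from line.generate_in_carrier[OF this assms(2)] show ?thesis by (simp add: incr_bij_line)
qed

lemma generate_comp:
  "f \<in> generate line_group A \<Longrightarrow> g \<in> generate line_group A \<Longrightarrow> f \<circ> g \<in> generate line_group A"
  using generate.eng[of f line_group A g] by simp

lemma generate_id: "id \<in> generate line_group A"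
  using generate.one[of line_group A] by simp

lemma generate_inv:
  assumes "\<And>f. f \<in> A \<Longrightarrow> incr_bij f" and g: "g \<in> generate line_group A"
  shows "fun_inv g \<in> generate line_group A"
proof -
  have "A \<subseteq> carrier line_group" using assms(1) by (auto simp: incr_bij_line simp del: line_group_simps)
  from line.generate_m_inv_closed[OF this g] generate_incr_bij[OF assms]
  show ?thesis by (simp add: incr_bij.m_inv)
qed

lemma generate_funpow:
  "f \<in> generate line_group A \<Longrightarrow> f ^^ n \<in> generate line_group A"
  by (induction n) (auto intro: generate_comp generate_id simp: funpow.simps(1))

lemma generate_subsetI:
  assumes "\<And>f. f \<in> B \<Longrightarrow> incr_bij f" and "\<And>f. f \<in> A \<Longrightarrow> f \<in> generate line_group B"
  shows "generate line_group A \<subseteq> generate line_group B"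
proof -
  have "B \<subseteq> carrier line_group" using assms(1) by (auto simp: incr_bij_line simp del: line_group_simps)
  from line.generate_subgroup_incl[OF _ line.generate_is_subgroup[OF this]] assms(2) show ?thesis by blast
qed

section \<open>Chains of increasing bijections\<close>

text \<open>Movement by \<open>y k\<close> is demanded only up to \<open>s (Suc k)\<close>, the zone
  where all letters above \<open>k\<close> are still trivial. The gap from \<open>t k\<close> to
  \<open>s k\<close> may be a single point, as happens for the generators of Thompson's
  group.\<close>

locale bump_chain =
  fixes N :: nat and y :: "nat \<Rightarrow> real \<Rightarrow> real" and s t :: "nat \<Rightarrow> real"
  assumes N_pos: "1 \<le> N"
    and incr: "incr_bij (y k)"
    and y_ge: "x \<le> y k x"
    and y_fix: "x \<le> s k \<Longrightarrow> y k x = x"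
    and y_gt: "s k < x \<Longrightarrow> x < s (Suc k) \<Longrightarrow> x < y k x"
    and y_shift: "t (Suc k) \<le> x \<Longrightarrow> y k x = y 0 x"
    and t_le_s: "1 \<le> k \<Longrightarrow> t k \<le> s k"
    and s_less_t: "s k < t (Suc k)"
    and y_period: "1 \<le> k \<Longrightarrow> y (k + N) (y 0 x) = y 0 (y k x)"
    and s_period: "1 \<le> k \<Longrightarrow> s (k + N) = y 0 (s k)"
    and t_period: "1 \<le> k \<Longrightarrow> t (k + N) = y 0 (t k)"
begin

sublocale y: incr_bij "y k" for k by (rule incr)

abbreviation G :: "(real \<Rightarrow> real) set" where "G \<equiv> generate line_group (range y)"

lemma incr_G: "g \<in> G \<Longrightarrow> incr_bij g"
  by (rule generate_incr_bij[of "range y"]) (auto intro: incr)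

lemma y_in_G: "y k \<in> G"
  by (rule generate.incl) simp

lemma inv_G: "g \<in> G \<Longrightarrow> fun_inv g \<in> G"
  by (rule generate_inv) (auto intro: incr)

lemma s_strict_mono: "strict_mono s"
  unfolding strict_mono_Suc_iff
proof
  fix k show "s k < s (Suc k)" using s_less_t[of k] t_le_s[of "Suc k"] by simp
qed

lemma s_mono: "i \<le> j \<Longrightarrow> s i \<le> s j"
  using s_strict_mono strict_mono_less_eq by blast

lemma s_less: "i < j \<Longrightarrow> s i < s j"
  using s_strict_mono strict_mono_less by blast

lemma s_less_t': "i < j \<Longrightarrow> s i < t j"
  using s_less_t[of "j - 1"] s_mono[of i "j - 1"] by (cases j) simp_all

lemma t_less: "1 \<le> i \<Longrightarrow> i < j \<Longrightarrow> t i < t j"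
  using t_le_s[of i] s_less_t'[of i j] by simp

lemma t_mono: "1 \<le> i \<Longrightarrow> i \<le> j \<Longrightarrow> t i \<le> t j"
  using t_less[of i j] by (cases "i = j") auto

lemma y_eq_shift: "i < k \<Longrightarrow> t k \<le> x \<Longrightarrow> y i x = y 0 x"
  using y_shift[of i x] t_mono[of "Suc i" k] by auto

lemma y_fix': "k \<le> i \<Longrightarrow> x \<le> s k \<Longrightarrow> y i x = x"
  using y_fix[of x i] s_mono[of k i] by auto

text \<open>Beyond \<open>t (Suc i)\<close> the map \<open>y i\<close> is \<open>y 0\<close>, and
  the relation is the periodicity. Before that point both sides reduce to \<open>y i x\<close>: the
  letter \<open>y j\<close> fixes \<open>x\<close>, and \<open>y (j + N)\<close> fixes
  \<open>y i x\<close> because this is still at most \<open>y 0 (s j) = s (j + N)\<close>.\<close>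

lemma relation:
  assumes "i < j" shows "y i \<circ> y j = y (j + N) \<circ> y i"
proof
  fix x
  show "(y i \<circ> y j) x = (y (j + N) \<circ> y i) x"
  proof (cases "t (Suc i) \<le> x")
    case True
    then have "y i x = y 0 x" "y i (y j x) = y 0 (y j x)"
      using y_shift y_ge[of x j] by auto
    then show ?thesis using y_period[of j x] assms by simp
  next
    case False
    have j: "1 \<le> j" using assms by simp
    have "x \<le> s j" using False t_mono[of "Suc i" j] t_le_s[OF j] assms by simp
    moreover have "y i x \<le> s (j + N)"
    proof -
      have "y i x < y i (t (Suc i))" using False by simp
      also have "\<dots> = y 0 (t (Suc i))" by (simp add: y_shift)
      also have "\<dots> \<le> y 0 (s j)" using t_mono[of "Suc i" j] t_le_s[OF j] assms by simp
      finally show ?thesis using s_period[OF j] by simp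
    qed
    ultimately show ?thesis using y_fix by simp
  qed
qed

sublocale shift_sequence line_group y N
  by unfold_locales (use y.smono y.surj relation in auto)

lemma wp_Nil': "wp [] = id" and wp_Cons': "wp (k # p) = y k \<circ> wp p"
  by auto

declare wp_Nil [simp del] wp_Cons [simp del] wp_Nil' [simp] wp_Cons' [simp]

lemma incr_wp: "incr_bij (wp p)"
  using wp_closed by (simp add: incr_bij_def)

lemma wp_ge: "x \<le> wp p x"
  by (induction p) (auto intro: order_trans y_ge)

lemma wp_fix: "\<forall>k\<in>set p. i \<le> k \<Longrightarrow> x \<le> s i \<Longrightarrow> wp p x = x"
  by (induction p) (auto simp: y_fix')

lemma wp_moves:
  assumes "\<forall>k\<in>set p. i \<le> k" "i \<in> set p" "s i < x" "x < s (Suc i)"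
  shows "x < wp p x"
  using assms
proof (induction p)
  case (Cons k p)
  show ?case
  proof (cases "wp p x = x")
    case True
    then have "i \<notin> set p" using Cons by auto
    then have "k = i" using Cons by auto
    then show ?thesis using True y_gt Cons by simp
  next
    case False
    then have "x < wp p x" using wp_ge[of x p] by simp
    then show ?thesis using y_ge[of "wp p x" k] by simp
  qed
qed simp

lemma nonincreasing_snoc:
  assumes "nonincreasing p" "p \<noteq> []"
  shows "\<exists>i p'. p = p' @ [i] \<and> nonincreasing p' \<and> (\<forall>k\<in>set p. i \<le> k)"
proof -
  obtain p' i where p: "p = p' @ [i]" using assms(2) by (metis append_butlast_last_id)
  then show ?thesis using assms(1) by (auto simp: sorted_wrt_append)
qed

text \<open>The smallest letter \<open>i\<close> of a nonincreasing word is detected by the action immediately to the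
  right of \<open>s i\<close>, where all larger letters act trivially.\<close>

lemma wp_inject:
  "nonincreasing p \<Longrightarrow> nonincreasing q \<Longrightarrow> wp p = wp q \<Longrightarrow> p = q"
proof (induction "length p + length q" arbitrary: p q rule: less_induct)
  case less
  have min_le: "j \<le> i" if pq: "nonincreasing p'" "wp p' = wp q'" "p' = p'' @ [i]" "\<forall>k\<in>set p'. i \<le> k"
    "\<forall>k\<in>set q'. j \<le> k" for p' q' p'' i j
  proof (rule ccontr)
    assume "\<not> j \<le> i"
    define x where "x = (s i + s (Suc i)) / 2"
    have x: "s i < x" "x < s (Suc i)" using s_less[of i "Suc i"] by (auto simp: x_def)
    have "x \<le> s j" using x s_mono[of "Suc i" j] \<open>\<not> j \<le> i\<close> by simp
    then have "wp q' x = x" using wp_fix pq by blast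
    moreover have "x < wp p' x" using wp_moves[of p' i x] pq x by simp
    ultimately show False using pq by simp
  qed
  show ?case
  proof (cases "p = [] \<or> q = []")
    case True
    have ne: "p' = []" if nil: "nonincreasing p'" "wp p' = id" for p'
    proof (rule ccontr)
      assume "p' \<noteq> []"
      then obtain i p'' where i: "p' = p'' @ [i]" "\<forall>k\<in>set p'. i \<le> k"
        using nil(1) nonincreasing_snoc[of p'] by blast
      have "Suc i \<le> i" using min_le[of p' "[]" p'' i "Suc i"] nil i by simp
      then show False by simp
    qed
    show ?thesis using True ne[of p] ne[of q] less by auto
  next
    case False
    obtain i p' where i: "p = p' @ [i]" "nonincreasing p'" "\<forall>k\<in>set p. i \<le> k"
      using False less nonincreasing_snoc by blast
    obtain j q' where j: "q = q' @ [j]" "nonincreasing q'" "\<forall>k\<in>set q. j \<le> k"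
      using False less nonincreasing_snoc by blast
    have "i = j" using min_le[of p q p' i j] min_le[of q p q' j i] less i j by simp
    have "wp p' \<circ> y i = wp q' \<circ> y i" using less(4) i j \<open>i = j\<close> by (simp add: wp_append)
    then have "wp p' = wp q'" using y.surj[of i] by (metis surj_fun_eq)
    then have "p' = q'" using less i j by simp
    then show ?thesis using i j \<open>i = j\<close> by simp
  qed
qed

sublocale faithful_shift_sequence line_group y N
  by unfold_locales (rule wp_inject)

lemma G_fraction:
  assumes "g \<in> G" obtains q p where "\<And>x. wp q (g x) = wp p x"
proof -
  from generate_normal_form[OF assms] obtain q p where g: "g = inv\<^bsub>line_group\<^esub> (wp q) \<otimes>\<^bsub>line_group\<^esub> wp p"
    by blast
  interpret q: incr_bij "wp q" by (rule incr_wp)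
  have "wp q (g x) = wp p x" for x using g by (simp add: q.m_inv)
  then show ?thesis using that by blast
qed

subsection \<open>Gaps\<close>

definition gap :: "nat \<Rightarrow> real set" where "gap k = {t k..s k}"

lemma shift_gap: "1 \<le> k \<Longrightarrow> y 0 x \<in> gap (k + N) \<longleftrightarrow> x \<in> gap k"
  by (simp add: gap_def s_period t_period)

lemma shift_pow_gap: "1 \<le> k \<Longrightarrow> (y 0 ^^ c) x \<in> gap (k + c * N) \<longleftrightarrow> x \<in> gap k"
proof (induction c)
  case (Suc c)
  then show ?case using shift_gap[of "k + c * N" "(y 0 ^^ c) x"] by (simp add: algebra_simps)
qed simp

lemma y_gap: "1 \<le> k \<Longrightarrow> x \<in> gap k \<Longrightarrow> y i x = (if i < k then y 0 x else x)"
  using y_fix'[of k i x] by (auto simp: gap_def y_eq_shift)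

text \<open>The number of the gap decides how a letter acts on all of its points alike:
  \<open>y i\<close> moves gap \<open>k\<close> as \<open>y 0\<close> does if \<open>i < k\<close>
  and fixes it otherwise. So a word moves each gap rigidly along its translates.\<close>

lemma wp_gap:
  assumes "1 \<le> k" obtains c where "\<And>x. x \<in> gap k \<Longrightarrow> wp p x = (y 0 ^^ c) x"
proof -
  have "\<exists>c. \<forall>x\<in>gap k. wp p x = (y 0 ^^ c) x"
  proof (induction p)
    case (Cons i p)
    then obtain c where c: "\<forall>x\<in>gap k. wp p x = (y 0 ^^ c) x" by blast
    have "y i ((y 0 ^^ c) x) = (if i < k + c * N then (y 0 ^^ (Suc c)) x else (y 0 ^^ c) x)"
      if "x \<in> gap k" for x
      using that assms y_gap[of "k + c * N" "(y 0 ^^ c) x" i] by (simp add: shift_pow_gap)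
    then show ?case using c by (cases "i < k + c * N") (fastforce intro: exI[of _ "Suc c"] exI[of _ c])+
  qed (auto intro: exI[of _ 0])
  then show ?thesis using that by blast
qed

lemma gap_disjoint: "1 \<le> k \<Longrightarrow> 1 \<le> l \<Longrightarrow> x \<in> gap k \<Longrightarrow> x \<in> gap l \<Longrightarrow> k = l"
  using s_less_t'[of k l] s_less_t'[of l k] by (cases k l rule: linorder_cases) (auto simp: gap_def)

text \<open>Numerator and denominator act on the gap as powers of \<open>y 0\<close>. Both lead to
  the same translate, and gaps are disjoint, so the exponents agree. The group thus cannot rearrange
  points inside a gap.\<close>

lemma gap_return:
  assumes g: "g \<in> G" and k: "1 \<le> k" and x: "x \<in> gap k" and gx: "g x \<in> gap k"
  shows "g x = x"
proof -
  obtain q p where qp: "\<And>x. wp q (g x) = wp p x" using G_fraction[OF g] by blast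
  obtain c where c: "\<And>x. x \<in> gap k \<Longrightarrow> wp q x = (y 0 ^^ c) x" using wp_gap[OF k] by blast
  obtain d where d: "\<And>x. x \<in> gap k \<Longrightarrow> wp p x = (y 0 ^^ d) x" using wp_gap[OF k] by blast
  have e: "(y 0 ^^ c) (g x) = (y 0 ^^ d) x" using qp c d x gx by metis
  have "(y 0 ^^ c) (g x) \<in> gap (k + c * N)" "(y 0 ^^ d) x \<in> gap (k + d * N)"
    using k x gx by (auto simp: shift_pow_gap)
  then have "k + c * N = k + d * N" using e gap_disjoint k by (metis trans_le_add1)
  then have "c = d" using N_pos by simp
  interpret P: incr_bij "y 0 ^^ d" by (rule incr_bij_funpow[OF incr])
  show ?thesis using e \<open>c = d\<close> by simp
qed

text \<open>Write \<open>fun_inv g\<close> as a fraction; its denominator then does what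
  \<open>g\<close> does, up to a power of \<open>y 0\<close> coming from the numerator. A positive
  word is preferred to \<open>g\<close> itself because it carries every gap into a gap.\<close>

lemma positive_positioning:
  assumes g: "g \<in> G" and k: "1 \<le> k"
  obtains w c where "\<And>x. g x \<in> gap k \<Longrightarrow> wp w x = (y 0 ^^ c) (g x)"
proof -
  interpret g: incr_bij g by (rule incr_G[OF g])
  obtain q p where qp: "\<And>x. wp q (fun_inv g x) = wp p x" using G_fraction[OF inv_G[OF g]] by blast
  obtain c where c: "\<And>x. x \<in> gap k \<Longrightarrow> wp p x = (y 0 ^^ c) x" using wp_gap[OF k] by blast
  show ?thesis using that[of q c] qp c by (metis g.inv_f)
qed

end

section \<open>Chains given by a single period\<close>

locale chain_period =
  fixes N :: nat and y :: "nat \<Rightarrow> real \<Rightarrow> real" and s t :: "nat \<Rightarrow> real"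
  assumes N_pos: "1 \<le> N"
    and incr: "k \<le> N \<Longrightarrow> incr_bij (y k)"
    and y_ge: "k \<le> N \<Longrightarrow> x \<le> y k x"
    and y_fix: "k \<le> N \<Longrightarrow> x \<le> s k \<Longrightarrow> y k x = x"
    and y_gt: "k < N \<Longrightarrow> s k < x \<Longrightarrow> x < s (Suc k) \<Longrightarrow> x < y k x"
    and y_gt_last: "s N < x \<Longrightarrow> x < y 0 (s 1) \<Longrightarrow> x < y N x"
    and y_shift: "k < N \<Longrightarrow> t (Suc k) \<le> x \<Longrightarrow> y k x = y 0 x"
    and y_shift_last: "y 0 (t 1) \<le> x \<Longrightarrow> y N x = y 0 x"
    and t_le_s: "1 \<le> k \<Longrightarrow> k \<le> N \<Longrightarrow> t k \<le> s k"
    and s_less_t: "k < N \<Longrightarrow> s k < t (Suc k)"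
    and s_less_t_last: "s N < y 0 (t 1)"
begin

text \<open>For \<open>k \<ge> 1\<close> the decomposition is
  \<open>k - 1 = turn k * N + (rem k - 1)\<close>, so that \<open>rem k\<close> runs through
  \<open>1\<close> to \<open>N\<close>; letter \<open>0\<close> stands outside the periodic pattern
  and provides the translation.\<close>

definition turn :: "nat \<Rightarrow> nat" where "turn k = (k - 1) div N"
definition rem :: "nat \<Rightarrow> nat" where "rem k = Suc ((k - 1) mod N)"

definition Y :: "nat \<Rightarrow> real \<Rightarrow> real" where
  "Y k = (if k = 0 then y 0 else (y 0 ^^ turn k) \<circ> y (rem k) \<circ> fun_inv (y 0 ^^ turn k))"
definition S :: "nat \<Rightarrow> real" where
  "S k = (if k = 0 then s 0 else (y 0 ^^ turn k) (s (rem k)))"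
definition T :: "nat \<Rightarrow> real" where
  "T k = (y 0 ^^ turn k) (t (rem k))"

lemma small: "1 \<le> k \<Longrightarrow> k \<le> N \<Longrightarrow> turn k = 0 \<and> rem k = k"
  by (simp add: turn_def rem_def)

lemma rem_range: "1 \<le> rem k" "rem k \<le> N"
  using N_pos by (auto simp: rem_def Suc_le_eq)

lemma period: "1 \<le> k \<Longrightarrow> turn (k + N) = Suc (turn k) \<and> rem (k + N) = rem k"
proof -
  assume "1 \<le> k"
  then obtain m where k: "k = Suc m" by (cases k) auto
  show ?thesis using N_pos by (simp add: turn_def rem_def k)
qed

lemma next_index:
  assumes "1 \<le> k"
  shows "turn (Suc k) = (if rem k < N then turn k else Suc (turn k))"
    and "rem (Suc k) = (if rem k < N then Suc (rem k) else 1)"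
proof -
  obtain m where k: "k = Suc m" using assms by (cases k) auto
  have t: "turn k = m div N" "turn (Suc k) = Suc m div N" "rem k = Suc (m mod N)"
    "rem (Suc k) = Suc (Suc m mod N)"
    by (simp_all add: turn_def rem_def k)
  have m: "m mod N < N" using N_pos by simp
  show "turn (Suc k) = (if rem k < N then turn k else Suc (turn k))"
    unfolding t using m by (simp add: div_Suc mod_Suc)
  show "rem (Suc k) = (if rem k < N then Suc (rem k) else 1)"
    unfolding t using m by (simp add: mod_Suc)
qed

lemma Y_small: "k \<le> N \<Longrightarrow> Y k = y k"
  using small[of k] by (cases k) (simp_all add: Y_def fun_eq_iff)

lemma S_small: "k \<le> N \<Longrightarrow> S k = s k"
  using small[of k] by (cases k) (simp_all add: S_def)

lemma T_small: "1 \<le> k \<Longrightarrow> k \<le> N \<Longrightarrow> T k = t k"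
  using small[of k] by (simp add: T_def)

lemma incr_pow: "incr_bij (y 0 ^^ c)"
  by (rule incr_bij_funpow) (simp add: incr)

text \<open>Every condition is transported from the index \<open>rem k\<close> by the power
  \<open>y 0 ^^ turn k\<close>. The passage from \<open>N\<close> to \<open>N + 1\<close> is the
  only one not inside a period; there the next points are \<open>y 0 (s 1)\<close> and
  \<open>y 0 (t 1)\<close>, which is what the assumptions named \<open>last\<close> refer
  to.\<close>

lemma chain: "bump_chain N Y S T"
proof (rule bump_chain.intro)
  interpret y0: incr_bij "y 0" using incr[of 0] by simp
  interpret P: incr_bij "y 0 ^^ c" for c by (rule incr_pow)
  fix k :: nat and x :: real
  have Sk: "1 \<le> k \<Longrightarrow> S k = (y 0 ^^ turn k) (s (rem k))" by (simp add: S_def)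
  have Yk: "1 \<le> k \<Longrightarrow> Y k z = (y 0 ^^ turn k) (y (rem k) (fun_inv (y 0 ^^ turn k) z))" for z by (simp add: Y_def)
  show "1 \<le> N" by (rule N_pos)
  show "incr_bij (Y k)"
    using incr[of 0] incr[OF rem_range(2)] by (auto simp: Y_def intro!: incr_bij_conj incr_pow)
  show "x \<le> Y k x"
  proof (cases "k = 0")
    case False
    then show ?thesis using Yk[of x] P.inv_le[of "turn k"] y_ge[OF rem_range(2)] P.inv_le_iff
      by (metis One_nat_def P.inv_f Suc_leI not_gr_zero)
  qed (simp add: Y_def y_ge)
  show "Y k x = x" if "x \<le> S k"
  proof (cases "k = 0")
    case False
    then show ?thesis using that Sk Yk[of x] y_fix[OF rem_range(2), of "fun_inv (y 0 ^^ turn k) x" k]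
      by (simp add: P.inv_le)
  qed (use that in \<open>simp add: Y_def S_def y_fix\<close>)
  show "x < Y k x" if "S k < x" "x < S (Suc k)"
  proof (cases "k = 0")
    case True
    then show ?thesis using that N_pos y_gt[of 0 x] by (simp add: Y_small S_small)
  next
    case False
    define z where "z = fun_inv (y 0 ^^ turn k) x"
    have xz: "x = (y 0 ^^ turn k) z" by (simp add: z_def)
    have k: "1 \<le> k" using False by simp
    have 1: "s (rem k) < z" using that Sk[OF k] xz by simp
    have "z < y (rem k) z"
    proof (cases "rem k < N")
      case True
      then have "z < s (Suc (rem k))" using that(2) xz next_index[OF k] by (simp add: S_def)
      then show ?thesis using y_gt[OF True 1] by simp
    next
      case False
      then have r: "rem k = N" using rem_range(2)[of k] by simp
      have "(y 0 ^^ Suc (turn k)) (s 1) = (y 0 ^^ turn k) (y 0 (s 1))"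
        by (simp only: funpow_Suc_right comp_apply)
      then have "z < y 0 (s 1)" using that(2) xz next_index[OF k] r by (simp add: S_def del: funpow.simps)
      then show ?thesis using y_gt_last 1 r by simp
    qed
    then show ?thesis using Yk[OF k, of x] xz by simp
  qed
  show "Y k x = Y 0 x" if "T (Suc k) \<le> x"
  proof (cases "k = 0")
    case False
    define z where "z = fun_inv (y 0 ^^ turn k) x"
    have xz: "x = (y 0 ^^ turn k) z" by (simp add: z_def)
    have k: "1 \<le> k" using False by simp
    have "y (rem k) z = y 0 z"
    proof (cases "rem k < N")
      case True
      then have "t (Suc (rem k)) \<le> z" using that xz next_index[OF k] by (simp add: T_def)
      then show ?thesis using y_shift[OF True] by simp
    next
      case False
      then have r: "rem k = N" using rem_range(2)[of k] by simp
      have "(y 0 ^^ Suc (turn k)) (t 1) = (y 0 ^^ turn k) (y 0 (t 1))"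
        by (simp only: funpow_Suc_right comp_apply)
      then have "y 0 (t 1) \<le> z" using that xz next_index[OF k] r by (simp add: T_def del: funpow.simps)
      then show ?thesis using y_shift_last r by simp
    qed
    moreover have "(y 0 ^^ turn k) (y 0 z) = y 0 ((y 0 ^^ turn k) z)"
      by (simp add: funpow_swap1)
    ultimately show ?thesis using Yk[OF k, of x] xz by (simp add: Y_def)
  qed simp
  show "T k \<le> S k" if "1 \<le> k"
    using t_le_s[OF rem_range] Sk[OF that] by (simp add: T_def)
  show "S k < T (Suc k)"
  proof (cases "k = 0")
    case True
    then show ?thesis using s_less_t[of 0] N_pos by (simp add: S_small T_small)
  next
    case False
    then have k: "1 \<le> k" by simp
    show ?thesis
    proof (cases "rem k < N")
      case True
      then show ?thesis using s_less_t[OF True] next_index[OF k] Sk[OF k] by (simp add: T_def)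
    next
      case False
      then have r: "rem k = N" using rem_range(2)[of k] by simp
      have "(y 0 ^^ Suc (turn k)) (t 1) = (y 0 ^^ turn k) (y 0 (t 1))"
        by (simp only: funpow_Suc_right comp_apply)
      then show ?thesis using s_less_t_last next_index[OF k] Sk[OF k] r
        by (simp add: T_def del: funpow.simps)
    qed
  qed
  show "Y (k + N) (Y 0 x) = Y 0 (Y k x)" if "1 \<le> k"
  proof -
    have "fun_inv (y 0 ^^ Suc (turn k)) (y 0 x) = fun_inv (y 0 ^^ turn k) x"
      by (metis P.f_inv P.inv_f comp_apply funpow.simps(2))
    then show ?thesis using period[OF that] that Yk by (simp add: Y_def del: funpow.simps) simp
  qed
  show "S (k + N) = Y 0 (S k)" if "1 \<le> k"
    using period[OF that] that by (simp add: S_def Y_def)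
  show "T (k + N) = Y 0 (T k)" if "1 \<le> k"
    using period[OF that] that by (simp add: T_def Y_def)
qed

lemma generate_Y: "generate line_group (range Y) = generate line_group (y ` {..N})"
proof
  have A: "\<And>f. f \<in> y ` {..N} \<Longrightarrow> incr_bij f" using incr by auto
  have B: "\<And>f. f \<in> range Y \<Longrightarrow> incr_bij f" using bump_chain.incr[OF chain] by auto
  have mem: "k \<le> N \<Longrightarrow> y k \<in> generate line_group (y ` {..N})" for k by (rule generate.incl) auto
  show "generate line_group (range Y) \<subseteq> generate line_group (y ` {..N})"
  proof (rule generate_subsetI[OF A])
    fix f assume "f \<in> range Y"
    then obtain k where "f = Y k" by auto
    then show "f \<in> generate line_group (y ` {..N})"
      using mem[of 0] mem[OF rem_range(2)[of k]] 
      by (auto simp: Y_def intro!: generate_comp generate_funpow generate_inv[OF A])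
  qed
  show "generate line_group (y ` {..N}) \<subseteq> generate line_group (range Y)"
  proof (rule generate_subsetI[OF B])
    fix f assume "f \<in> y ` {..N}"
    then obtain k where "k \<le> N" "f = y k" by auto
    then show "f \<in> generate line_group (range Y)" using Y_small by (metis generate.incl rangeI)
  qed
qed

end

section \<open>Tracking the feet of the bumps that are still to be added\<close>

type_synonym foot = "real \<times> real"

definition before :: "foot \<Rightarrow> foot \<Rightarrow> bool" where
  "before U V \<longleftrightarrow> snd U \<le> fst V"

definition disjoint_feet :: "foot set \<Rightarrow> bool" where
  "disjoint_feet A \<longleftrightarrow> (\<forall>U\<in>A. fst U < snd U) \<and> (\<forall>U\<in>A. \<forall>V\<in>A. U \<noteq> V \<longrightarrow> before U V \<or> before V U)"

definition sep :: "foot set \<Rightarrow> foot \<Rightarrow> foot \<Rightarrow> bool" where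
  "sep D U V \<longleftrightarrow> (\<exists>W\<in>D. before U W \<and> before W V)"

text \<open>Index \<open>0\<close> is excluded because such feet wait outside the support at their
  original places, where their order is that of the line.\<close>

definition prec :: "foot set \<Rightarrow> (foot \<Rightarrow> nat) \<Rightarrow> foot \<Rightarrow> foot \<Rightarrow> bool" where
  "prec D idx U V \<longleftrightarrow> idx U = idx V \<and> idx U \<noteq> 0 \<and>
     (before U V \<and> \<not> sep D U V \<or> before V U \<and> sep D V U)"

lemma before_trans: "fst V < snd V \<Longrightarrow> before U V \<Longrightarrow> before V W \<Longrightarrow> before U W"
  by (auto simp: before_def)

lemma before_asym: "fst U < snd U \<Longrightarrow> fst V < snd V \<Longrightarrow> before U V \<Longrightarrow> \<not> before V U"
  by (auto simp: before_def)

lemma sep_mono: "sep D V W \<Longrightarrow> before U V \<Longrightarrow> fst V < snd V \<Longrightarrow> sep D U W"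
  and sep_mono': "sep D U V \<Longrightarrow> before V W \<Longrightarrow> fst V < snd V \<Longrightarrow> sep D U W"
  unfolding sep_def by (meson before_trans)+

text \<open>The set \<open>D\<close> consists of the feet of the bumps that generate the group \<open>G\<close>, and \<open>F\<close> of the
  remaining feet. An element \<open>rep U\<close> of \<open>G\<close> carries the foot \<open>U\<close> into the gap number \<open>idx U\<close>, where
  \<open>idx U = 0\<close> means that \<open>U\<close> lies to the left of the support of \<open>G\<close>. If two feet arrive in the same
  gap, then their order is reversed precisely if a foot in \<open>D\<close> separates them.\<close>

locale tracking = bump_chain +
  fixes \<Omega> D F :: "foot set" and rep :: "foot \<Rightarrow> real \<Rightarrow> real" and idx :: "foot \<Rightarrow> nat"
  assumes feet: "disjoint_feet \<Omega>" and D_sub: "D \<subseteq> \<Omega>" and F_sub: "F \<subseteq> \<Omega>" and DF: "D \<inter> F = {}"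
    and rep_G: "U \<in> F \<Longrightarrow> rep U \<in> generate line_group (range y)"
    and idx_le: "U \<in> F \<Longrightarrow> idx U \<le> N"
    and outer: "U \<in> F \<Longrightarrow> idx U = 0 \<Longrightarrow> snd U \<le> s 0"
    and inner: "U \<in> F \<Longrightarrow> idx U \<noteq> 0 \<Longrightarrow> t (idx U) \<le> rep U (fst U) \<and> rep U (snd U) \<le> s (idx U)"
    and ordered: "U \<in> F \<Longrightarrow> V \<in> F \<Longrightarrow> prec D idx U V \<Longrightarrow> rep U (snd U) \<le> rep V (fst V)"
    and adjacent: "U \<in> F \<Longrightarrow> V \<in> F \<Longrightarrow> before U V \<Longrightarrow> \<not> sep D U V \<Longrightarrow> idx U = idx V"
    and s0_le: "W \<in> D \<Longrightarrow> s 0 \<le> fst W"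
begin

lemma foot_less: "U \<in> F \<Longrightarrow> fst U < snd U"
  using feet F_sub unfolding disjoint_feet_def by blast

lemma foot_less_D: "U \<in> D \<Longrightarrow> fst U < snd U"
  using feet D_sub unfolding disjoint_feet_def by blast

lemma feet_ordered: "U \<in> \<Omega> \<Longrightarrow> V \<in> \<Omega> \<Longrightarrow> U \<noteq> V \<Longrightarrow> before U V \<or> before V U"
  using feet unfolding disjoint_feet_def by blast

lemma foot_cases: "U \<in> F \<Longrightarrow> V \<in> F \<Longrightarrow> U \<noteq> V \<Longrightarrow> before U V \<or> before V U"
  using feet_ordered[of U V] F_sub by blast

lemma foot_cases_D: "U \<in> F \<Longrightarrow> V \<in> D \<Longrightarrow> before U V \<or> before V U"
  using feet_ordered[of U V] F_sub D_sub DF by blast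

lemma incr_rep: "U \<in> F \<Longrightarrow> incr_bij (rep U)"
  by (rule incr_G[OF rep_G])

lemma rep_less: "U \<in> F \<Longrightarrow> rep U (fst U) < rep U (snd U)"
  using incr_bij.less_iff[OF incr_rep] foot_less by blast

lemma prec_total:
  "U \<in> F \<Longrightarrow> V \<in> F \<Longrightarrow> U \<noteq> V \<Longrightarrow> idx U = idx V \<Longrightarrow> idx U \<noteq> 0 \<Longrightarrow> prec D idx U V \<or> prec D idx V U"
  using foot_cases[of U V] by (auto simp: prec_def)

text \<open>The positions given by \<open>rep\<close> realise the relation on the line, so
  transitivity is inherited from there and no combinatorial case distinction on
  \<open>before\<close> and \<open>sep\<close> is made.\<close>

lemma prec_trans:
  assumes "U \<in> F" "V \<in> F" "W \<in> F" "prec D idx U V" "prec D idx V W"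
  shows "prec D idx U W"
proof -
  have "rep U (snd U) \<le> rep V (fst V)" "rep V (snd V) \<le> rep W (fst W)"
    using assms ordered by auto
  then have lt: "rep U (snd U) < rep W (fst W)" using rep_less[of V] assms by simp
  have "U \<noteq> W" using lt rep_less[of U] assms by auto
  moreover have "\<not> prec D idx W U" using lt ordered[of W U] rep_less[of U] rep_less[of W] assms by auto
  ultimately show ?thesis using prec_total[of U W] assms by (auto simp: prec_def)
qed

lemma prec_irrefl: "U \<in> F \<Longrightarrow> \<not> prec D idx U U"
  using foot_less[of U] by (auto simp: prec_def before_def)

lemma prec_asym: "U \<in> F \<Longrightarrow> V \<in> F \<Longrightarrow> prec D idx U V \<Longrightarrow> \<not> prec D idx V U"
  using prec_trans[of U V U] prec_irrefl by blast

text \<open>If \<open>W\<close> lay to the right of \<open>V\<close>, arriving before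
  \<open>V\<close> would require a foot of \<open>D\<close> between them; this foot also separates
  \<open>U\<close> from \<open>W\<close>, against the order of these two. The argument on the left
  of \<open>U\<close> is symmetric.\<close>

lemma prec_between:
  assumes "U \<in> F" "V \<in> F" "W \<in> F" "before U V" "prec D idx U W" "prec D idx W V"
    and nsep: "\<not> sep D U V"
  shows "before U W \<and> before W V"
proof -
  note lt = foot_less[OF assms(1)] foot_less[OF assms(2)] foot_less[OF assms(3)]
  have 1: "before U W \<and> \<not> sep D U W \<or> before W U \<and> sep D W U"
    and 2: "before W V \<and> \<not> sep D W V \<or> before V W \<and> sep D V W"
    using assms by (auto simp: prec_def)
  from 1 show ?thesis
  proof
    assume x: "before U W \<and> \<not> sep D U W"
    have "\<not> (before V W \<and> sep D V W)" using x sep_mono[of D V W U] assms lt by blast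
    then show ?thesis using 2 x by blast
  next
    assume x: "before W U \<and> sep D W U"
    then have "before W V" using before_trans assms lt by blast
    moreover have "sep D W V" using x sep_mono'[of D W U V] assms lt by blast
    moreover have "\<not> before V W" using \<open>before W V\<close> before_asym lt by blast
    ultimately show ?thesis using 2 by blast
  qed
qed

text \<open>The predicted order changes only when some \<open>W\<close> in \<open>E\<close> newly
  separates the two feet. No foot of \<open>D\<close> lies between \<open>W\<close> and either of
  them, so all three share a gap and \<open>W\<close> arrives between the other two. Hence a step
  can alter the order only across its own two feet.\<close>

lemma prec_refine:
  assumes UV: "U \<in> F" "V \<in> F" "idx U = idx V" "idx U \<noteq> 0" and E: "E \<subseteq> F"
    and p: "prec (D \<union> E) idx' U V"
  shows "prec D idx U V \<or> (\<exists>W\<in>E. prec D idx V W \<and> prec D idx W U)"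
proof (cases "sep D V U \<or> before U V \<and> \<not> sep D U V")
  case True
  have "sep D V U \<Longrightarrow> before V U"
    using foot_less_D before_trans unfolding sep_def by blast
  then show ?thesis using True UV by (auto simp: prec_def)
next
  case False
  have un: "sep (D \<union> E) A B \<longleftrightarrow> sep D A B \<or> sep E A B" for A B by (auto simp: sep_def)
  then obtain W where W: "W \<in> E" "before V W" "before W U"
    using p False by (auto simp: prec_def sep_def)
  have ZF: "W \<in> F" using W E by auto
  have "\<not> sep D V W" "\<not> sep D W U"
    using False W sep_mono'[of D V W U] sep_mono[of D W U V] foot_less[OF ZF] by blast+
  moreover from this have "idx V = idx W" "idx W = idx U"
    using adjacent[of V W] adjacent[of W U] ZF UV W by auto
  ultimately show ?thesis using W UV by (auto simp: prec_def)
qed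

lemma not_separated_refine:
  assumes UV: "U \<in> F" "V \<in> F" "before U V" and E: "E \<subseteq> F" and n: "\<not> sep (D \<union> E) U V"
  shows "idx U = idx V" and "W \<in> E \<Longrightarrow> \<not> (prec D idx U W \<and> prec D idx W V)"
proof -
  have n': "\<not> sep D U V" using n by (auto simp: sep_def)
  then show "idx U = idx V" using adjacent UV by blast
  show "\<not> (prec D idx U W \<and> prec D idx W V)" if "W \<in> E"
    using prec_between[of U V W] UV that E n n' by (auto simp: sep_def)
qed

subsection \<open>Rotation\<close>

text \<open>For letter \<open>0\<close> the assumption \<open>y_gt\<close> reaches only to
  \<open>s 1\<close>, but after a rotation the next point is \<open>s (1 + r)\<close>. The longer
  range comes from \<open>y 0 (s k) = s (k + N)\<close>.\<close>

lemma shift_gt: "s 0 < x \<Longrightarrow> x < s k \<Longrightarrow> x < y 0 x"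
proof (induction k)
  case (Suc k)
  show ?case
  proof (cases "x < s k")
    case False
    show ?thesis
    proof (cases "k = 0")
      case True
      then show ?thesis using Suc y_gt[of 0 x] by simp
    next
      case k: False
      have "x < s (k + N)" using Suc s_mono[of "Suc k" "k + N"] N_pos by simp
      also have "\<dots> = y 0 (s k)" using k by (simp add: s_period)
      also have "\<dots> \<le> y 0 x" using False by simp
      finally show ?thesis .
    qed
  qed (use Suc in simp)
qed simp

text \<open>Letters \<open>1\<close> to \<open>r\<close> are dropped and the others renumbered; a
  lost gap is represented by its image under \<open>y 0\<close>, one period later. This lets a
  chosen foot lie in gap \<open>1\<close>, the only position for which the steps below are
  formulated.\<close>

definition rot_y where "rot_y r k = (if k = 0 then y 0 else y (k + r))"
definition rot_s where "rot_s r k = (if k = 0 then s 0 else s (k + r))"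
definition rot_idx where
  "rot_idx r U = (if idx U = 0 then 0 else if r < idx U then idx U - r else idx U + N - r)"
definition rot_rep where
  "rot_rep r U = (if 0 < idx U \<and> idx U \<le> r then y 0 \<circ> rep U else rep U)"

lemma bump_chain_rot: "bump_chain N (rot_y r) (rot_s r) (\<lambda>k. t (k + r))"
proof (rule bump_chain.intro)
  fix k x
  show "1 \<le> N" by (rule N_pos)
  show "incr_bij (rot_y r k)" "x \<le> rot_y r k x" by (auto simp: rot_y_def incr y_ge)
  show "x \<le> rot_s r k \<Longrightarrow> rot_y r k x = x" by (auto simp: rot_y_def rot_s_def y_fix split: if_splits)
  show "rot_s r k < x \<Longrightarrow> x < rot_s r (Suc k) \<Longrightarrow> x < rot_y r k x"
    using shift_gt y_gt[of "k + r" x] by (auto simp: rot_y_def rot_s_def split: if_splits)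
  show "t (Suc k + r) \<le> x \<Longrightarrow> rot_y r k x = rot_y r 0 x"
    using y_shift[of "k + r" x] by (auto simp: rot_y_def)
  show "1 \<le> k \<Longrightarrow> t (k + r) \<le> rot_s r k" using t_le_s[of "k + r"] by (simp add: rot_s_def)
  show "rot_s r k < t (Suc k + r)" using s_less_t'[of 0 "Suc r"] s_less_t[of "k + r"] by (simp add: rot_s_def)
  show "1 \<le> k \<Longrightarrow> rot_y r (k + N) (rot_y r 0 x) = rot_y r 0 (rot_y r k x)"
    using y_period[of "k + r" x] by (simp add: rot_y_def ac_simps)
  show "1 \<le> k \<Longrightarrow> rot_s r (k + N) = rot_y r 0 (rot_s r k)"
    using s_period[of "k + r"] by (simp add: rot_y_def rot_s_def ac_simps)
  show "1 \<le> k \<Longrightarrow> t (k + N + r) = rot_y r 0 (t (k + r))"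
    using t_period[of "k + r"] by (simp add: rot_y_def ac_simps)
qed

text \<open>A dropped letter \<open>k\<close> comes back as
  \<open>fun_inv (y 0) \<circ> y (k + N) \<circ> y 0\<close>, since \<open>k + N\<close> exceeds
  \<open>r\<close>.\<close>

lemma generate_rot:
  assumes "r < N" shows "generate line_group (range (rot_y r)) = G"
proof
  have 0: "y 0 \<in> generate line_group (range (rot_y r))"
    using generate.incl[of "rot_y r 0" "range (rot_y r)" line_group] by (simp add: rot_y_def)
  have A: "\<And>f. f \<in> range (rot_y r) \<Longrightarrow> incr_bij f" by (auto simp: rot_y_def incr)
  have B: "\<And>f. f \<in> range y \<Longrightarrow> incr_bij f" by (auto simp: incr)
  have big: "y k \<in> generate line_group (range (rot_y r))" if "r < k" for k
  proof -
    have "y k = rot_y r (k - r)" using that by (simp add: rot_y_def)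
    then show ?thesis by (metis generate.incl rangeI)
  qed
  show "generate line_group (range (rot_y r)) \<subseteq> G"
    by (rule generate_subsetI[OF B]) (auto simp: rot_y_def y_in_G)
  show "G \<subseteq> generate line_group (range (rot_y r))"
  proof (rule generate_subsetI[OF A])
    fix f assume "f \<in> range y"
    then obtain k where f: "f = y k" by auto
    have "f = fun_inv (y 0) \<circ> (y (k + N) \<circ> y 0)" if "1 \<le> k"
      using y_period[OF that] f by (simp add: fun_eq_iff y.inv_eq)
    then show "f \<in> generate line_group (range (rot_y r))"
      using 0 big[of "k + N"] assms f by (cases "k = 0") (auto intro!: generate_comp generate_inv[OF A])
  qed
qed

lemma rot_idx_eq: "r < N \<Longrightarrow> U \<in> F \<Longrightarrow> V \<in> F \<Longrightarrow> rot_idx r U = rot_idx r V \<longleftrightarrow> idx U = idx V"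
  using idx_le[of U] idx_le[of V] by (auto simp: rot_idx_def split: if_splits)

lemma rot_idx_0: "r < N \<Longrightarrow> rot_idx r U = 0 \<longleftrightarrow> idx U = 0"
  by (auto simp: rot_idx_def)

lemma tracking_rot:
  assumes r: "r < N"
  shows "tracking N (rot_y r) (rot_s r) (\<lambda>k. t (k + r)) \<Omega> D F (rot_rep r) (rot_idx r)"
proof (intro tracking.intro bump_chain_rot tracking_axioms.intro)
  fix U V
  show "disjoint_feet \<Omega>" "D \<subseteq> \<Omega>" "F \<subseteq> \<Omega>" "D \<inter> F = {}" by (fact feet D_sub F_sub DF)+
  show "U \<in> F \<Longrightarrow> rot_rep r U \<in> generate line_group (range (rot_y r))"
    unfolding generate_rot[OF r] by (auto simp: rot_rep_def rep_G y_in_G intro: generate_comp)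
  show "U \<in> F \<Longrightarrow> rot_idx r U \<le> N" using idx_le[of U] by (auto simp: rot_idx_def)
  show "U \<in> F \<Longrightarrow> rot_idx r U = 0 \<Longrightarrow> snd U \<le> rot_s r 0"
    using outer by (simp add: rot_idx_0[OF r] rot_s_def)
  show "t (rot_idx r U + r) \<le> rot_rep r U (fst U) \<and> rot_rep r U (snd U) \<le> rot_s r (rot_idx r U)"
    if "U \<in> F" "rot_idx r U \<noteq> 0"
  proof -
    have n: "idx U \<noteq> 0" using that rot_idx_0[OF r] by simp
    note i = inner[OF that(1) n]
    show ?thesis
    proof (cases "r < idx U")
      case True
      then show ?thesis using i n by (simp add: rot_idx_def rot_rep_def rot_s_def)
    next
      case False
      then have "rot_idx r U + r = idx U + N" "rot_idx r U \<noteq> 0" using n r by (auto simp: rot_idx_def)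
      then show ?thesis using i n False by (simp add: rot_rep_def rot_s_def s_period t_period)
    qed
  qed
  show "rot_rep r U (snd U) \<le> rot_rep r V (fst V)" if "U \<in> F" "V \<in> F" "prec D (rot_idx r) U V"
  proof -
    have "prec D idx U V" using that rot_idx_eq[OF r] rot_idx_0[OF r] by (auto simp: prec_def)
    then have "rep U (snd U) \<le> rep V (fst V)" "idx U = idx V" using that ordered by (auto simp: prec_def)
    then show ?thesis by (auto simp: rot_rep_def)
  qed
  show "U \<in> F \<Longrightarrow> V \<in> F \<Longrightarrow> before U V \<Longrightarrow> \<not> sep D U V \<Longrightarrow> rot_idx r U = rot_idx r V"
    using adjacent rot_idx_eq[OF r] by blast
  show "U \<in> D \<Longrightarrow> rot_s r 0 \<le> fst U" using s0_le by (simp add: rot_s_def)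
qed

end

lemma (in chain_period) tracking_period:
  assumes "disjoint_feet \<Omega>" "D \<subseteq> \<Omega>" "F \<subseteq> \<Omega>" "D \<inter> F = {}"
    and "\<And>U. U \<in> F \<Longrightarrow> rep U \<in> generate line_group (y ` {..N})"
    and idx: "\<And>U. U \<in> F \<Longrightarrow> idx U \<le> N"
    and "\<And>U. U \<in> F \<Longrightarrow> idx U = 0 \<Longrightarrow> snd U \<le> s 0"
    and inner: "\<And>U. U \<in> F \<Longrightarrow> idx U \<noteq> 0 \<Longrightarrow> t (idx U) \<le> rep U (fst U) \<and> rep U (snd U) \<le> s (idx U)"
    and "\<And>U V. U \<in> F \<Longrightarrow> V \<in> F \<Longrightarrow> prec D idx U V \<Longrightarrow> rep U (snd U) \<le> rep V (fst V)"
    and "\<And>U V. U \<in> F \<Longrightarrow> V \<in> F \<Longrightarrow> before U V \<Longrightarrow> \<not> sep D U V \<Longrightarrow> idx U = idx V"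
    and "\<And>W. W \<in> D \<Longrightarrow> s 0 \<le> fst W"
  shows "tracking N Y S T \<Omega> D F rep idx"
proof (intro tracking.intro chain tracking_axioms.intro)
  fix U assume U: "U \<in> F" "idx U \<noteq> 0"
  show "T (idx U) \<le> rep U (fst U) \<and> rep U (snd U) \<le> S (idx U)"
    using inner[OF U] idx[OF U(1)] U(2) by (simp add: S_small T_small)
qed (use assms in \<open>auto simp: generate_Y S_small\<close>)

section \<open>Bumps with real end points\<close>

locale bump = incr_bij b for b :: "real \<Rightarrow> real" +
  fixes a c :: real
  assumes a_less_c: "a < c" and left_fix: "x \<le> a \<Longrightarrow> b x = x" and right_fix: "c \<le> x \<Longrightarrow> b x = x"
    and moves: "a < x \<Longrightarrow> x < c \<Longrightarrow> x < b x"
begin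

lemma ge: "x \<le> b x"
  using left_fix[of x] right_fix[of x] moves[of x] by linarith

lemma less_c: "x < c \<Longrightarrow> b x < c"
  using less_iff[of x c] right_fix[of c] by simp

lemma le_c: "x \<le> c \<Longrightarrow> b x \<le> c"
  using le_iff[of x c] right_fix[of c] by simp

lemma a_less: "a < x \<Longrightarrow> a < b x"
  using ge[of x] by simp

lemma inv_fix_left: "x \<le> a \<Longrightarrow> fun_inv b x = x"
  using left_fix[of x] inv_eq[of x x] by simp

lemma inv_fix_right: "c \<le> x \<Longrightarrow> fun_inv b x = x"
  using right_fix[of x] inv_eq[of x x] by simp

lemma inv_ge: "fun_inv b x \<le> x"
  using ge[of x] by (simp add: inv_le)

lemma inv_a_less: "a < x \<Longrightarrow> a < fun_inv b x"
  using left_fix[of a] by (simp add: less_inv)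

lemma conj_bump:
  assumes "incr_bij q" shows "bump (q \<circ> b \<circ> fun_inv q) (q a) (q c)"
proof -
  interpret q: incr_bij q by fact
  interpret k: incr_bij "q \<circ> b \<circ> fun_inv q" by (intro incr_bij_conj assms incr_bij_axioms)
  show ?thesis
  proof unfold_locales
    fix x
    show "q a < q c" using a_less_c by simp
    show "x \<le> q a \<Longrightarrow> (q \<circ> b \<circ> fun_inv q) x = x"
      using left_fix[of "fun_inv q x"] by (simp add: q.inv_le)
    show "q c \<le> x \<Longrightarrow> (q \<circ> b \<circ> fun_inv q) x = x"
      using right_fix[of "fun_inv q x"] by (simp add: q.le_inv)
    show "q a < x \<Longrightarrow> x < q c \<Longrightarrow> x < (q \<circ> b \<circ> fun_inv q) x"
      using moves[of "fun_inv q x"] q.less_iff[of "fun_inv q x"] by (simp add: q.inv_less q.less_inv)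
  qed
qed

end

subsection \<open>Two crossing bumps\<close>

locale crossing_pair = b: bump b ab cb + p: bump p ap cp
  for b ab cb p ap cp +
  fixes mb mp :: real and \<Omega> F :: "foot set"
  assumes feet: "disjoint_feet \<Omega>"
    and in_\<Omega>: "(ab, mb) \<in> \<Omega>" "(b mb, cb) \<in> \<Omega>" "(ap, mp) \<in> \<Omega>" "(p mp, cp) \<in> \<Omega>"
    and order: "mb \<le> ap" "mp \<le> b mb" "cb \<le> p mp"
    and F_def: "F = \<Omega> - {(ab, mb), (b mb, cb), (ap, mp), (p mp, cp)}"
    and F_left: "U \<in> F \<Longrightarrow> snd U \<le> p mp"
begin

lemma lt: "ab < mb" "ap < mp" "b mb < cb" "p mp < cp"
  using feet in_\<Omega> unfolding disjoint_feet_def by auto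

lemma lt': "mb < cb" "mp < cp" "ap < cb" "ab < cp" "mp < cb"
  using lt order b.ge[of mb] p.ge[of mp] by auto

text \<open>The second letter is \<open>p\<close> conjugated by \<open>b\<close>. It is trivial up
  to \<open>b ap\<close> and agrees with \<open>b \<circ> p\<close> beyond \<open>cb\<close>, where
  \<open>b\<close> is trivial. With period one, \<open>yy 0 (tt 1)\<close> has to be the point where
  this agreement begins, so \<open>tt 1\<close> is the preimage of \<open>cb\<close>.\<close>

definition yy :: "nat \<Rightarrow> real \<Rightarrow> real" where
  "yy k = (if k = 0 then b \<circ> p else b \<circ> p \<circ> fun_inv b)"
definition ss :: "nat \<Rightarrow> real" where
  "ss k = (if k = 0 then ab else b ap)"
definition tt :: "nat \<Rightarrow> real" where
  "tt k = fun_inv (b \<circ> p) cb"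

sublocale bp: incr_bij "b \<circ> p"
  by (rule incr_bij_comp[OF b.incr_bij_axioms p.incr_bij_axioms])

lemma bp_inv [simp]: "b (p (fun_inv (b \<circ> p) x)) = x"
  using bp.f_inv[of x] by simp

sublocale P: chain_period 1 yy ss tt
proof (rule chain_period.intro)
  fix k :: nat and x :: real
  show "incr_bij (yy k)"
    by (auto simp: yy_def intro: bp.incr_bij_axioms incr_bij_conj b.incr_bij_axioms p.incr_bij_axioms)
  show "x \<le> yy k x"
    using b.ge[of "p x"] p.ge[of x] p.ge[of "fun_inv b x"] by (cases "k = 0") (auto simp: yy_def b.inv_le)
  show "x \<le> ss k \<Longrightarrow> yy k x = x"
    using p.left_fix[of x] b.left_fix[of x] p.left_fix[of "fun_inv b x"] order lt
    by (auto simp: yy_def ss_def b.inv_le split: if_splits)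
  show "x < yy k x" if "k < 1" "ss k < x" "x < ss (Suc k)"
  proof -
    have "x < cb" using that b.less_c[of ap] lt' by (simp add: ss_def)
    then have "x < b x" using b.moves that by (simp add: ss_def)
    then show ?thesis using that p.ge[of x] b.le_iff[of x "p x"] by (simp add: yy_def del: b.le_iff)
  qed
  show "x < yy 1 x" if "ss 1 < x" "x < yy 0 (ss 1)"
  proof -
    have "fun_inv b x < p (b ap)" using that by (simp add: yy_def ss_def b.inv_less)
    also have "p (b ap) < cp" using b.less_c[of ap] p.less_c[of "b ap"] lt' lt p.ge[of mp] order by simp
    finally have "fun_inv b x < p (fun_inv b x)" using that p.moves[of "fun_inv b x"] by (simp add: ss_def b.less_inv)
    then show ?thesis by (simp add: yy_def b.inv_less)
  qed
  show "yy 0 (tt 1) \<le> x \<Longrightarrow> yy 1 x = yy 0 x"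
    using b.inv_fix_right[of x] bp.f_inv[of cb] by (simp add: yy_def tt_def)
  show "tt k \<le> ss k" if "1 \<le> k"
  proof -
    have "cb \<le> p (b ap)" using order b.le_iff[of mb ap] p.le_iff[of mp "b ap"] by linarith
    then have "cb \<le> b (p (b ap))" using b.ge[of "p (b ap)"] by simp
    then show ?thesis using that by (simp add: ss_def tt_def bp.inv_le)
  qed
  show "k < 1 \<Longrightarrow> ss k < tt (Suc k)"
    using p.left_fix[of ab] b.left_fix[of ab] order lt lt' by (simp add: ss_def tt_def bp.less_inv)
  show "ss 1 < yy 0 (tt 1)"
    using b.less_c[of ap] lt' bp.f_inv[of cb] by (simp add: ss_def tt_def yy_def)
qed simp_all

text \<open>Before the common factor \<open>fun_inv (b \<circ> p)\<close> is applied, the three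
  intervals between consecutive used feet fill the stretches from \<open>cb\<close> to
  \<open>p mp\<close>, from \<open>p mp\<close> to \<open>p (b mb)\<close> and from
  \<open>p (b mb)\<close> to \<open>p (b ap)\<close>, the rightmost interval coming first.\<close>

definition rep where
  "rep U = (if before U (ap, mp) then fun_inv (b \<circ> p) \<circ> (p \<circ> b)
            else if before U (b mb, cb) then fun_inv (b \<circ> p) \<circ> p else fun_inv (b \<circ> p))"
definition idx :: "foot \<Rightarrow> nat" where
  "idx U = (if before U (ab, mb) then 0 else 1)"

abbreviation "D \<equiv> {(ab, mb), (b mb, cb), (ap, mp), (p mp, cp)}"

text \<open>The fifth possibility, a foot beyond the right foot of \<open>p\<close>, is removed by
  \<open>F_left\<close>.\<close>

lemma foot_position:
  assumes "U \<in> F"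
  obtains "snd U \<le> ab" | "mb \<le> fst U" "snd U \<le> ap" | "mp \<le> fst U" "snd U \<le> b mb"
    | "cb \<le> fst U" "snd U \<le> p mp"
proof -
  have "U \<in> \<Omega>" "\<And>V. V \<in> D \<Longrightarrow> U \<noteq> V" using assms F_def by auto
  then have "before U (ab, mb) \<or> before (ab, mb) U" "before U (b mb, cb) \<or> before (b mb, cb) U"
    "before U (ap, mp) \<or> before (ap, mp) U" "fst U < snd U"
    using feet in_\<Omega> unfolding disjoint_feet_def by auto
  then show ?thesis using that F_left[OF assms] by (fastforce simp: before_def)
qed

lemma generate_yy: "generate line_group (yy ` {..1}) = generate line_group {b, p}"
proof
  have 01: "{..1::nat} = {0, 1}" by auto
  have A: "\<And>f. f \<in> {b, p} \<Longrightarrow> incr_bij f" using b.incr_bij_axioms p.incr_bij_axioms by auto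
  have B: "\<And>f. f \<in> yy ` {..1} \<Longrightarrow> incr_bij f" using P.incr by auto
  have gb: "b \<in> generate line_group {b, p}" "p \<in> generate line_group {b, p}" by (auto intro: generate.incl)
  show "generate line_group (yy ` {..1}) \<subseteq> generate line_group {b, p}"
    by (rule generate_subsetI[OF A]) (auto simp: 01 yy_def gb intro!: generate_comp generate_inv[OF A])
  have y: "yy 0 \<in> generate line_group (yy ` {..1})" "yy 1 \<in> generate line_group (yy ` {..1})"
    by (auto intro: generate.incl)
  have eb: "b = fun_inv (yy 1) \<circ> yy 0"
  proof
    fix x
    have "yy 0 x = yy 1 (b x)" by (simp add: yy_def)
    then show "b x = (fun_inv (yy 1) \<circ> yy 0) x"
      using incr_bij.inv_f[OF P.incr[of 1]] by simp
  qed
  have b: "b \<in> generate line_group (yy ` {..1})"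
    by (subst eb) (intro generate_comp generate_inv[OF B] y)
  have ep: "p = fun_inv b \<circ> yy 0" by (simp add: fun_eq_iff yy_def)
  have p: "p \<in> generate line_group (yy ` {..1})"
    by (subst ep) (intro generate_comp generate_inv[OF B] y b)
  show "generate line_group {b, p} \<subseteq> generate line_group (yy ` {..1})"
    by (rule generate_subsetI[OF B]) (use b p in auto)
qed

lemma rep_values:
  assumes "U \<in> F"
  shows "mb \<le> fst U \<Longrightarrow> snd U \<le> ap \<Longrightarrow> idx U = 1 \<and> rep U x = fun_inv (b \<circ> p) (p (b x))"
    and "mp \<le> fst U \<Longrightarrow> snd U \<le> b mb \<Longrightarrow> idx U = 1 \<and> rep U x = fun_inv (b \<circ> p) (p x)"
    and "cb \<le> fst U \<Longrightarrow> idx U = 1 \<and> rep U x = fun_inv (b \<circ> p) x"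
proof -
  have "fst U < snd U" using feet assms F_def unfolding disjoint_feet_def by auto
  then show "mb \<le> fst U \<Longrightarrow> snd U \<le> ap \<Longrightarrow> idx U = 1 \<and> rep U x = fun_inv (b \<circ> p) (p (b x))"
    and "mp \<le> fst U \<Longrightarrow> snd U \<le> b mb \<Longrightarrow> idx U = 1 \<and> rep U x = fun_inv (b \<circ> p) (p x)"
    and "cb \<le> fst U \<Longrightarrow> idx U = 1 \<and> rep U x = fun_inv (b \<circ> p) x"
    using order lt lt' by (auto simp: idx_def rep_def before_def)
qed

lemma tracking: "tracking 1 P.Y P.S P.T \<Omega> D F rep idx"
proof (rule P.tracking_period)
  show "disjoint_feet \<Omega>" "D \<subseteq> \<Omega>" "F \<subseteq> \<Omega>" "D \<inter> F = {}"
    using feet in_\<Omega> F_def by auto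
  have A: "\<And>f. f \<in> {b, p} \<Longrightarrow> incr_bij f" using b.incr_bij_axioms p.incr_bij_axioms by auto
  have gb: "b \<in> generate line_group {b, p}" "p \<in> generate line_group {b, p}" by (auto intro: generate.incl)
  fix U
  show "rep U \<in> generate line_group (yy ` {..1})"
    unfolding generate_yy by (auto simp: rep_def gb intro!: generate_comp generate_inv[OF A])
  show "idx U \<le> 1" by (simp add: idx_def)
  show "idx U = 0 \<Longrightarrow> snd U \<le> ss 0" by (simp add: idx_def ss_def before_def split: if_splits)
  show "W \<in> D \<Longrightarrow> ss 0 \<le> fst W" for W
    using lt order b.ge[of mb] p.ge[of mp] by (auto simp: ss_def)
  have p1: "p (b mb) \<le> p (b ap)" "p mp \<le> p (b mb)" using order by auto
  have p2: "p (b ap) \<le> b (p (b ap))" by (rule b.ge)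
  show "tt (idx U) \<le> rep U (fst U) \<and> rep U (snd U) \<le> ss (idx U)" if U: "U \<in> F" "idx U \<noteq> 0"
    using U(1)
  proof (cases rule: foot_position)
    case 1
    then show ?thesis using U by (simp add: idx_def before_def)
  next
    case 2
    have "p (b mb) \<le> p (b (fst U))" "p (b (snd U)) \<le> p (b ap)" using 2 by auto
    then show ?thesis using rep_values(1)[OF U(1) 2] order p1 p2 
      by (simp add: tt_def ss_def bp.inv_le del: p.le_iff b.le_iff)
  next
    case 3
    have "p mp \<le> p (fst U)" "p (snd U) \<le> p (b mb)" using 3 by auto
    then show ?thesis using rep_values(2)[OF U(1) 3] order p1 p2 
      by (simp add: tt_def ss_def bp.inv_le del: p.le_iff b.le_iff)
  next
    case 4
    then show ?thesis using rep_values(3)[OF U(1)] order p1 p2 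
      by (simp add: tt_def ss_def bp.inv_le del: p.le_iff b.le_iff)
  qed
  fix V assume U: "U \<in> F" and V: "V \<in> F"
  have ne: "fst U < snd U" "fst V < snd V" using feet U V F_def unfolding disjoint_feet_def by auto
  note o = lt order lt' b.ge[of mb] p.ge[of mp]
  show "idx U = idx V" if "before U V" "\<not> sep D U V"
    using that o ne by (cases rule: foot_position[OF U]; cases rule: foot_position[OF V])
      (auto simp: idx_def sep_def before_def)
  assume pr: "prec D idx U V"
  have pr': "before U V \<and> \<not> sep D U V \<or> before V U \<and> sep D V U" and n: "idx U \<noteq> 0" "idx V \<noteq> 0"
    using pr by (auto simp: prec_def)
  show "rep U (snd U) \<le> rep V (fst V)"
    using U
  proof (cases rule: foot_position)
    case 1
    then show ?thesis using n by (simp add: idx_def before_def)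
  next
    case u: 2
    show ?thesis using V
    proof (cases rule: foot_position)
      case 1
      then show ?thesis using n by (simp add: idx_def before_def)
    next
      case v: 2
      have "snd U \<le> fst V" using pr' u v o ne by (auto simp: sep_def before_def)
      then show ?thesis using rep_values(1)[OF U u] rep_values(1)[OF V v] by simp
    next
      case v: 3
      \<comment> \<open>Here \<open>V\<close> lies to the right of \<open>U\<close> beyond a used
        foot, so \<open>prec\<close> would ask for the opposite order.\<close>
      have False using pr' u v o ne by (auto simp: sep_def before_def)
      then show ?thesis ..
    next
      case v: 4
      have False using pr' u v o ne by (auto simp: sep_def before_def)
      then show ?thesis ..
    qed
  next
    case u: 3
    show ?thesis using V
    proof (cases rule: foot_position)
      case 1
      then show ?thesis using n by (simp add: idx_def before_def)
    next
      case v: 2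
      have "snd U \<le> b (fst V)" using u v b.le_iff[of mb "fst V"] by linarith
      then show ?thesis using rep_values(2)[OF U u] rep_values(1)[OF V v] by simp
    next
      case v: 3
      have "snd U \<le> fst V" using pr' u v o ne by (auto simp: sep_def before_def)
      then show ?thesis using rep_values(2)[OF U u] rep_values(2)[OF V v] by simp
    next
      case v: 4
      have False using pr' u v o ne by (auto simp: sep_def before_def)
      then show ?thesis ..
    qed
  next
    case u: 4
    show ?thesis using V
    proof (cases rule: foot_position)
      case 1
      then show ?thesis using n by (simp add: idx_def before_def)
    next
      case v: 2
      have "snd U \<le> p (b (fst V))"
        using u v p1 p.le_iff[of "b mb" "b (fst V)"] b.le_iff[of mb "fst V"] by linarith
      then show ?thesis using rep_values(3)[OF U u(1)] rep_values(1)[OF V v] by simp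
    next
      case v: 3
      have "snd U \<le> p (fst V)" using u v p.le_iff[of mp "fst V"] by linarith
      then show ?thesis using rep_values(3)[OF U u(1)] rep_values(2)[OF V v] by simp
    next
      case v: 4
      have "snd U \<le> fst V" using pr' u v o ne by (auto simp: sep_def before_def)
      then show ?thesis using rep_values(3)[OF U u(1)] rep_values(3)[OF V v(1)] by simp
    qed
  qed
qed

end

subsection \<open>Adding a bump on the left\<close>

lemma (in bump_chain) G_fix: "g \<in> G \<Longrightarrow> x \<le> s 0 \<Longrightarrow> g x = x"
proof -
  assume g: "g \<in> G" and x: "x \<le> s 0"
  obtain q p where "\<And>x. wp q (g x) = wp p x" using G_fraction[OF g] by blast
  moreover have "wp p x = x" "wp q x = x" by (rule wp_fix[of _ 0]; simp add: x)+
  ultimately show ?thesis using incr_bij.eq_iff[OF incr_wp] by metis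
qed

lemma (in tracking) inner_right: "U \<in> F \<Longrightarrow> idx U \<noteq> 0 \<Longrightarrow> s 0 < fst U"
proof -
  assume U: "U \<in> F" "idx U \<noteq> 0"
  have "s 0 < rep U (fst U)" using inner[of U] s_less_t'[of 0 "idx U"] U by simp
  then show ?thesis
    using G_fix[OF rep_G[OF U(1)], of "s 0"] incr_bij.less_iff[OF incr_rep[OF U(1)], of "s 0"] by simp
qed

text \<open>The bump \<open>\<beta>\<close> is the new one conjugated into position: the left foot
  waits outside the support and stays where it is, while the right foot has been carried into gap
  \<open>1\<close>. So \<open>\<beta>\<close> is trivial beyond that gap.\<close>

locale left_step = tracking + \<beta>: bump \<beta> \<alpha> \<gamma> for \<beta> \<alpha> \<gamma> +
  fixes L R :: foot
  assumes LF: "L \<in> F" and RF: "R \<in> F" and LR: "before L R"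
    and idx_L: "idx L = 0" and idx_R: "idx R = 1"
    and \<alpha>: "\<alpha> = fst L" and \<gamma>: "\<gamma> = rep R (snd R)" and \<mu>: "\<beta> (snd L) = rep R (fst R)"
begin

lemma facts: "\<alpha> < snd L" "snd L \<le> s 0" "\<alpha> < s 0" "s 0 < t 1" "t 1 \<le> \<beta> (snd L)" "\<beta> (snd L) \<le> \<beta> (s 0)"
  "\<beta> (s 0) < \<gamma>" "\<gamma> \<le> s 1" "s 1 < t 2"
proof -
  show "\<alpha> < snd L" using foot_less[OF LF] \<alpha> by simp
  show L: "snd L \<le> s 0" using outer[OF LF idx_L] .
  then show "\<alpha> < s 0" using \<open>\<alpha> < snd L\<close> by simp
  show s0: "s 0 < t 1" using s_less_t[of 0] by simp
  show t1: "t 1 \<le> \<beta> (snd L)" "\<gamma> \<le> s 1" using inner[OF RF] idx_R \<gamma> \<mu> by auto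
  show "\<beta> (snd L) \<le> \<beta> (s 0)" using L by simp
  have "s 0 < \<gamma>" using s0 t1 rep_less[OF RF] \<gamma> \<mu> by simp
  then show "\<beta> (s 0) < \<gamma>" by (rule \<beta>.less_c)
  show "s 1 < t 2" using s_less_t[of 1] by (simp add: numeral_2_eq_2)
qed

lemma t1_le: "t 1 \<le> \<beta> (s 0)"
  using facts(5,6) by linarith

text \<open>The first two letters repeat the pattern of the crossing pair, with
  \<open>\<beta>\<close> for \<open>b\<close> and \<open>y 0\<close> for \<open>p\<close>. The old
  gap \<open>1\<close> leaves two gaps, from \<open>t 1\<close> to \<open>\<beta> (s 0)\<close> and
  from \<open>\<gamma>\<close> to \<open>s 1\<close>. The portion of the first one beyond
  \<open>\<beta> (snd L)\<close> lies inside the right foot and receives the feet that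
  \<open>\<beta>\<close> brings over from the left.\<close>

definition yy :: "nat \<Rightarrow> real \<Rightarrow> real" where
  "yy k = (if k = 0 then \<beta> \<circ> y 0 else if k = 1 then \<beta> \<circ> y 0 \<circ> fun_inv \<beta> else y (k - 1))"
definition ss :: "nat \<Rightarrow> real" where
  "ss k = (if k = 0 then \<alpha> else if k = 1 then \<beta> (s 0) else s (k - 1))"
definition tt :: "nat \<Rightarrow> real" where
  "tt k = (if k = 1 then t 1 else if k = 2 then \<gamma> else t (k - 1))"

text \<open>One period after \<open>t 1\<close> the points are beyond \<open>t 2\<close>, hence
  beyond \<open>\<gamma>\<close>, where \<open>\<beta>\<close> is trivial.\<close>

lemma shift_right_fix: "t 1 \<le> x \<Longrightarrow> \<beta> (y 0 x) = y 0 x"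
proof -
  assume "t 1 \<le> x"
  then have "t (1 + N) \<le> y 0 x" using t_period[of 1] by simp
  then have "t 2 \<le> y 0 x" using t_mono[of 2 "1 + N"] N_pos by simp
  then show ?thesis using \<beta>.right_fix facts by simp
qed

sublocale P: chain_period "Suc N" yy ss tt
proof (rule chain_period.intro)
  fix k :: nat and x :: real
  show "incr_bij (yy k)"
    by (auto simp: yy_def intro!: incr incr_bij_comp incr_bij_conj \<beta>.incr_bij_axioms)
  show "x \<le> yy k x"
    using \<beta>.ge[of "y 0 x"] y_ge[of x 0] y_ge[of "fun_inv \<beta> x" 0] y_ge[of x "k - 1"]
    by (auto simp: yy_def \<beta>.inv_le)
  show "x \<le> ss k \<Longrightarrow> yy k x = x"
    using y_fix[of x 0] y_fix[of "fun_inv \<beta> x" 0] \<beta>.left_fix[of x] y_fix[of x "k - 1"] facts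
    by (auto simp: yy_def ss_def \<beta>.inv_le split: if_splits)
  show "x < yy k x" if "k < Suc N" "ss k < x" "x < ss (Suc k)"
  proof -
    consider "k = 0" | "k = 1" | "2 \<le> k" by linarith
    then show ?thesis
    proof cases
      case 1
      then have "x < \<beta> x" using that facts \<beta>.moves[of x] by (simp add: ss_def)
      moreover have "\<beta> x \<le> \<beta> (y 0 x)" using y_ge by simp
      ultimately have "x < \<beta> (y 0 x)" by linarith
      then show ?thesis using 1 by (simp add: yy_def)
    next
      case 2
      then have x: "\<beta> (s 0) < x" "x < s 1" using that by (auto simp: ss_def)
      have "s 0 < fun_inv \<beta> x" using x by (simp add: \<beta>.less_inv)
      moreover have "fun_inv \<beta> x < s 1" using x \<beta>.inv_ge[of x] by simp
      ultimately have "fun_inv \<beta> x < y 0 (fun_inv \<beta> x)" using y_gt[of 0] by simp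
      then show ?thesis using 2 by (simp add: yy_def \<beta>.inv_less)
    next
      case 3
      then show ?thesis using that y_gt[of "k - 1" x] by (simp add: ss_def yy_def)
    qed
  qed
  show "x < yy (Suc N) x" if "ss (Suc N) < x" "x < yy 0 (ss 1)"
  proof -
    have "t 1 \<le> \<beta> (s 0)" using facts(5,6) by linarith
    then have "yy 0 (ss 1) = y 0 (\<beta> (s 0))" using shift_right_fix[of "\<beta> (s 0)"] by (simp add: yy_def ss_def)
    also have "\<dots> < y 0 (s 1)" using facts by simp
    also have "\<dots> = s (Suc N)" using s_period[of 1] by simp
    finally show ?thesis using that N_pos y_gt[of N x] by (simp add: ss_def yy_def)
  qed
  show "yy k x = yy 0 x" if "k < Suc N" "tt (Suc k) \<le> x"
  proof -
    consider "k = 0" | "k = 1" | "2 \<le> k" by linarith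
    then show ?thesis
    proof cases
      case 2
      then show ?thesis using that \<beta>.inv_fix_right[of x] by (simp add: yy_def tt_def numeral_2_eq_2)
    next
      case 3
      then have "t k \<le> x" using that by (simp add: tt_def)
      then have "t (Suc (k - 1)) \<le> x" "t 1 \<le> x" using 3 t_mono[of 1 k] by auto
      then show ?thesis using 3 y_shift[of "k - 1" x] shift_right_fix[of x] by (simp add: yy_def)
    qed simp
  qed
  have last: "yy 0 (tt 1) = t (Suc N)"
    using shift_right_fix[of "t 1"] t_period[of 1] by (simp add: yy_def tt_def)
  show "yy (Suc N) x = yy 0 x" if "yy 0 (tt 1) \<le> x"
  proof -
    have "t (Suc N) \<le> x" using that last by simp
    moreover from this have "t 1 \<le> x" using t_mono[of 1 "Suc N"] by simp
    ultimately show ?thesis using y_shift[of N x] shift_right_fix[of x] N_pos by (simp add: yy_def)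
  qed
  show "tt k \<le> ss k" if k: "1 \<le> k"
  proof -
    consider "k = 1" | "k = 2" | "3 \<le> k" using k by linarith
    then show ?thesis
      by cases (use facts t1_le t_le_s[of "k - 1"] in \<open>auto simp: tt_def ss_def\<close>)
  qed
  show "ss k < tt (Suc k)" if "k < Suc N"
  proof -
    consider "k = 0" | "k = 1" | "2 \<le> k" by linarith
    then show ?thesis
      by cases (use facts s_less_t[of "k - 1"] in \<open>auto simp: tt_def ss_def\<close>)
  qed
  show "ss (Suc N) < yy 0 (tt 1)"
    using last s_less_t[of N] N_pos by (simp add: ss_def)
qed simp

text \<open>First \<open>\<beta> = fun_inv (yy 1) \<circ> yy 0\<close> is recovered, then
  \<open>y 0\<close>; letters above \<open>N\<close> are conjugates of earlier ones by
  \<open>y 0\<close>.\<close>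

lemma generate_yy: "generate line_group (yy ` {..Suc N}) = generate line_group (insert \<beta> (range y))"
proof
  have A: "\<And>f. f \<in> insert \<beta> (range y) \<Longrightarrow> incr_bij f" using \<beta>.incr_bij_axioms incr by auto
  have B: "\<And>f. f \<in> yy ` {..Suc N} \<Longrightarrow> incr_bij f" using P.incr by auto
  have g: "\<beta> \<in> generate line_group (insert \<beta> (range y))" "y k \<in> generate line_group (insert \<beta> (range y))" for k
    by (auto intro: generate.incl)
  show "generate line_group (yy ` {..Suc N}) \<subseteq> generate line_group (insert \<beta> (range y))"
    by (rule generate_subsetI[OF A]) (auto simp: yy_def g intro!: generate_comp generate_inv[OF A])
  let ?H = "generate line_group (yy ` {..Suc N})"
  have h: "k \<le> Suc N \<Longrightarrow> yy k \<in> ?H" for k by (auto intro: generate.incl)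
  have "\<beta> = fun_inv (yy 1) \<circ> yy 0"
  proof
    fix x
    have "yy 0 x = yy 1 (\<beta> x)" by (simp add: yy_def)
    then show "\<beta> x = (fun_inv (yy 1) \<circ> yy 0) x" using incr_bij.inv_f[OF P.incr[of 1]] by simp
  qed
  then have \<beta>: "\<beta> \<in> ?H" using h[of 0] h[of 1] by (metis B generate_comp generate_inv le_add1 plus_1_eq_Suc zero_le)
  have "y 0 = fun_inv \<beta> \<circ> yy 0" by (simp add: yy_def fun_eq_iff)
  then have y0: "y 0 \<in> ?H" using h[of 0] \<beta> by (metis B generate_comp generate_inv zero_le)
  have "y k \<in> ?H" for k
  proof (induction k rule: less_induct)
    case (less k)
    consider "k = 0" | "1 \<le> k" "k \<le> N" | "N < k" by linarith
    then show ?case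
    proof cases
      case 2
      then have "y k = yy (Suc k)" by (simp add: yy_def)
      then show ?thesis using h[of "Suc k"] 2 by simp
    next
      case 3
      have "y k = y 0 \<circ> y (k - N) \<circ> fun_inv (y 0)"
        using 3 y_period[of "k - N" "fun_inv (y 0) x" for x] by (simp add: fun_eq_iff)
      moreover have "y (k - N) \<in> ?H" using less 3 N_pos by simp
      ultimately show ?thesis using y0 by (metis B generate_comp generate_inv)
    qed (use y0 in simp)
  qed
  then show "generate line_group (insert \<beta> (range y)) \<subseteq> ?H"
    by (intro generate_subsetI[OF B]) (use \<beta> in auto)
qed

text \<open>Outer feet to the right of \<open>L\<close> are inside the new support. They are put
  into gap \<open>1\<close> beyond all feet that precede \<open>R\<close> there, as the reversal
  demands: they lie further to the left, on the other side of a used foot.\<close>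

definition rep' where
  "rep' U = (if idx U = 0 then \<beta> else rep U)"
definition idx' where
  "idx' U = (if idx U = 0 then (if before U L then 0 else 1)
             else if idx U = 1 \<and> prec D idx U R then 1 else idx U + 1)"

lemma idx'_inner:
  "idx U \<noteq> 0 \<Longrightarrow> idx' U = (if idx U = 1 \<and> prec D idx U R then 1 else idx U + 1)"
  unfolding idx'_def by (simp only: if_False)

abbreviation "F' \<equiv> F - {L, R}"

lemma outer_before: "U \<in> F \<Longrightarrow> V \<in> F \<Longrightarrow> idx U = 0 \<Longrightarrow> idx V \<noteq> 0 \<Longrightarrow> before U V"
  using outer[of U] inner_right[of V] by (simp add: before_def)

lemma tracking': "tracking (Suc N) P.Y P.S P.T \<Omega> (D \<union> {L, R}) F' rep' idx'"
proof (rule P.tracking_period)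
  show "disjoint_feet \<Omega>" "D \<union> {L, R} \<subseteq> \<Omega>" "F' \<subseteq> \<Omega>" "(D \<union> {L, R}) \<inter> F' = {}"
    using feet D_sub F_sub DF LF RF by auto
  have LRF: "{L, R} \<subseteq> F" using LF RF by simp
  have \<beta>in: "\<beta> \<in> generate line_group (insert \<beta> (range y))" by (auto intro: generate.incl)
  have Gsub: "G \<subseteq> generate line_group (insert \<beta> (range y))" by (rule line.mono_generate) auto
  have ss0: "ss 0 = fst L" by (simp add: ss_def flip: \<alpha>)
  fix U
  show "rep' U \<in> generate line_group (yy ` {..Suc N})" if "U \<in> F'"
    unfolding generate_yy using \<beta>in subsetD[OF Gsub rep_G[of U]] that by (simp add: rep'_def)
  show "idx' U \<le> Suc N" if "U \<in> F'" using idx_le[of U] that by (auto simp: idx'_def)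
  show "snd U \<le> ss 0" if "U \<in> F'" "idx' U = 0"
    using that by (auto simp: idx'_def ss0 before_def split: if_splits)
  show "ss 0 \<le> fst W" if "W \<in> D \<union> {L, R}" for W
    using that s0_le[of W] facts(1,2) foot_less[OF LF] LR unfolding ss0 by (auto simp: before_def)
  show "tt (idx' U) \<le> rep' U (fst U) \<and> rep' U (snd U) \<le> ss (idx' U)" if U: "U \<in> F'" "idx' U \<noteq> 0"
  proof (cases "idx U = 0")
    case True
    then have "before L U" using U foot_cases[of U L] LF by (auto simp: idx'_def split: if_splits)
    then have "\<beta> (snd L) \<le> \<beta> (fst U)" by (simp add: before_def)
    then have "t 1 \<le> \<beta> (fst U)" using facts(5) by linarith
    moreover have "\<beta> (snd U) \<le> \<beta> (s 0)" using outer[of U] True U by simp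
    ultimately show ?thesis using U True facts by (simp add: idx'_def rep'_def tt_def ss_def split: if_splits)
  next
    case False
    have i: "t (idx U) \<le> rep U (fst U)" "rep U (snd U) \<le> s (idx U)" using inner[of U] U False by auto
    consider "idx U = 1" "prec D idx U R" | "idx U = 1" "prec D idx R U" | "2 \<le> idx U"
      using False prec_total[of U R] U RF idx_R by fastforce
    then show ?thesis
    proof cases
      case 1
      then have "rep U (snd U) \<le> \<beta> (snd L)" using ordered[of U R] U RF \<mu> by simp
      then have "rep U (snd U) \<le> \<beta> (s 0)" using facts(6) by linarith
      then show ?thesis using 1 i facts by (simp add: idx'_def rep'_def tt_def ss_def)
    next
      case 2
      then have "\<gamma> \<le> rep U (fst U)" using ordered[of R U] U RF \<gamma> by simp
      moreover have "\<not> prec D idx U R" using 2 prec_asym[of U R] U RF by blast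
      ultimately show ?thesis using 2 i facts by (simp add: idx'_def rep'_def tt_def ss_def)
    next
      case 3
      then show ?thesis using i by (simp add: idx'_def rep'_def tt_def ss_def)
    qed
  qed
  fix V assume U: "U \<in> F'" and V: "V \<in> F'"
  have UF: "U \<in> F" and VF: "V \<in> F" using U V by auto
  have ne: "fst U < snd U" "fst V < snd V" "fst L < snd L" using foot_less UF VF LF by auto
  \<comment> \<open>All used feet except \<open>L\<close> lie to the right of every outer foot, so
    nothing separates two outer feet beyond \<open>L\<close>.\<close>
  have D_right: "\<not> sep (D \<union> {L, R}) A B" if "B \<in> F" "idx B = 0" "before L A" "fst A < snd A" for A B
  proof
    assume "sep (D \<union> {L, R}) A B"
    then obtain W where W: "W \<in> D \<union> {L, R}" "before A W" "before W B"
      unfolding sep_def by blast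
    have B: "fst B < snd B" "snd B \<le> s 0" using that outer foot_less by auto
    consider "W \<in> D" | "W = L" | "W = R" using W by auto
    then show False
    proof cases
      case 1
      then show False using W B s0_le[of W] foot_less_D[of W] by (simp add: before_def)
    next
      case 2
      then show False using that W ne before_asym[of L A] by simp
    next
      case 3
      then have "before B W" using outer_before[OF that(1) RF that(2)] idx_R by simp
      then show False using W 3 before_asym[of B R] B foot_less[OF RF] by simp
    qed
  qed
  show "rep' U (snd U) \<le> rep' V (fst V)" if pr: "prec (D \<union> {L, R}) idx' U V"
  proof -
    have ie: "idx' U = idx' V" "idx' U \<noteq> 0" using pr by (auto simp: prec_def)
    consider "idx U = 0" "idx V = 0" | "idx U = 0" "idx V \<noteq> 0" | "idx U \<noteq> 0" "idx V = 0"
      | "idx U \<noteq> 0" "idx V \<noteq> 0" by auto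
    then show ?thesis
    proof cases
      case 1
      then have "\<not> before U L" "\<not> before V L" using ie unfolding idx'_def by metis+
      then have "before L U" "before L V" using foot_cases[OF UF LF] foot_cases[OF VF LF] U V by blast+
      then have "before U V" using pr D_right[of U V] UF ne 1 by (auto simp: prec_def)
      then show ?thesis using 1 by (simp add: rep'_def before_def)
    next
      case 2
      have b: "before U V" by (rule outer_before[OF UF VF 2])
      \<comment> \<open>Contraposition of \<open>adjacent\<close>: the indices differ, so some used
        foot lies between.\<close>
      have "sep D U V" using adjacent[OF UF VF b] 2 by auto
      then have "sep (D \<union> {L, R}) U V" by (auto simp: sep_def)
      then show ?thesis using pr b before_asym[of U V] ne by (auto simp: prec_def)
    next
      case 3
      have v: "idx' V = (if before V L then 0 else 1)" using 3 by (simp add: idx'_def)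
      have "idx' V \<noteq> 0" using ie(1,2) by metis
      then have nb: "\<not> before V L" using v by metis
      then have "idx' U = 1" using v ie(1) by metis
      moreover note idx'_inner[OF 3(1)]
      ultimately have "idx U = 1 \<and> prec D idx U R" using 3(1) by (metis add_cancel_left_left add.commute)
      moreover have "before L V" using nb foot_cases[OF VF LF] V by blast
      ultimately have L: "before L V" "idx U = 1" "prec D idx U R" by blast+
      have "rep U (snd U) \<le> \<beta> (snd L)" using ordered[OF UF RF L(3)] \<mu> by simp
      also have "\<dots> \<le> \<beta> (fst V)" using L(1) by (simp add: before_def)
      finally show ?thesis using 3 by (simp add: rep'_def)
    next
      case 4
      then have e: "idx U = idx V"
        using idx'_inner[of U] idx'_inner[of V] ie(1) by (metis add_right_cancel add_cancel_left_left add.commute)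
      \<comment> \<open>A change of order could come only from \<open>R\<close> arriving between the
        two feet, but then their new indices would be \<open>1\<close> and \<open>2\<close>.\<close>
      have "\<not> (prec D idx V W \<and> prec D idx W U)" if "W \<in> {L, R}" for W
      proof
        assume a: "prec D idx V W \<and> prec D idx W U"
        then have vw: "idx V = idx W" unfolding prec_def by blast
        then have "W = R" using that 4(2) idx_L by auto
        then have "idx V = 1" "prec D idx V R" "\<not> prec D idx U R"
          using a vw idx_R prec_asym[OF UF RF] by auto
        then have "idx' V = 1" "idx' U = idx U + 1"
          using idx'_inner[of U] idx'_inner[of V] 4 by auto
        then show False using ie(1) 4(1) by simp
      qed
      then have "prec D idx U V" using prec_refine[OF UF VF e 4(1) LRF pr] by blast
      then show ?thesis using ordered[OF UF VF] 4 by (simp add: rep'_def)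
    qed
  qed
  show "idx' U = idx' V" if b: "before U V" and n: "\<not> sep (D \<union> {L, R}) U V"
  proof -
    have e: "idx U = idx V" by (rule not_separated_refine(1)[OF UF VF b LRF n])
    show ?thesis
    proof (cases "idx U = 0")
      case True
      have "before U L \<longleftrightarrow> before V L"
      proof
        assume "before V L" then show "before U L" using b before_trans ne by blast
      next
        assume "before U L"
        then have "\<not> before L V" using n by (auto simp: sep_def)
        then show "before V L" using foot_cases[OF VF LF] V by auto
      qed
      then show ?thesis using e True by (simp add: idx'_def)
    next
      case False
      have "prec D idx U R \<longleftrightarrow> prec D idx V R" if 1: "idx U = 1"
      proof -
        have "\<not> (prec D idx U R \<and> prec D idx R V)" by (rule not_separated_refine(2)[OF UF VF b LRF n]) simp
        moreover have "prec D idx U V"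
          using b n e False by (auto simp: prec_def sep_def)
        moreover have "prec D idx V R \<or> prec D idx R V" using prec_total[OF VF RF] 1 e idx_R V by auto
        ultimately show ?thesis using prec_trans[OF UF VF RF] by blast
      qed
      then show ?thesis using e False idx'_inner[of U] idx'_inner[of V] by (cases "idx U = 1") auto
    qed
  qed
qed

end

subsection \<open>Adding a bump with both feet in gaps\<close>

text \<open>The left foot of the new bump lies in gap \<open>1\<close> and its right foot in gap \<open>j\<close>. If \<open>j = N + 1\<close>,
  then both feet are of the same type, and the translate of the left foot is to the right of the
  right foot.\<close>

locale inner_step = tracking + \<beta>: bump \<beta> \<alpha> \<gamma> for \<beta> \<alpha> \<gamma> +
  fixes L R :: foot and j :: nat
  assumes LF: "L \<in> F" and RF: "R \<in> F" and LR: "before L R" and sepLR: "sep D L R"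
    and j: "2 \<le> j" "j \<le> Suc N"
    and idx_L: "idx L = 1" and idx_R: "idx R = (if j = Suc N then 1 else j)"
    and \<alpha>: "\<alpha> = rep L (fst L)" and \<beta>\<mu>: "\<beta> (rep L (snd L)) = (if j = Suc N then y 0 (rep R (fst R)) else rep R (fst R))"
    and \<gamma>: "\<gamma> = (if j = Suc N then y 0 (rep R (snd R)) else rep R (snd R))"
begin

definition \<mu> where "\<mu> = rep L (snd L)"

lemma facts: "t 1 \<le> \<alpha>" "\<alpha> < \<mu>" "\<mu> \<le> s 1" "t j \<le> \<beta> \<mu>" "\<beta> \<mu> < \<gamma>" "\<gamma> \<le> s j" "\<gamma> \<le> y 0 \<alpha>"
  "s 1 < t j" "s (j - 1) < t j"
proof -
  show \<alpha>1: "t 1 \<le> \<alpha>" "\<mu> \<le> s 1" using inner[OF LF] idx_L \<alpha> by (auto simp: \<mu>_def)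
  show "\<alpha> < \<mu>" using rep_less[OF LF] \<alpha> by (simp add: \<mu>_def)
  show "\<beta> \<mu> < \<gamma>" using rep_less[OF RF] by (simp add: \<mu>_def \<beta>\<mu> \<gamma>)
  have "t j \<le> \<beta> \<mu> \<and> \<gamma> \<le> s j"
    using inner[OF RF] idx_R j t_period[of 1] s_period[of 1]
    by (auto simp: \<mu>_def \<beta>\<mu> \<gamma> split: if_splits)
  then show tj: "t j \<le> \<beta> \<mu>" "\<gamma> \<le> s j" by auto
  show "\<gamma> \<le> y 0 \<alpha>"
  proof (cases "j = Suc N")
    case True
    then have "prec D idx R L" using idx_L idx_R LR sepLR by (simp add: prec_def)
    then show ?thesis using ordered[OF RF LF] True \<alpha> by (simp add: \<gamma>)
  next
    case False
    then have "s j < t (Suc N)" using j s_less_t'[of j "Suc N"] by simp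
    also have "\<dots> = y 0 (t 1)" using t_period[of 1] by simp
    also have "\<dots> \<le> y 0 \<alpha>" using \<alpha>1 by simp
    finally show ?thesis using tj by simp
  qed
  show "s 1 < t j" "s (j - 1) < t j" using s_less_t'[of 1 j] s_less_t'[of "j - 1" j] j by auto
qed

definition \<beta>' where "\<beta>' = y 0 \<circ> \<beta> \<circ> fun_inv (y 0)"

sublocale \<beta>': bump \<beta>' "y 0 \<alpha>" "y 0 \<gamma>"
  unfolding \<beta>'_def by (rule \<beta>.conj_bump) (rule incr)

text \<open>The first new letter must be trivial up to \<open>\<alpha>\<close> and equal to
  \<open>y 0\<close> further on. Since \<open>y (j - 1)\<close> is \<open>y 0\<close> beyond
  \<open>t j\<close>, the map \<open>y (j - 1) \<circ> \<beta>\<close> equals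
  \<open>y 0 \<circ> \<beta> = \<beta>' \<circ> y 0\<close> beyond
  \<open>fun_inv \<beta> (t j)\<close>. The factor \<open>fun_inv \<beta>'\<close> removes the
  surplus \<open>\<beta>'\<close>.\<close>

definition yx where "yx = fun_inv \<beta>' \<circ> y (j - 1)"

definition yy :: "nat \<Rightarrow> real \<Rightarrow> real" where
  "yy k = (if k = 0 then y 0 else if k = 1 then yx \<circ> \<beta> else if k = j then yx else y (k - 1))"
definition ss :: "nat \<Rightarrow> real" where
  "ss k = (if k = 0 then s 0 else if k = 1 then \<alpha> else s (k - 1))"
text \<open>Gap \<open>1\<close> is cut by the left foot, its first part now ending at
  \<open>\<alpha>\<close>. Gap \<open>j\<close> keeps only what lies beyond \<open>\<gamma>\<close>;
  its part in front of \<open>R\<close> is pulled back by \<open>\<beta>\<close> and joins the part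
  of gap \<open>1\<close> behind \<open>L\<close> in the new gap \<open>2\<close>. If
  \<open>j = Suc N\<close>, the loss of gap \<open>j\<close> shows one period earlier, at the
  beginning of gap \<open>1\<close>.\<close>

definition tt :: "nat \<Rightarrow> real" where
  "tt k = (if k = 1 then (if j = Suc N then fun_inv (y 0) \<gamma> else t 1)
           else if k = 2 then fun_inv \<beta> (t j) else if k = Suc j then \<gamma> else t (k - 1))"

sublocale yx: incr_bij yx
  unfolding yx_def by (intro incr_bij_comp incr \<beta>'.incr_bij_inv)

lemma yj_shift: "t j \<le> x \<Longrightarrow> y (j - 1) x = y 0 x"
  using y_shift[of "j - 1" x] j by simp

text \<open>Points are lowered by \<open>fun_inv \<beta>'\<close> only between
  \<open>y 0 \<alpha>\<close> and \<open>y 0 \<gamma>\<close>, and they stay in that interval. A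
  point brought there by \<open>y (j - 1)\<close> started below
  \<open>\<gamma> \<le> y 0 \<alpha>\<close>, so it still ends above its start.\<close>

lemma yx_ge: "x \<le> yx x" and yx_gt: "s (j - 1) < x \<Longrightarrow> x < s j \<Longrightarrow> x < yx x"
proof -
  let ?w = "y (j - 1) x"
  have "yx x = ?w \<or> x < yx x"
  proof (cases "y 0 \<alpha> < ?w \<and> ?w < y 0 \<gamma>")
    case True
    have "x < \<gamma>"
    proof (rule ccontr)
      assume "\<not> x < \<gamma>"
      then have "t j \<le> x" using facts(4,5) by linarith
      then show False using True yj_shift \<open>\<not> x < \<gamma>\<close> by simp
    qed
    moreover have "y 0 \<alpha> < yx x" using True \<beta>'.inv_a_less by (simp add: yx_def)
    ultimately show ?thesis using facts(7) by linarith
  next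
    case False
    then show ?thesis using \<beta>'.inv_fix_left[of ?w] \<beta>'.inv_fix_right[of ?w] by (auto simp: yx_def not_less)
  qed
  then show "x \<le> yx x" and "s (j - 1) < x \<Longrightarrow> x < s j \<Longrightarrow> x < yx x"
    using y_ge[of x "j - 1"] y_gt[of "j - 1" x] j by auto
qed

lemma yx_fix: "x \<le> s (j - 1) \<Longrightarrow> yx x = x"
proof -
  assume x: "x \<le> s (j - 1)"
  then have "x \<le> y 0 \<alpha>" using facts(4,5,7,9) by linarith
  then show ?thesis using x y_fix[of x "j - 1"] \<beta>'.inv_fix_left[of x] by (simp add: yx_def)
qed

lemma yx_shift: "\<gamma> \<le> x \<Longrightarrow> yx x = y 0 x"
proof -
  assume x: "\<gamma> \<le> x"
  then have "t j \<le> x" using facts(4,5) by linarith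
  then show ?thesis using x yj_shift[of x] \<beta>'.inv_fix_right[of "y 0 x"] by (simp add: yx_def)
qed

lemma yL_shift: "fun_inv \<beta> (t j) \<le> x \<Longrightarrow> yx (\<beta> x) = y 0 x"
proof -
  assume "fun_inv \<beta> (t j) \<le> x"
  then have "y (j - 1) (\<beta> x) = y 0 (\<beta> x)" using yj_shift by (simp add: \<beta>.inv_le)
  moreover have "\<beta>' (y 0 x) = y 0 (\<beta> x)" by (simp add: \<beta>'_def)
  ultimately show ?thesis by (metis \<beta>'.inv_f comp_apply yx_def)
qed

lemma tt_last: "y 0 (tt 1) = (if j = Suc N then \<gamma> else t (Suc N))"
  using t_period[of 1] by (simp add: tt_def)

sublocale P: chain_period "Suc N" yy ss tt
proof (rule chain_period.intro)
  fix k :: nat and x :: real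
  show "incr_bij (yy k)"
    using incr incr_bij_comp[OF yx.incr_bij_axioms \<beta>.incr_bij_axioms] yx.incr_bij_axioms by (simp add: yy_def)
  show "x \<le> yy k x"
    using \<beta>.ge[of x] yx_ge[of "\<beta> x"] yx_ge[of x] y_ge[of x 0] y_ge[of x "k - 1"]
    by (auto simp: yy_def)
  have "s 1 \<le> s (j - 1)" using s_mono[of 1 "j - 1"] j by simp
  then have \<alpha>s: "\<alpha> \<le> s (j - 1)" using facts(2,3) by linarith
  show "x \<le> ss k \<Longrightarrow> yy k x = x"
    using y_fix[of x 0] yx_fix[of x] \<beta>.left_fix[of x] y_fix[of x "k - 1"] \<alpha>s
    by (auto simp: yy_def ss_def split: if_splits)
  show "x < yy k x" if a: "k < Suc N" "ss k < x" "x < ss (Suc k)"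
  proof -
    consider "k = 0" | "k = 1" | "2 \<le> k" by linarith
    then show ?thesis
    proof cases
      case 1
      then have "x < s 1" using a facts(2,3) by (simp add: ss_def)
      then show ?thesis using 1 a y_gt[of 0 x] by (simp add: ss_def yy_def)
    next
      case 2
      then have "\<alpha> < x" "x < \<gamma>" using a facts(4,5,8) by (auto simp: ss_def)
      then show ?thesis using 2 \<beta>.moves[of x] yx_ge[of "\<beta> x"] by (simp add: yy_def)
    next
      case 3
      then show ?thesis using a y_gt[of "k - 1" x] yx_gt[of x] by (auto simp: ss_def yy_def)
    qed
  qed
  show "x < yy (Suc N) x" if a: "ss (Suc N) < x" "x < yy 0 (ss 1)"
  proof -
    have "yy 0 (ss 1) = y 0 \<alpha>" by (simp add: yy_def ss_def)
    also have "\<dots> < y 0 (s 1)" using facts by simp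
    also have "\<dots> = s (Suc N)" using s_period[of 1] by simp
    finally have "x < s (Suc N)" using a by simp
    then show ?thesis using a N_pos y_gt[of N x] yx_gt[of x] by (auto simp: ss_def yy_def)
  qed
  show "yy k x = yy 0 x" if a: "k < Suc N" "tt (Suc k) \<le> x"
  proof -
    consider "k = 0" | "k = 1" | "2 \<le> k" by linarith
    then show ?thesis
    proof cases
      case 2
      then show ?thesis using a j yL_shift[of x] by (simp add: yy_def tt_def numeral_2_eq_2)
    next
      case 3
      then show ?thesis using a y_shift[of "k - 1" x] yx_shift[of x] by (auto simp: yy_def tt_def)
    qed simp
  qed
  show "yy (Suc N) x = yy 0 x" if a: "yy 0 (tt 1) \<le> x"
    using a N_pos y_shift[of N x] yx_shift[of x] tt_last by (auto simp: yy_def split: if_splits)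
  show "tt k \<le> ss k" if k: "1 \<le> k"
  proof -
    consider "k = 1" | "k = 2" | "3 \<le> k" using k by linarith
    then show ?thesis
    proof cases
      case 1
      then show ?thesis using facts(1,7) by (simp add: tt_def ss_def y.inv_le)
    next
      case 2
      have "fun_inv \<beta> (t j) \<le> \<mu>" using facts(4) by (simp add: \<beta>.inv_le)
      then show ?thesis using 2 facts(3) by (simp add: tt_def ss_def)
    next
      case 3
      then show ?thesis using facts(6) t_le_s[of "k - 1"] by (auto simp: tt_def ss_def)
    qed
  qed
  show "ss k < tt (Suc k)" if a: "k < Suc N"
  proof -
    consider "k = 0" | "k = 1" | "2 \<le> k" by linarith
    then show ?thesis
    proof cases
      case 1
      have "s 0 < fun_inv (y 0) \<gamma>" if "j = Suc N"
      proof -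
        have "y 0 (s 0) = s 0" by (rule y_fix) simp
        moreover have "s 0 < t j" using s_less_t'[of 0 j] j by simp
        ultimately show ?thesis using facts(4,5) by (simp add: y.less_inv)
      qed
      then show ?thesis using 1 s_less_t[of 0] by (simp add: tt_def ss_def)
    next
      case 2
      have "\<alpha> < t j" using facts(2,3,8) by linarith
      then have "\<alpha> < fun_inv \<beta> (t j)" by (rule \<beta>.inv_a_less)
      then show ?thesis using 2 by (simp add: tt_def ss_def numeral_2_eq_2)
    next
      case 3
      have "s (j - 1) < \<gamma>" using facts(4,5,9) by linarith
      then show ?thesis using 3 s_less_t[of "k - 1"] by (auto simp: tt_def ss_def)
    qed
  qed
  show "ss (Suc N) < yy 0 (tt 1)"
  proof -
    have "s (j - 1) < \<gamma>" using facts(4,5,9) by linarith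
    then show ?thesis using s_less_t[of N] N_pos tt_last by (auto simp: ss_def yy_def)
  qed
qed simp

text \<open>The order of recovery is \<open>\<beta> = fun_inv yx \<circ> yy 1\<close>, then its
  conjugate \<open>\<beta>'\<close>, then the replaced letter
  \<open>y (j - 1) = \<beta>' \<circ> yx\<close>.\<close>

lemma generate_yy: "generate line_group (yy ` {..Suc N}) = generate line_group (insert \<beta> (range y))"
proof
  have A: "\<And>f. f \<in> insert \<beta> (range y) \<Longrightarrow> incr_bij f" using \<beta>.incr_bij_axioms incr by auto
  have B: "\<And>f. f \<in> yy ` {..Suc N} \<Longrightarrow> incr_bij f" using P.incr by auto
  have g: "\<beta> \<in> generate line_group (insert \<beta> (range y))" "y k \<in> generate line_group (insert \<beta> (range y))" for k
    by (auto intro: generate.incl)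
  have g': "yx \<in> generate line_group (insert \<beta> (range y))"
    unfolding yx_def \<beta>'_def by (intro generate_comp generate_inv[OF A] g)
  show "generate line_group (yy ` {..Suc N}) \<subseteq> generate line_group (insert \<beta> (range y))"
    by (rule generate_subsetI[OF A]) (auto simp: yy_def g g' intro!: generate_comp)
  let ?H = "generate line_group (yy ` {..Suc N})"
  have h: "k \<le> Suc N \<Longrightarrow> yy k \<in> ?H" for k by (auto intro: generate.incl)
  have y0: "y 0 \<in> ?H" using h[of 0] by (simp add: yy_def)
  have x: "yx \<in> ?H" using h[OF j(2)] j by (simp add: yy_def)
  have "\<beta> = fun_inv yx \<circ> yy 1" by (simp add: yy_def fun_eq_iff)
  moreover have "yy 1 \<in> ?H" using h by simp
  ultimately have \<beta>: "\<beta> \<in> ?H" using x by (metis B generate_comp generate_inv)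
  have \<beta>'H: "\<beta>' \<in> ?H" unfolding \<beta>'_def by (intro generate_comp generate_inv[OF B] y0 \<beta>)
  have "y (j - 1) = \<beta>' \<circ> yx" by (simp add: yx_def fun_eq_iff)
  then have yj: "y (j - 1) \<in> ?H" using \<beta>'H x by (simp add: generate_comp)
  have "y k \<in> ?H" for k
  proof (induction k rule: less_induct)
    case (less k)
    consider "k = 0" | "k = j - 1" | "1 \<le> k" "k \<le> N" "k \<noteq> j - 1" | "N < k" by linarith
    then show ?case
    proof cases
      case 3
      then have "y k = yy (Suc k)" using j by (auto simp: yy_def)
      then show ?thesis using h[of "Suc k"] 3 by simp
    next
      case 4
      have "y k = y 0 \<circ> y (k - N) \<circ> fun_inv (y 0)"
        using 4 y_period[of "k - N" "fun_inv (y 0) x" for x] by (simp add: fun_eq_iff)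
      moreover have "y (k - N) \<in> ?H" using less 4 N_pos by simp
      ultimately show ?thesis using y0 by (metis B generate_comp generate_inv)
    qed (use y0 yj in simp_all)
  qed
  then show "generate line_group (insert \<beta> (range y)) \<subseteq> ?H"
    by (intro generate_subsetI[OF B]) (use \<beta> in auto)
qed

text \<open>Takes the part of the gap in front of \<open>R\<close> to the stretch just in front of
  \<open>\<mu>\<close>. If \<open>j = Suc N\<close>, that part sits in gap \<open>1\<close> and is
  first moved on by a period.\<close>

definition toR :: "real \<Rightarrow> real" where
  "toR = (if j = Suc N then fun_inv \<beta> \<circ> y 0 else fun_inv \<beta>)"

definition rep' where
  "rep' U = (if prec D idx U R then toR \<circ> rep U else rep U)"
definition idx' where
  "idx' U = (if prec D idx U R \<or> prec D idx L U then 2 else if idx U \<le> 1 then idx U else Suc (idx U))"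

lemma idx'_0: "idx' U \<noteq> 0 \<Longrightarrow> idx U \<noteq> 0"
proof
  assume a: "idx' U \<noteq> 0" "idx U = 0"
  have "\<not> prec D idx U R" "\<not> prec D idx L U" using a(2) idx_L unfolding prec_def by auto
  then show False using a by (simp add: idx'_def)
qed

lemma idx'_2: "idx' U = 2 \<longleftrightarrow> prec D idx U R \<or> prec D idx L U"
  by (simp add: idx'_def)

lemma idx'_other:
  "\<not> prec D idx U R \<Longrightarrow> \<not> prec D idx L U \<Longrightarrow> idx' U = (if idx U \<le> 1 then idx U else Suc (idx U))"
  by (simp add: idx'_def)

abbreviation "F' \<equiv> F - {L, R}"

lemma toR_R: "toR (rep R (fst R)) = \<mu>"
  using \<beta>\<mu> \<beta>.inv_f[of \<mu>] by (simp add: toR_def \<mu>_def split: if_splits)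

lemma incr_toR: "incr_bij toR"
  unfolding toR_def by (simp add: \<beta>.incr_bij_inv incr incr_bij_comp)

text \<open>The hypotheses force \<open>L\<close> and \<open>R\<close> into one gap, where their
  separation by \<open>D\<close> reverses them.\<close>

lemma prec_RL: "prec D idx U R \<Longrightarrow> prec D idx L V \<Longrightarrow> idx U = idx V \<Longrightarrow> prec D idx R L"
  using sepLR LR idx_L by (auto simp: prec_def)

lemma not_both: "U \<in> F \<Longrightarrow> V \<in> F \<Longrightarrow> prec D idx U R \<Longrightarrow> prec D idx L V \<Longrightarrow> \<not> prec D idx V U"
proof
  assume a: "U \<in> F" "V \<in> F" "prec D idx U R" "prec D idx L V" "prec D idx V U"
  then have "prec D idx R L" using prec_RL[of U V] by (auto simp: prec_def)
  moreover have "prec D idx L R"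
    using a prec_trans[OF LF a(2) a(1)] prec_trans[OF LF a(1) RF] by blast
  ultimately show False using prec_asym[OF LF RF] by blast
qed

lemma not_both': "U \<in> F \<Longrightarrow> prec D idx U R \<Longrightarrow> \<not> prec D idx L U"
proof
  assume a: "U \<in> F" "prec D idx U R" "prec D idx L U"
  then have "prec D idx R L" using prec_RL[of U U] by simp
  moreover have "prec D idx L R" using prec_trans[OF LF a(1) RF a(3) a(2)] .
  ultimately show False using prec_asym[OF LF RF] by blast
qed

text \<open>The new gap \<open>2\<close> merges feet from in front of \<open>R\<close> with feet
  from behind \<open>L\<close>, and the former come first. This agrees with the rule: the foot of
  \<open>D\<close> between \<open>L\<close> and \<open>R\<close> excludes that \<open>U\<close> lies
  to the left of \<open>V\<close>; and if \<open>V\<close> lies to the left of \<open>U\<close>,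
  some foot of \<open>D\<close> separates them, since otherwise both would share a gap with
  \<open>V\<close> preceding \<open>U\<close>, against \<open>not_both\<close>.\<close>

lemma mixed_order:
  assumes U: "U \<in> F" "prec D idx U R" and V: "V \<in> F" "prec D idx L V"
    and ne: "U \<notin> {L, R}" "V \<notin> {L, R}"
  shows "\<not> prec (D \<union> {L, R}) idx'' V U"
proof
  assume pr: "prec (D \<union> {L, R}) idx'' V U"
  note lt = foot_less[OF U(1)] foot_less[OF V(1)] foot_less[OF LF] foot_less[OF RF]
  have u: "before U R \<and> \<not> sep D U R \<or> before R U \<and> sep D R U"
    and v: "before L V \<and> \<not> sep D L V \<or> before V L \<and> sep D V L"
    using U V by (auto simp: prec_def)
  have un: "sep D A B \<Longrightarrow> sep (D \<union> {L, R}) A B" for A B by (auto simp: sep_def)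
  from pr consider "before V U" "\<not> sep D V U" | "before U V"
    unfolding prec_def using un by blast
  then show False
  proof cases
    case 1
    then have "idx V = idx U" using adjacent U V by blast
    then have "prec D idx V U" using 1 V by (auto simp: prec_def)
    then show False using not_both U V by blast
  next
    case 2
    show False
    proof (cases "before R U")
      case True
      have RV: "before R V" using True 2 before_trans lt by blast
      then have "before L V" using LR before_trans lt by blast
      then have "\<not> sep D L V" using v before_asym lt by blast
      then show False using sepLR RV sep_mono' lt by blast
    next
      case False
      then have UR: "before U R" "\<not> sep D U R" using u by auto
      have "\<not> before U L" using UR sepLR sep_mono lt by blast
      then have LU: "before L U" using foot_cases[OF U(1) LF] ne by auto
      then have "before L V" using 2 before_trans lt by blast
      then have nLV: "\<not> sep D L V" using v before_asym lt by blast
      obtain W where W: "W \<in> D" "before L W" "before W R" using sepLR by (auto simp: sep_def)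
      from foot_cases_D[OF U(1) W(1)] show False
      proof
        assume "before U W"
        then show False using UR W by (auto simp: sep_def)
      next
        assume "before W U"
        then have "sep D L U" using W by (auto simp: sep_def)
        then show False using nLV 2 sep_mono' lt by blast
      qed
    qed
  qed
qed

lemma between_RL:
  assumes "U \<in> F" "V \<in> F" "U \<notin> {L, R}" "V \<notin> {L, R}" "before U V" "\<not> sep (D \<union> {L, R}) U V"
    "W \<in> {L, R}" "idx W = idx U" "idx U \<noteq> 0"
  shows "prec D idx U W \<longleftrightarrow> prec D idx V W" "prec D idx W U \<longleftrightarrow> prec D idx W V"
proof -
  have LRF: "{L, R} \<subseteq> F" using LF RF by simp
  have WF: "W \<in> F" using assms LRF by auto
  have e: "idx U = idx V" by (rule not_separated_refine(1)[OF assms(1,2,5) LRF assms(6)])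
  have n: "\<not> (prec D idx U W \<and> prec D idx W V)"
    by (rule not_separated_refine(2)[OF assms(1,2,5) LRF assms(6,7)])
  have p: "prec D idx U V" using assms e by (auto simp: prec_def sep_def)
  have "U \<noteq> W" "V \<noteq> W" using assms by auto
  then have tot: "prec D idx V W \<or> prec D idx W V" "prec D idx U W \<or> prec D idx W U"
    using prec_total[OF _ WF] assms e by auto
  show "prec D idx U W \<longleftrightarrow> prec D idx V W" "prec D idx W U \<longleftrightarrow> prec D idx W V"
    using n p tot prec_trans[OF assms(1,2) WF] prec_trans[OF WF assms(1,2)]
      prec_asym[OF assms(1) WF] prec_asym[OF assms(2) WF] by blast+
qed

lemma tracking': "tracking (Suc N) P.Y P.S P.T \<Omega> (D \<union> {L, R}) F' rep' idx'"
proof (rule P.tracking_period)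
  show "disjoint_feet \<Omega>" "D \<union> {L, R} \<subseteq> \<Omega>" "F' \<subseteq> \<Omega>" "(D \<union> {L, R}) \<inter> F' = {}"
    using feet D_sub F_sub DF LF RF by auto
  have LRF: "{L, R} \<subseteq> F" using LF RF by simp
  have A: "\<And>f. f \<in> insert \<beta> (range y) \<Longrightarrow> incr_bij f" using \<beta>.incr_bij_axioms incr by auto
  have gin: "\<beta> \<in> generate line_group (insert \<beta> (range y))" "y k \<in> generate line_group (insert \<beta> (range y))" for k
    by (auto intro: generate.incl)
  have toRin: "toR \<in> generate line_group (insert \<beta> (range y))"
    unfolding toR_def by (auto intro!: generate_comp generate_inv[OF A] gin)
  have Gsub: "G \<subseteq> generate line_group (insert \<beta> (range y))" by (rule line.mono_generate) auto
  interpret toR: incr_bij toR by (rule incr_toR)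
  fix U
  show "rep' U \<in> generate line_group (yy ` {..Suc N})" if "U \<in> F'"
    unfolding generate_yy using toRin subsetD[OF Gsub rep_G[of U]] that by (simp add: rep'_def generate_comp)
  show "idx' U \<le> Suc N" if "U \<in> F'" using idx_le[of U] that N_pos by (auto simp: idx'_def)
  show "snd U \<le> ss 0" if "U \<in> F'" "idx' U = 0"
    using that outer[of U] by (auto simp: idx'_def ss_def split: if_splits)
  show "ss 0 \<le> fst W" if "W \<in> D \<union> {L, R}" for W
  proof -
    have "idx R \<noteq> 0" using idx_R j by simp
    then have "s 0 \<le> fst L" "s 0 \<le> fst R"
      using inner_right[OF LF] inner_right[OF RF] idx_L by auto
    then show ?thesis using that s0_le[of W] by (auto simp: ss_def)
  qed
  show "tt (idx' U) \<le> rep' U (fst U) \<and> rep' U (snd U) \<le> ss (idx' U)" if U: "U \<in> F'" "idx' U \<noteq> 0"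
  proof -
    have UF: "U \<in> F" using U by simp
    have n: "idx U \<noteq> 0" by (rule idx'_0[OF U(2)])
    note i = inner[OF UF n]
    consider "prec D idx U R" | "prec D idx L U" | "\<not> prec D idx U R" "\<not> prec D idx L U" by blast
    then show ?thesis
    proof cases
      case 1
      have "rep U (snd U) \<le> rep R (fst R)" using ordered[OF UF RF 1] .
      then have "toR (rep U (snd U)) \<le> \<mu>" using toR.le_iff toR_R by metis
      moreover have "fun_inv \<beta> (t j) \<le> toR (rep U (fst U))"
        using 1 i idx_R t_period[of 1] by (auto simp: toR_def prec_def)
      ultimately show ?thesis using 1 facts(3) by (simp add: idx'_def rep'_def tt_def ss_def)
    next
      case 2
      have "\<mu> \<le> rep U (fst U)" using ordered[OF LF UF 2] by (simp add: \<mu>_def)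
      moreover have "fun_inv \<beta> (t j) \<le> \<mu>" using facts(4) by (simp add: \<beta>.inv_le)
      moreover have "idx U = 1" using 2 idx_L by (simp add: prec_def)
      moreover have "\<not> prec D idx U R" using not_both'[OF UF] 2 by blast
      ultimately show ?thesis using 2 i by (simp add: idx'_def rep'_def tt_def ss_def)
    next
      case 3
      have idx'U: "idx' U = (if idx U = 1 then 1 else Suc (idx U))" "rep' U = rep U"
        using 3 n by (auto simp: idx'_def rep'_def)
      have RU: "prec D idx R U" if "idx U = idx R" using prec_total[OF UF RF] that 3 n U by auto
      show ?thesis
      proof (cases "idx U = 1")
        case True
        then have "prec D idx U L" using prec_total[OF UF LF] 3 idx_L U by auto
        then have "rep U (snd U) \<le> \<alpha>" using ordered[OF UF LF] \<alpha> by simp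
        moreover have "fun_inv (y 0) \<gamma> \<le> rep U (fst U)" if "j = Suc N"
        proof -
          have "rep R (snd R) \<le> rep U (fst U)" using ordered[OF RF UF RU] True idx_R that by simp
          then show ?thesis using that by (simp add: \<gamma>)
        qed
        ultimately show ?thesis using True i by (simp add: idx'U tt_def ss_def)
      next
        case False
        show ?thesis
        proof (cases "idx U = j")
          case True
          then have "j \<noteq> Suc N" using idx_le[OF UF] by simp
          then have "\<gamma> \<le> rep U (fst U)" using ordered[OF RF UF RU] True idx_R by (simp add: \<gamma>)
          then show ?thesis using True j i False by (simp add: idx'U tt_def ss_def)
        next
          case False2: False
          then show ?thesis using i n False by (simp add: idx'U tt_def ss_def)
        qed
      qed
    qed
  qed
  fix V assume U: "U \<in> F'" and V: "V \<in> F'"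
  have UF: "U \<in> F" and VF: "V \<in> F" using U V by auto
  show "rep' U (snd U) \<le> rep' V (fst V)" if pr: "prec (D \<union> {L, R}) idx' U V"
  proof -
    have ie: "idx' U = idx' V" "idx' U \<noteq> 0" using pr by (auto simp: prec_def)
    have n: "idx U \<noteq> 0" "idx V \<noteq> 0"
      using ie idx'_0[of U] idx'_0[of V] by auto
    \<comment> \<open>By \<open>prec_refine\<close> a change of order would need \<open>L\<close> or
      \<open>R\<close> to arrive between the two feet, which equal behaviour towards both
      excludes.\<close>
    have same: "prec D idx U V" if e: "idx U = idx V"
      and sR: "prec D idx U R \<longleftrightarrow> prec D idx V R" and sL: "prec D idx L U \<longleftrightarrow> prec D idx L V"
    proof -
      have "\<not> (prec D idx V W \<and> prec D idx W U)" if "W \<in> {L, R}" for W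
        using that sR sL prec_asym[OF UF RF] prec_asym[OF VF LF] by blast
      then show ?thesis using prec_refine[OF UF VF e n(1) LRF pr] by blast
    qed
    consider "prec D idx U R" "prec D idx V R" | "prec D idx U R" "\<not> prec D idx V R"
      | "\<not> prec D idx U R" "prec D idx V R" | "\<not> prec D idx U R" "\<not> prec D idx V R" by blast
    then show ?thesis
    proof cases
      case 1
      then have "idx U = idx V" unfolding prec_def by simp
      then have "prec D idx U V" using same 1 not_both'[OF UF] not_both'[OF VF] by blast
      then show ?thesis using ordered[OF UF VF] 1 by (simp add: rep'_def)
    next
      case 2
      then have LV: "prec D idx L V" using ie(1) idx'_2[of U] idx'_2[of V] by simp
      have "rep U (snd U) \<le> rep R (fst R)" using ordered[OF UF RF 2(1)] .
      then have "toR (rep U (snd U)) \<le> \<mu>" using toR.le_iff toR_R by metis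
      also have "\<dots> \<le> rep V (fst V)" using ordered[OF LF VF LV] by (simp add: \<mu>_def)
      finally show ?thesis using 2 by (simp add: rep'_def)
    next
      case 3
      then have "prec D idx L U" using ie(1) idx'_2[of U] idx'_2[of V] by simp
      then show ?thesis using mixed_order[OF VF 3(2) UF] U V pr by blast
    next
      case 4
      have LUV: "prec D idx L U \<longleftrightarrow> prec D idx L V" using 4 ie(1) idx'_2[of U] idx'_2[of V] by simp
      have "idx U = idx V"
      proof (cases "prec D idx L U")
        case True
        then show ?thesis using LUV unfolding prec_def by simp
      next
        case False
        then show ?thesis using 4 LUV ie(1) idx'_other[of U] idx'_other[of V] by (auto split: if_splits)
      qed
      then have "idx U = idx V \<and> (prec D idx L U \<longleftrightarrow> prec D idx L V)" using LUV by simp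
      then have "prec D idx U V" using same 4 by blast
      then show ?thesis using ordered[OF UF VF] 4 by (simp add: rep'_def)
    qed
  qed
  show "idx' U = idx' V" if b: "before U V" and n: "\<not> sep (D \<union> {L, R}) U V"
  proof -
    have e: "idx U = idx V" by (rule not_separated_refine(1)[OF UF VF b LRF n])
    have nR: "prec D idx U R \<longleftrightarrow> prec D idx V R"
      using between_RL(1)[OF UF VF _ _ b n, of R] U V e by (auto simp: prec_def)
    have nL: "prec D idx L U \<longleftrightarrow> prec D idx L V"
      using between_RL(2)[OF UF VF _ _ b n, of L] U V e by (auto simp: prec_def)
    show ?thesis using e nR nL by (simp add: idx'_def)
  qed
qed

end

subsection \<open>Connected fast families\<close>

text \<open>In combination with \<open>y_pow_fix\<close>: powers of \<open>y i\<close> leave gap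
  \<open>i\<close> alone and translate all later gaps, which changes the distance of two gaps by
  whole periods.\<close>

lemma (in bump_chain) y_pow_gap: "i < k \<Longrightarrow> x \<in> gap k \<Longrightarrow> (y i ^^ e) x = (y 0 ^^ e) x"
proof (induction e)
  case (Suc e)
  have "(y 0 ^^ e) x \<in> gap (k + e * N)" using Suc by (simp add: shift_pow_gap)
  then show ?case using Suc y_gap[of "k + e * N" "(y 0 ^^ e) x" i] by simp
qed simp

lemma (in bump_chain) y_pow_fix: "1 \<le> k \<Longrightarrow> x \<in> gap k \<Longrightarrow> (y k ^^ e) x = x"
  by (induction e) (auto simp: y_gap)

lemma (in bump_chain) wp_in_G: "wp p \<in> G"
proof (induction p)
  case Nil
  then show ?case by (simp only: wp_Nil' generate_id)
next
  case (Cons k p)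
  then show ?case by (simp only: wp_Cons') (rule generate_comp[OF y_in_G])
qed

text \<open>Both feet of a bump can be positioned by one element of the group, as follows. Positive words
  move any foot into a gap and keep those feet in gaps that are already there; the powers of \<open>y i\<close>
  then bring the right foot within one period of the left one. The feet do not arrive in the
  same gap because some element of the group moves a point between them.\<close>

lemma (in tracking) common_position:
  assumes L: "L \<in> F" "idx L \<noteq> 0" and R: "R \<in> F" "idx R \<noteq> 0"
    and x: "g \<in> G" "snd L \<le> x" "x < g x" "g x \<le> fst R"
  obtains q where "q \<in> G" "\<And>x. x \<in> {fst L, snd L} \<Longrightarrow> q x = rep L x"
    "\<And>x. x \<in> {fst R, snd R} \<Longrightarrow> q x = (if idx L < idx R then rep R x else y 0 (rep R x))"
proof -
  define i k where "i = idx L" and "k = idx R"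
  have ik: "1 \<le> i" "i \<le> N" "1 \<le> k" "k \<le> N" using L R idx_le by (auto simp: i_def k_def)
  have Lgap: "rep L z \<in> gap i" if "z \<in> {fst L, snd L}" for z
    using inner[OF L] rep_less[OF L(1)] that by (auto simp: gap_def i_def)
  have Rgap: "rep R z \<in> gap k" if "z \<in> {fst R, snd R}" for z
    using inner[OF R] rep_less[OF R(1)] that by (auto simp: gap_def k_def)
  obtain w c where w: "\<And>x. rep L x \<in> gap i \<Longrightarrow> wp w x = (y 0 ^^ c) (rep L x)"
    using positive_positioning[OF rep_G[OF L(1)] ik(1)] by blast
  note wG = wp_in_G
  interpret w: incr_bij "wp w" by (rule incr_wp)
  have "rep R \<circ> fun_inv (wp w) \<in> G" by (intro generate_comp rep_G R inv_G wG)
  then obtain v d where v: "\<And>x. (rep R \<circ> fun_inv (wp w)) x \<in> gap k \<Longrightarrow> wp v x = (y 0 ^^ d) ((rep R \<circ> fun_inv (wp w)) x)"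
    using positive_positioning[OF _ ik(3)] by blast
  have "1 \<le> i + c * N" using ik by simp
  then obtain c' where c': "\<And>x. x \<in> gap (i + c * N) \<Longrightarrow> wp v x = (y 0 ^^ c') x"
    using wp_gap by blast
  define a where "a = c + c'"
  define q0 where "q0 = wp v \<circ> wp w"
  have q0G: "q0 \<in> G" unfolding q0_def by (intro generate_comp wG)
  interpret q0: incr_bij q0 by (rule incr_G[OF q0G])
  have q0L: "q0 z = (y 0 ^^ a) (rep L z)" if "z \<in> {fst L, snd L}" for z
  proof -
    have "wp w z = (y 0 ^^ c) (rep L z)" using w Lgap[OF that] by simp
    moreover have "(y 0 ^^ c) (rep L z) \<in> gap (i + c * N)" using Lgap[OF that] ik by (simp add: shift_pow_gap)
    ultimately show ?thesis using c' by (simp add: q0_def a_def funpow_add add.commute)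
  qed
  have q0R: "q0 z = (y 0 ^^ d) (rep R z)" if "z \<in> {fst R, snd R}" for z
    using v[of "wp w z"] Rgap[OF that] by (simp add: q0_def)
  have L': "q0 z \<in> gap (i + a * N)" if "z \<in> {fst L, snd L}" for z
    using q0L[OF that] Lgap[OF that] ik by (simp add: shift_pow_gap)
  have R': "q0 z \<in> gap (k + d * N)" if "z \<in> {fst R, snd R}" for z
    using q0R[OF that] Rgap[OF that] ik by (simp add: shift_pow_gap)
  have less: "i + a * N < k + d * N"
  proof (rule ccontr)
    assume "\<not> i + a * N < k + d * N"
    moreover have "\<not> k + d * N < i + a * N"
    proof
      assume "k + d * N < i + a * N"
      then have "s (k + d * N) < t (i + a * N)" by (rule s_less_t')
      moreover have "q0 (snd L) < q0 (fst R)" using x by simp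
      moreover have "t (i + a * N) \<le> q0 (snd L)" "q0 (fst R) \<le> s (k + d * N)"
        using L'[of "snd L"] R'[of "fst R"] by (auto simp: gap_def)
      ultimately show False by linarith
    qed
    ultimately have e: "k + d * N = i + a * N" by simp
    have "q0 (snd L) \<le> q0 x" "q0 (g x) \<le> q0 (fst R)" "q0 x < q0 (g x)" using x by auto
    then have gaps: "q0 x \<in> gap (i + a * N)" "q0 (g x) \<in> gap (i + a * N)"
      using L'[of "snd L"] R'[of "fst R"] e by (auto simp: gap_def simp del: q0.le_iff q0.less_iff)
    have "q0 \<circ> g \<circ> fun_inv q0 \<in> G" by (intro generate_comp q0G x inv_G)
    from gap_return[OF this _ gaps(1)] gaps(2) ik have "q0 (g x) = q0 x" by simp
    then show False using x by simp
  qed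
  \<comment> \<open>The gap \<open>k + m * N\<close> is the first one of its type strictly after gap
    \<open>i\<close>; for \<open>k = i\<close> this is a full period later.\<close>
  define m where "m = (if i < k then 0 else 1 :: nat)"
  have J: "i < k + m * N" using ik by (auto simp: m_def)
  have "a + m \<le> d"
  proof (rule ccontr)
    assume "\<not> a + m \<le> d"
    then have "d + 1 \<le> a + m" by simp
    then have "d * N + N \<le> a * N + m * N" using mult_le_mono1[of "d + 1" "a + m" N] by (simp add: algebra_simps)
    then show False using less ik by (auto simp: m_def split: if_splits)
  qed
  then obtain e where e: "d = a + (e + m)" using le_Suc_ex by (metis add.assoc add.commute)
  interpret P: incr_bij "y 0 ^^ n" for n by (rule incr_bij_funpow[OF incr])
  interpret Q: incr_bij "y i ^^ n" for n by (rule incr_bij_funpow[OF incr])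
  define q where "q = fun_inv (y i ^^ e) \<circ> (fun_inv (y 0 ^^ a) \<circ> q0)"
  show ?thesis
  proof (rule that)
    show "q \<in> G" unfolding q_def by (intro generate_comp inv_G generate_funpow y_in_G q0G)
    show "q z = rep L z" if "z \<in> {fst L, snd L}" for z
      using q0L[OF that] y_pow_fix[OF ik(1) Lgap[OF that], of e] by (simp add: q_def Q.inv_eq)
    show "q z = (if idx L < idx R then rep R z else y 0 (rep R z))" if z: "z \<in> {fst R, snd R}" for z
    proof -
      have "q0 z = (y 0 ^^ a) ((y 0 ^^ e) ((y 0 ^^ m) (rep R z)))"
        using q0R[OF z] by (simp add: e funpow_add)
      moreover have "(y 0 ^^ m) (rep R z) \<in> gap (k + m * N)" using Rgap[OF z] ik by (simp add: shift_pow_gap)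
      ultimately have "q z = (y 0 ^^ m) (rep R z)"
        using y_pow_gap[OF J, of "(y 0 ^^ m) (rep R z)" e] by (simp add: q_def Q.inv_eq)
      then show ?thesis by (simp add: m_def i_def k_def)
    qed
  qed
qed

text \<open>A new bump may be replaced by its conjugate under an element of the group generated so
  far. This is how its feet are brought into the positions that the steps assume.\<close>

lemma generate_insert_conj:
  assumes A: "\<And>f. f \<in> A \<Longrightarrow> incr_bij f" and C: "\<And>f. f \<in> C \<Longrightarrow> incr_bij f" and f: "incr_bij f"
    and e: "generate line_group A = generate line_group C" and q: "q \<in> generate line_group C"
  shows "generate line_group (insert (q \<circ> f \<circ> fun_inv q) A) = generate line_group (insert f C)"
proof
  let ?b = "q \<circ> f \<circ> fun_inv q"
  interpret q: incr_bij q by (rule generate_incr_bij[OF C q])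
  have C': "\<And>g. g \<in> insert f C \<Longrightarrow> incr_bij g" using C f by auto
  have A': "\<And>g. g \<in> insert ?b A \<Longrightarrow> incr_bij g"
    using A incr_bij_conj[OF q.incr_bij_axioms f] by auto
  have CS: "generate line_group C \<subseteq> generate line_group (insert f C)"
    and AS: "generate line_group A \<subseteq> generate line_group (insert ?b A)"
    by (rule line.mono_generate; auto)+
  have qC: "q \<in> generate line_group (insert f C)" using q CS by blast
  have fC: "f \<in> generate line_group (insert f C)" by (rule generate.incl) simp
  have "?b \<in> generate line_group (insert f C)"
    by (intro generate_comp generate_inv[OF C'] qC fC)
  moreover have "A \<subseteq> generate line_group A" by (auto intro: generate.incl)
  ultimately show "generate line_group (insert ?b A) \<subseteq> generate line_group (insert f C)"
    using e CS by (intro generate_subsetI[OF C']) auto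
  have qA: "q \<in> generate line_group (insert ?b A)" using q e AS by auto
  have "f = fun_inv q \<circ> (?b \<circ> q)" by (simp add: fun_eq_iff)
  moreover have "?b \<in> generate line_group (insert ?b A)" by (rule generate.incl) simp
  ultimately have "f \<in> generate line_group (insert ?b A)"
    using qA by (metis generate_comp generate_inv[OF A'])
  moreover have "C \<subseteq> generate line_group C" by (auto intro: generate.incl)
  ultimately show "generate line_group (insert f C) \<subseteq> generate line_group (insert ?b A)"
    using e AS by (intro generate_subsetI[OF A']) auto
qed

text \<open>Connectedness of the crossing graph is recorded as an edge leaving every proper nonempty
  subset, the form used to add one bump at a time. Crossing is expressed by end points, so it is
  visibly independent of the markers.\<close>

locale fast_family =
  fixes B :: "(real \<Rightarrow> real) set" and lo mk hi :: "(real \<Rightarrow> real) \<Rightarrow> real"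
  assumes fin: "finite B"
    and bump: "f \<in> B \<Longrightarrow> bump f (lo f) (hi f)"
    and mk: "f \<in> B \<Longrightarrow> lo f < mk f" "f \<in> B \<Longrightarrow> mk f < hi f"
    and left_left: "f \<in> B \<Longrightarrow> g \<in> B \<Longrightarrow> f \<noteq> g \<Longrightarrow> before (lo f, mk f) (lo g, mk g) \<or> before (lo g, mk g) (lo f, mk f)"
    and right_right: "f \<in> B \<Longrightarrow> g \<in> B \<Longrightarrow> f \<noteq> g \<Longrightarrow>
      before (f (mk f), hi f) (g (mk g), hi g) \<or> before (g (mk g), hi g) (f (mk f), hi f)"
    and left_right: "f \<in> B \<Longrightarrow> g \<in> B \<Longrightarrow>
      before (lo f, mk f) (g (mk g), hi g) \<or> before (g (mk g), hi g) (lo f, mk f)"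
    and connected: "C \<subseteq> B \<Longrightarrow> C \<noteq> {} \<Longrightarrow> C \<noteq> B \<Longrightarrow> \<exists>f\<in>B - C. \<exists>g\<in>C.
      lo f < lo g \<and> lo g < hi f \<and> hi f < hi g \<or> lo g < lo f \<and> lo f < hi g \<and> hi g < hi f"
begin

definition lf where "lf f = (lo f, mk f)"
definition rf where "rf f = (f (mk f), hi f)"
definition feet where "feet C = lf ` C \<union> rf ` C"

lemma sizes: "f \<in> B \<Longrightarrow> fst (lf f) < snd (lf f)" "f \<in> B \<Longrightarrow> fst (rf f) < snd (rf f)"
  using mk bump.less_c[OF bump] by (auto simp: lf_def rf_def)

lemma lf_inj: "f \<in> B \<Longrightarrow> g \<in> B \<Longrightarrow> lf f = lf g \<longleftrightarrow> f = g"
  using left_left[of f g] sizes(1)[of f] by (cases "f = g") (auto simp: lf_def before_def)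

lemma rf_inj: "f \<in> B \<Longrightarrow> g \<in> B \<Longrightarrow> rf f = rf g \<longleftrightarrow> f = g"
  using right_right[of f g] sizes(2)[of f] by (cases "f = g") (auto simp: rf_def before_def)

lemma lf_rf: "f \<in> B \<Longrightarrow> g \<in> B \<Longrightarrow> lf f \<noteq> rf g"
  using left_right[of f g] sizes(1)[of f] by (auto simp: lf_def rf_def before_def)

lemma feet_diff: "C \<subseteq> B \<Longrightarrow> A \<subseteq> B \<Longrightarrow> feet (A - C) = feet A - feet C"
proof
  assume CA: "C \<subseteq> B" "A \<subseteq> B"
  show "feet (A - C) \<subseteq> feet A - feet C"
  proof
    fix W assume "W \<in> feet (A - C)"
    then obtain f where f: "f \<in> A" "f \<notin> C" "W = lf f \<or> W = rf f" by (auto simp: feet_def)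
    have "W \<noteq> lf g \<and> W \<noteq> rf g" if g: "g \<in> C" for g
    proof -
      have fg: "f \<in> B" "g \<in> B" "f \<noteq> g" using f g CA by auto
      show ?thesis using f(3) fg(3) lf_inj[OF fg(1,2)] rf_inj[OF fg(1,2)] lf_rf[OF fg(1,2)] lf_rf[OF fg(2,1)] by metis
    qed
    then have "W \<notin> feet C" unfolding feet_def by blast
    moreover have "W \<in> feet A" using f unfolding feet_def by blast
    ultimately show "W \<in> feet A - feet C" by blast
  qed
qed (auto simp: feet_def)

lemma feet_insert: "feet (insert f C) = feet C \<union> {lf f, rf f}"
  by (auto simp: feet_def)

lemma disjoint_feet_B: "disjoint_feet (feet B)"
proof -
  have "before U V \<or> before V U" if UV: "U \<in> feet B" "V \<in> feet B" "U \<noteq> V" for U V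
  proof -
    obtain f g where "f \<in> B" "g \<in> B" "U = lf f \<or> U = rf f" "V = lf g \<or> V = rf g"
      using UV by (auto simp: feet_def)
    then show ?thesis using left_left[of f g] right_right[of f g] left_right[of f g] left_right[of g f] UV(3)
      by (cases "f = g") (auto simp: lf_def[symmetric] rf_def[symmetric])
  qed
  moreover have "fst U < snd U" if "U \<in> feet B" for U using that sizes by (auto simp: feet_def)
  ultimately show ?thesis by (simp add: disjoint_feet_def)
qed

lemma crossing_order:
  assumes "f \<in> B" "g \<in> B" "lo f < lo g" "lo g < hi f" "hi f < hi g"
  shows "before (lf f) (lf g)" "before (lf g) (rf f)" "before (rf f) (rf g)"
proof -
  have "f \<noteq> g" using assms by auto
  then show "before (lf f) (lf g)" "before (lf g) (rf f)" "before (rf f) (rf g)"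
    using left_left[of f g] left_right[of g f] right_right[of f g] assms mk[of g] sizes(2)[of f]
    by (auto simp: lf_def rf_def before_def)
qed

lemma own_feet: "f \<in> B \<Longrightarrow> before (lf f) (rf f)"
  using bump.ge[OF bump] by (simp add: lf_def rf_def before_def)

text \<open>Supplies the moved point that \<open>common_position\<close> wants between the feet of a
  new bump. In the left foot it is the preimage of the marker, in the right foot the image of the
  marker.\<close>

lemma moved_point:
  assumes "g \<in> B" "W = lf g \<or> W = rf g"
  obtains x where "fst W \<le> x" "x < g x" "g x \<le> snd W"
proof -
  interpret g: bump g "lo g" "hi g" by (rule bump[OF assms(1)])
  note m = mk[OF assms(1)]
  from assms(2) show ?thesis
  proof
    assume W: "W = lf g"
    have "lo g < fun_inv g (mk g)" by (rule g.inv_a_less) (rule m)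
    moreover have "fun_inv g (mk g) < hi g" using g.inv_ge[of "mk g"] m by simp
    ultimately show ?thesis using that[of "fun_inv g (mk g)"] W g.moves[of "fun_inv g (mk g)"]
      by (simp add: lf_def)
  next
    assume W: "W = rf g"
    have "lo g < g (mk g)" "g (mk g) < hi g" using m g.a_less g.less_c by auto
    then show ?thesis using that[of "g (mk g)"] W g.moves[of "g (mk g)"] g.le_c[of "g (mk g)"]
      by (simp add: rf_def)
  qed
qed

definition tracked :: "(real \<Rightarrow> real) set \<Rightarrow> bool" where
  "tracked C \<longleftrightarrow> (\<exists>y s t rep idx.
     tracking (card C - 1) y s t (feet B) (feet C) (feet (B - C)) rep idx \<and>
     generate line_group (range y) = generate line_group C)"

lemma tracked_pair:
  assumes "2 \<le> card B" obtains C where "C \<subseteq> B" "C \<noteq> {}" "tracked C"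
proof -
  have "B \<noteq> {}" using assms by auto
  then have "Max (hi ` B) \<in> hi ` B" using fin by (intro Max_in) auto
  then obtain p where p0: "p \<in> B" "hi p = Max (hi ` B)" by (metis imageE)
  have p: "p \<in> B" "\<And>g. g \<in> B \<Longrightarrow> hi g \<le> hi p"
    using p0(1) fin by (auto simp: p0(2))
  have "{p} \<noteq> B" using assms by auto
  then obtain f where f: "f \<in> B" "f \<noteq> p"
    "lo f < lo p \<and> lo p < hi f \<and> hi f < hi p \<or> lo p < lo f \<and> lo f < hi p \<and> hi p < hi f"
    using connected[of "{p}"] p by auto
  \<comment> \<open>Maximality of \<open>hi p\<close> excludes the crossing with \<open>p\<close> on
    the left.\<close>
  then have fp: "lo f < lo p" "lo p < hi f" "hi f < hi p" using p(2)[of f] by auto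
  note order = crossing_order[OF f(1) p(1) fp]
  have feet_fp: "feet {f, p} = {(lo f, mk f), (f (mk f), hi f), (lo p, mk p), (p (mk p), hi p)}"
    by (auto simp: feet_def lf_def rf_def)
  have sub: "{f, p} \<subseteq> B" using f p by simp
  have "crossing_pair f (lo f) (hi f) p (lo p) (hi p) (mk f) (mk p) (feet B) (feet (B - {f, p}))"
  proof (intro crossing_pair.intro crossing_pair_axioms.intro bump f p disjoint_feet_B)
    show "(lo f, mk f) \<in> feet B" "(f (mk f), hi f) \<in> feet B" "(lo p, mk p) \<in> feet B" "(p (mk p), hi p) \<in> feet B"
      using f p by (auto simp: feet_def lf_def rf_def)
    show "mk f \<le> lo p" "mk p \<le> f (mk f)" "hi f \<le> p (mk p)" using order by (auto simp: before_def lf_def rf_def)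
    show "feet (B - {f, p}) = feet B - {(lo f, mk f), (f (mk f), hi f), (lo p, mk p), (p (mk p), hi p)}"
      using feet_diff[OF sub order_refl] feet_fp by simp
    show "snd U \<le> p (mk p)" if "U \<in> feet (B - {f, p})" for U
    proof -
      from that obtain g where g: "g \<in> B" "g \<noteq> p" "U = lf g \<or> U = rf g" unfolding feet_def by blast
      have "snd U \<le> hi p" "fst U < snd U" using g p(2)[of g] mk[OF g(1)] sizes[OF g(1)] by (auto simp: lf_def rf_def)
      moreover have "before U (rf p) \<or> before (rf p) U"
        using g left_right[OF g(1) p(1)] right_right[OF g(1) p(1)] by (auto simp: lf_def rf_def)
      ultimately show ?thesis by (auto simp: before_def rf_def)
    qed
  qed
  then interpret cp: crossing_pair f "lo f" "hi f" p "lo p" "hi p" "mk f" "mk p" "feet B" "feet (B - {f, p})" .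
  have "card {f, p} - 1 = 1" using f by simp
  then have "tracked {f, p}"
    unfolding tracked_def using cp.tracking cp.P.generate_Y cp.generate_yy feet_fp by metis
  then show ?thesis using that[of "{f, p}"] sub by simp
qed

lemma tracked_insert:
  assumes C: "C \<subseteq> B" "C \<noteq> {}" "tracked C" and f: "f \<in> B" "f \<notin> C" and g: "g \<in> C"
    and cross: "lo f < lo g \<and> lo g < hi f \<and> hi f < hi g \<or> lo g < lo f \<and> lo f < hi g \<and> hi g < hi f"
  shows "tracked (insert f C)"
proof -
  define N where "N = card C - 1"
  have card: "card (insert f C) - 1 = Suc N"
    using C f finite_subset[OF C(1) fin] by (simp add: N_def card_gt_0_iff Suc_leI)
  obtain y s t rep idx where tr: "tracking N y s t (feet B) (feet C) (feet (B - C)) rep idx"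
    and gen: "generate line_group (range y) = generate line_group C"
    using C(3) unfolding tracked_def N_def by blast
  interpret tracking N y s t "feet B" "feet C" "feet (B - C)" rep idx by (rule tr)
  interpret f: bump f "lo f" "hi f" by (rule bump[OF f(1)])
  have gB: "g \<in> B" using g C by auto
  have LF: "lf f \<in> feet (B - C)" and RF: "rf f \<in> feet (B - C)" using f by (auto simp: feet_def)
  have LR: "before (lf f) (rf f)" by (rule own_feet[OF f(1)])
  \<comment> \<open>Either kind of crossing puts one foot of \<open>g\<close> between the feet of
    \<open>f\<close>: the left one if \<open>f\<close> starts first, the right one
    otherwise.\<close>
  obtain W where W: "W = lf g \<or> W = rf g" "before (lf f) W" "before W (rf f)"
    using cross crossing_order[OF f(1) gB] crossing_order[OF gB f(1)] by blast
  have WD: "W \<in> feet C" using W(1) g by (auto simp: feet_def)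
  then have sepLR: "sep (feet C) (lf f) (rf f)" using W by (auto simp: sep_def)
  obtain x where x: "fst W \<le> x" "x < g x" "g x \<le> snd W" using moved_point[OF gB W(1)] by blast
  have idxR: "idx (rf f) \<noteq> 0"
  proof
    assume "idx (rf f) = 0"
    then have "snd (rf f) \<le> fst W" using outer[OF RF] s0_le[OF WD] by simp
    then show False using W(3) x sizes(2)[OF f(1)] by (simp add: before_def)
  qed
  have F': "feet (B - insert f C) = feet (B - C) - {lf f, rf f}"
  proof -
    have "B - insert f C = (B - C) - {f}" by auto
    then show ?thesis using feet_diff[of "{f}" "B - C"] f by (auto simp: feet_def)
  qed
  have incrC: "\<And>h. h \<in> C \<Longrightarrow> incr_bij h" using bump C by (auto simp: bump_def)
  have tracked_by: "tracked (insert f C)"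
    if "tracking (Suc N) y' s' t' (feet B) (feet C \<union> {lf f, rf f}) (feet (B - C) - {lf f, rf f}) rep' idx'"
      "generate line_group (range y') = generate line_group (insert (q \<circ> f \<circ> fun_inv q) (range z))"
      "generate line_group (range z) = G" "\<And>k. incr_bij (z k)" "q \<in> G" for y' s' t' rep' idx' q z
  proof -
    have "generate line_group (range y') = generate line_group (insert f C)"
      using that(2) generate_insert_conj[of "range z" C f q] that gen incrC f.incr_bij_axioms by auto
    then show ?thesis unfolding tracked_def card feet_insert F' using that(1) by blast
  qed
  show ?thesis
  proof (cases "idx (lf f) = 0")
    case True
    \<comment> \<open>This element fixes everything up to \<open>s 0\<close>, so conjugation leaves
      the left foot in place; rotation by \<open>r\<close> then makes the gap of the right foot
      number \<open>1\<close>.\<close>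
    define q where "q = rep (rf f)"
    define r where "r = idx (rf f) - 1"
    have r: "r < N" using idxR idx_le[OF RF] by (simp add: r_def)
    have q: "q \<in> G" unfolding q_def by (rule rep_G[OF RF])
    interpret q: incr_bij q by (rule incr_G[OF q])
    have mks: "mk f \<le> s 0" using outer[OF LF True] by (simp add: lf_def)
    have fixq: "q (lo f) = lo f" "q (mk f) = mk f"
      using mks mk(1)[OF f(1)] by (auto intro!: G_fix[OF q])
    have "bump (q \<circ> f \<circ> fun_inv q) (lo f) (q (hi f))" using f.conj_bump[OF q.incr_bij_axioms] fixq by simp
    moreover have "fun_inv q (mk f) = mk f" using fixq by (simp add: q.inv_eq)
    ultimately interpret L: left_step N "rot_y r" "rot_s r" "\<lambda>k. t (k + r)" "feet B" "feet C" "feet (B - C)"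
      "rot_rep r" "rot_idx r" "q \<circ> f \<circ> fun_inv q" "lo f" "q (hi f)" "lf f" "rf f"
      using LF RF LR True idxR
      by (intro left_step.intro tracking_rot[OF r] left_step_axioms.intro)
        (auto simp: rot_idx_def rot_rep_def r_def q_def lf_def rf_def)
    show ?thesis
      using tracked_by[OF L.tracking' _ generate_rot[OF r] L.incr q] L.P.generate_Y L.generate_yy by simp
  next
    case False
    have "g \<in> G" using g gen by (auto intro: generate.incl)
    moreover have "snd (lf f) \<le> x" "g x \<le> fst (rf f)" using W x by (auto simp: before_def)
    ultimately obtain q where q: "q \<in> G" "\<And>x. x \<in> {fst (lf f), snd (lf f)} \<Longrightarrow> q x = rep (lf f) x"
      "\<And>x. x \<in> {fst (rf f), snd (rf f)} \<Longrightarrow> q x = (if idx (lf f) < idx (rf f) then rep (rf f) x else y 0 (rep (rf f) x))"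
      using common_position[OF LF False RF idxR, where g = g and x = x] x(2) by blast
    interpret q: incr_bij q by (rule incr_G[OF q(1)])
    define r where "r = idx (lf f) - 1"
    \<comment> \<open>After rotation the left foot is in gap \<open>1\<close>, and \<open>j\<close>
      is the number of the gap of the right foot within the following period. Equal indices give
      \<open>j = Suc N\<close>.\<close>
    define j where "j = (if idx (lf f) < idx (rf f) then idx (rf f) - r else idx (rf f) + N - r)"
    have il: "1 \<le> idx (lf f)" "idx (lf f) \<le> N" "1 \<le> idx (rf f)" "idx (rf f) \<le> N"
      using False idxR idx_le[OF LF] idx_le[OF RF] by auto
    have r: "r < N" "idx (lf f) = Suc r" using il by (auto simp: r_def)
    have ends: "lo f = fst (lf f)" "mk f = snd (lf f)" "f (mk f) = fst (rf f)" "hi f = snd (rf f)"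
      by (auto simp: lf_def rf_def)
    have bump': "bump (q \<circ> f \<circ> fun_inv q) (q (lo f)) (q (hi f))" by (rule f.conj_bump[OF q.incr_bij_axioms])
    have R_pos: "q z = (if j = Suc N then rot_y r 0 (rot_rep r (rf f) z) else rot_rep r (rf f) z)"
      if "z \<in> {fst (rf f), snd (rf f)}" for z
      using q(3)[OF that] r il by (auto simp: j_def rot_y_def rot_rep_def)
    have step: "inner_step N (rot_y r) (rot_s r) (\<lambda>k. t (k + r)) (feet B) (feet C) (feet (B - C))
      (rot_rep r) (rot_idx r) (q \<circ> f \<circ> fun_inv q) (q (lo f)) (q (hi f)) (lf f) (rf f) j"
    proof (intro inner_step.intro tracking_rot[OF r(1)] inner_step_axioms.intro bump' LF RF LR sepLR)
      show "2 \<le> j" "j \<le> Suc N" using r il by (auto simp: j_def)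
      show "rot_idx r (lf f) = 1" using r by (simp add: rot_idx_def)
      show "rot_idx r (rf f) = (if j = Suc N then 1 else j)" using r il by (auto simp: rot_idx_def j_def)
      have rl: "rot_rep r (lf f) = rep (lf f)" using r by (simp add: rot_rep_def)
      show "q (lo f) = rot_rep r (lf f) (fst (lf f))" using q(2) by (simp add: rl ends)
      have "rep (lf f) (snd (lf f)) = q (mk f)" using q(2) ends by simp
      then have "(q \<circ> f \<circ> fun_inv q) (rot_rep r (lf f) (snd (lf f))) = q (f (mk f))" by (simp add: rl)
      then show "(q \<circ> f \<circ> fun_inv q) (rot_rep r (lf f) (snd (lf f))) =
        (if j = Suc N then rot_y r 0 (rot_rep r (rf f) (fst (rf f))) else rot_rep r (rf f) (fst (rf f)))"
        using R_pos[of "fst (rf f)"] ends by simp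
      show "q (hi f) = (if j = Suc N then rot_y r 0 (rot_rep r (rf f) (snd (rf f))) else rot_rep r (rf f) (snd (rf f)))"
        using R_pos[of "snd (rf f)"] ends by simp
    qed
    interpret I: inner_step N "rot_y r" "rot_s r" "\<lambda>k. t (k + r)" "feet B" "feet C" "feet (B - C)"
      "rot_rep r" "rot_idx r" "q \<circ> f \<circ> fun_inv q" "q (lo f)" "q (hi f)" "lf f" "rf f" j by (rule step)
    show ?thesis
      using tracked_by[OF I.tracking' _ generate_rot[OF r(1)] I.incr q(1)] I.P.generate_Y I.generate_yy by simp
  qed
qed

theorem chain_of_fast_family:
  assumes "2 \<le> card B"
  shows "\<exists>y s t. bump_chain (card B - 1) y s t \<and> generate line_group (range y) = generate line_group B"
proof -
  have "C \<subseteq> B \<Longrightarrow> C \<noteq> {} \<Longrightarrow> tracked C \<Longrightarrow> tracked B" for C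
  proof (induction "card (B - C)" arbitrary: C rule: less_induct)
    case less
    show ?case
    proof (cases "C = B")
      case False
      then obtain f g where fg: "f \<in> B - C" "g \<in> C"
        "lo f < lo g \<and> lo g < hi f \<and> hi f < hi g \<or> lo g < lo f \<and> lo f < hi g \<and> hi g < hi f"
        using connected[OF less.prems(1,2) False] by blast
      then have "tracked (insert f C)" using tracked_insert[OF less.prems _ _ fg(2,3)] by blast
      moreover have "card (B - insert f C) < card (B - C)"
        using fg fin by (intro psubset_card_mono) auto
      ultimately show ?thesis using less.hyps[of "insert f C"] less.prems(1) fg(1) by blast
    qed (use less.prems in simp)
  qed
  then have "tracked B" using tracked_pair[OF assms] by blast
  then show ?thesis unfolding tracked_def tracking_def by blast
qed

end

section \<open>Thompson's groups\<close>

locale thompson =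
  fixes n :: nat
  assumes n_ge: "2 \<le> n"
begin

definition N :: nat where "N = n - 1"
definition \<nu> :: real where "\<nu> = real n"

lemma n_real: "2 \<le> \<nu>" "real N = \<nu> - 1" "1 \<le> real N" "0 < \<nu>" "1 < \<nu>"
  using n_ge by (auto simp: of_nat_diff N_def \<nu>_def)

subsection \<open>The standard generators as maps of the line\<close>

text \<open>In terms of trees, \<open>gen j\<close> hangs an \<open>n\<close>-ary caret below leaf
  \<open>j\<close>: one unit interval is spread over \<open>n\<close> of them, and everything behind
  is renumbered.\<close>

definition gen :: "nat \<Rightarrow> real \<Rightarrow> real" where
  "gen j x = (if x \<le> j then x else if x \<le> j + 1 then j + \<nu> * (x - j) else x + real N)"

lemma gen_simps:
  "x \<le> real j \<Longrightarrow> gen j x = x"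
  "real j \<le> x \<Longrightarrow> x \<le> real j + 1 \<Longrightarrow> gen j x = j + \<nu> * (x - j)"
  "real j + 1 \<le> x \<Longrightarrow> gen j x = x + real N"
proof -
  show "x \<le> real j \<Longrightarrow> gen j x = x" by (simp add: gen_def)
  show "real j \<le> x \<Longrightarrow> x \<le> real j + 1 \<Longrightarrow> gen j x = j + \<nu> * (x - j)"
    by (cases "x = j") (auto simp: gen_def)
  show "real j + 1 \<le> x \<Longrightarrow> gen j x = x + real N"
    using n_real by (cases "x = real j + 1") (auto simp: gen_def)
qed

lemma gen_gt:
  assumes "real j < x" shows "x < gen j x"
proof (cases "x \<le> real j + 1")
  case True
  have "0 < (\<nu> - 1) * (x - j)" using assms n_real by (intro mult_pos_pos) auto
  moreover have "gen j x = x + (\<nu> - 1) * (x - j)" using assms True by (simp add: gen_simps(2) algebra_simps)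
  ultimately show ?thesis by linarith
next
  case False
  then show ?thesis using gen_simps(3)[of j x] n_real by linarith
qed

lemma gen_ge: "x \<le> gen j x"
  using gen_gt[of j x] gen_simps(1)[of x j] by (cases "x \<le> j") auto

lemma incr_gen: "incr_bij (gen j)"
proof
  show "strict_mono (gen j)"
  proof (rule strict_monoI)
    fix x z :: real assume xz: "x < z"
    have 1: "\<nu> * (x - j) < \<nu> * (z - j)" using xz n_real by simp
    have 2: "x \<le> j + 1 \<Longrightarrow> \<nu> * (x - j) \<le> \<nu> * 1" using n_real by (intro mult_left_mono) auto
    have 3: "j < z \<Longrightarrow> 0 < \<nu> * (z - j)" using n_real by simp
    consider "z \<le> j" | "x \<le> j" "j < z" | "j < x" "z \<le> real j + 1"
      | "j < x" "x \<le> real j + 1" "real j + 1 < z" | "real j + 1 < x" by linarith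
    then show "gen j x < gen j z"
    proof cases
      case 1
      then show ?thesis using xz by (simp add: gen_simps)
    next
      case 2
      then show ?thesis using gen_gt[of j z] gen_simps(1)[of x j] xz by linarith
    next
      case 3
      then show ?thesis using gen_simps(2)[of j x] gen_simps(2)[of j z] xz \<open>\<nu> * (x - j) < \<nu> * (z - j)\<close> by linarith
    next
      case 4
      then have "\<nu> * (x - j) \<le> \<nu> * 1" using 2 by simp
      then show ?thesis using gen_simps(2)[of j x] gen_simps(3)[of j z] 4 n_real by linarith
    next
      case 5
      then show ?thesis using gen_simps(3)[of j x] gen_simps(3)[of j z] xz by linarith
    qed
  qed
  have "\<exists>x. gen j x = z" for z
  proof -
    consider "z \<le> j" | "j \<le> z" "z \<le> j + \<nu>" | "j + \<nu> \<le> z" by linarith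
    then show ?thesis
    proof cases
      case 1
      then show ?thesis using gen_simps(1) by blast
    next
      case 2
      have "(z - j) / \<nu> \<le> 1" "0 \<le> (z - j) / \<nu>" using 2 n_real by (auto simp: field_simps)
      then have "gen j (j + (z - j) / \<nu>) = z" using n_real by (subst gen_simps(2)) auto
      then show ?thesis by blast
    next
      case 3
      then have "gen j (z - real N) = z" using n_real by (subst gen_simps(3)) auto
      then show ?thesis by blast
    qed
  qed
  then show "surj (gen j)" by (metis surjI)
qed

sublocale gen: incr_bij "gen j" for j by (rule incr_gen)

text \<open>Each gap is a single integer, and the period comes from \<open>gen 0\<close>, which is
  translation by \<open>N\<close> beyond \<open>1\<close>.\<close>

lemma chain_gen: "bump_chain N gen real real"
proof (rule bump_chain.intro)
  fix k :: nat and x :: real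
  show "gen (k + N) (gen 0 x) = gen 0 (gen k x)" if k: "1 \<le> k"
  proof -
    have k': "1 \<le> real k" using k by simp
    consider "x \<le> 0" | "0 \<le> x" "x \<le> 1" | "1 \<le> x" "x \<le> k" | "real k \<le> x" by linarith
    then show ?thesis
    proof cases
      case 1
      then show ?thesis by (simp add: gen_simps)
    next
      case 2
      have "\<nu> * x \<le> \<nu>" using 2 n_real mult_left_mono[of x 1 \<nu>] by simp
      then have "\<nu> * x \<le> real (k + N)" unfolding of_nat_add using n_real k' by linarith
      then show ?thesis using 2 k' by (simp add: gen_simps)
    next
      case 3
      then show ?thesis using k' by (simp add: gen_simps)
    next
      case 4
      then have g: "gen 0 x = x + real N" using k' by (simp add: gen_simps)
      have "1 \<le> gen k x" using 4 k' gen_ge[of x k] by simp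
      then have g': "gen 0 (gen k x) = gen k x + real N" by (simp add: gen_simps)
      show ?thesis unfolding g g' using 4 by (auto simp: gen_def)
    qed
  qed
  show "1 \<le> N" using n_ge by (simp add: N_def)
  show "real (k + N) = gen 0 (real k)" if "1 \<le> k"
    using that by (simp add: gen_simps)
  then show "1 \<le> k \<Longrightarrow> real (k + N) = gen 0 (real k)" .
  show "real (Suc k) \<le> x \<Longrightarrow> gen k x = gen 0 x" by (simp add: gen_simps)
qed (simp_all add: incr_gen gen_ge gen_gt gen_simps(1))

sublocale chain: bump_chain N gen real real by (rule chain_gen)

subsection \<open>The half-line and the unit interval\<close>

text \<open>The map \<open>\<theta>\<close> takes the unit intervals of the half-line to the leaves of the infinite
  right-branching \<open>n\<close>-ary subdivision of \<open>[0, 1)\<close>.\<close>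

definition \<theta> :: "real \<Rightarrow> real" where
  "\<theta> x = (let m = nat \<lfloor>x / real N\<rfloor> in 1 - (1 - (x - real m * real N) / \<nu>) / \<nu> ^ m)"

text \<open>At the right end of a block the floor already jumps to the next one; the two formulas
  agree there because \<open>1 - real N / \<nu> = 1 / \<nu>\<close>. The closed blocks spare later
  proofs a case distinction.\<close>

lemma \<theta>_piece:
  assumes "real m * real N \<le> x" "x \<le> (real m + 1) * real N"
  shows "\<theta> x = 1 - (1 - (x - real m * real N) / \<nu>) / \<nu> ^ m"
proof (cases "x = (real m + 1) * real N")
  case True
  then have "x / real N = real (Suc m)" using n_real by simp
  then have "nat \<lfloor>x / real N\<rfloor> = Suc m" by (simp only: floor_of_nat nat_int)
  then have "\<theta> x = 1 - 1 / \<nu> ^ Suc m" using True by (simp add: \<theta>_def algebra_simps)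
  moreover have "x - real m * real N = real N" using True by (simp add: algebra_simps)
  moreover have "1 - real N / \<nu> = 1 / \<nu>" using n_real by (simp add: field_simps)
  ultimately show ?thesis by simp
next
  case False
  then have "real m \<le> x / real N" "x / real N < real m + 1"
    using assms n_real by (auto simp: pos_le_divide_eq pos_divide_less_eq)
  then have "\<lfloor>x / real N\<rfloor> = int m" by (intro floor_unique) auto
  then have "nat \<lfloor>x / real N\<rfloor> = m" by simp
  then show ?thesis by (simp add: \<theta>_def)
qed

lemma piece_exists:
  assumes "0 \<le> x" obtains m :: nat where "real m * real N \<le> x" "x < (real m + 1) * real N"
proof -
  define m where "m = nat \<lfloor>x / real N\<rfloor>"
  have "0 \<le> x / real N" using assms by simp
  then have "real m \<le> x / real N" "x / real N < real m + 1" unfolding m_def by linarith+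
  then show ?thesis using that[of m] n_real by (simp add: pos_le_divide_eq pos_divide_less_eq)
qed

lemma \<theta>_first: "0 \<le> x \<Longrightarrow> x \<le> real N \<Longrightarrow> \<theta> x = x / \<nu>"
  using \<theta>_piece[of 0 x] by simp

lemma \<theta>_0 [simp]: "\<theta> 0 = 0"
  using \<theta>_first[of 0] by simp

text \<open>Self-similarity of the infinite subdivision: translation by one block becomes
  contraction towards \<open>1\<close>, which accounts for the slope \<open>1 / \<nu>\<close> of the
  generators near \<open>1\<close>.\<close>

lemma \<theta>_shift:
  assumes "0 \<le> x" shows "\<theta> (x + real N) = 1 - (1 - \<theta> x) / \<nu>"
proof -
  obtain m where m: "real m * real N \<le> x" "x < (real m + 1) * real N" using piece_exists[OF assms] .
  define w where "w = 1 - (x - real m * real N) / \<nu>"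
  have "\<theta> (x + real N) = 1 - (1 - (x + real N - real (Suc m) * real N) / \<nu>) / \<nu> ^ Suc m"
    using m by (intro \<theta>_piece) (auto simp: distrib_right)
  moreover have "x + real N - real (Suc m) * real N = x - real m * real N" by (simp add: algebra_simps)
  ultimately have "\<theta> (x + real N) = 1 - w / \<nu> ^ Suc m" by (simp add: w_def)
  moreover have "\<theta> x = 1 - w / \<nu> ^ m" unfolding w_def using m by (intro \<theta>_piece) auto
  ultimately show ?thesis by simp
qed

lemma \<theta>_bounds:
  assumes "real m * real N \<le> x" "x < (real m + 1) * real N"
  shows "1 - 1 / \<nu> ^ m \<le> \<theta> x" "\<theta> x < 1 - 1 / \<nu> ^ Suc m"
proof -
  define v where "v = 1 - (x - real m * real N) / \<nu>"
  define w where "w = x - real m * real N"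
  have "0 \<le> w" "w < \<nu> - 1" using assms n_real(2) unfolding w_def distrib_right by linarith+
  moreover have "v = 1 - w / \<nu>" by (simp add: v_def w_def)
  moreover have "0 \<le> w / \<nu>" "1 / \<nu> < 1 - w / \<nu>" using calculation(1,2) n_real by (auto simp: field_simps)
  ultimately have v: "v \<le> 1" "1 / \<nu> < v" by simp_all
  have \<theta>: "\<theta> x = 1 - v / \<nu> ^ m" using \<theta>_piece assms by (simp add: v_def)
  have "v / \<nu> ^ m \<le> 1 / \<nu> ^ m" using v n_real by (intro divide_right_mono) auto
  then show "1 - 1 / \<nu> ^ m \<le> \<theta> x" by (simp add: \<theta>)
  have "1 / \<nu> / \<nu> ^ m < v / \<nu> ^ m" using v n_real by (intro divide_strict_right_mono) auto
  then show "\<theta> x < 1 - 1 / \<nu> ^ Suc m" by (simp add: \<theta>)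
qed

lemma \<theta>_less_1:
  assumes "0 \<le> x" shows "\<theta> x < 1"
proof -
  obtain m where m: "real m * real N \<le> x" "x < (real m + 1) * real N" using piece_exists[OF assms] .
  have "0 < 1 / \<nu> ^ Suc m" using n_real by simp
  then show ?thesis using \<theta>_bounds(2)[OF m] by linarith
qed

lemma \<theta>_strict_mono:
  assumes "0 \<le> x" "x < z" shows "\<theta> x < \<theta> z"
proof -
  obtain m where m: "real m * real N \<le> x" "x < (real m + 1) * real N" using piece_exists[OF assms(1)] .
  obtain k where k: "real k * real N \<le> z" "z < (real k + 1) * real N" using piece_exists[of z] assms by auto
  have "real m * real N < (real k + 1) * real N" using m k assms by linarith
  then have mk: "m \<le> k" using n_real by simp
  show ?thesis
  proof (cases "m = k")
    case True
    have "(1 - (z - real m * real N) / \<nu>) / \<nu> ^ m < (1 - (x - real m * real N) / \<nu>) / \<nu> ^ m"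
      using assms n_real by (intro divide_strict_right_mono) (auto simp: divide_strict_right_mono)
    then show ?thesis using \<theta>_piece[of m x] \<theta>_piece[of m z] m k True by simp
  next
    case False
    then have "Suc m \<le> k" using mk by simp
    then have "\<nu> ^ Suc m \<le> \<nu> ^ k" using n_real by (intro power_increasing) auto
    then have "1 / \<nu> ^ k \<le> 1 / \<nu> ^ Suc m" using n_real by (intro divide_left_mono) auto
    then show ?thesis using \<theta>_bounds(2)[OF m] \<theta>_bounds(1)[OF k] by linarith
  qed
qed

lemma \<theta>_less_iff: "0 \<le> x \<Longrightarrow> 0 \<le> z \<Longrightarrow> \<theta> x < \<theta> z \<longleftrightarrow> x < z"
  using \<theta>_strict_mono by (metis linorder_neq_iff order_less_asym)

lemma \<theta>_le_iff: "0 \<le> x \<Longrightarrow> 0 \<le> z \<Longrightarrow> \<theta> x \<le> \<theta> z \<longleftrightarrow> x \<le> z"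
  using \<theta>_less_iff[of z x] by (simp add: not_less[symmetric])

lemma \<theta>_nonneg: "0 \<le> x \<Longrightarrow> 0 \<le> \<theta> x"
  using \<theta>_le_iff[of 0 x] by simp

lemma \<theta>_surj:
  assumes "0 \<le> z" "z < 1" obtains x where "0 \<le> x" "\<theta> x = z"
proof -
  have "\<exists>m. (1 / \<nu>) ^ m < 1 - z" using assms n_real by (intro real_arch_pow_inv) auto
  then have ex: "\<exists>m. 1 / \<nu> ^ m < 1 - z" by (simp add: power_divide)
  \<comment> \<open>The block \<open>m\<close> containing the preimage satisfies
    \<open>1 / \<nu> ^ Suc m < 1 - z \<le> 1 / \<nu> ^ m\<close>, so it is found through the least
    exponent; \<open>x\<close> below solves the linear formula of that block.\<close>
  define k where "k = (LEAST m. 1 / \<nu> ^ m < 1 - z)"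
  have k: "1 / \<nu> ^ k < 1 - z" unfolding k_def by (rule LeastI_ex[OF ex])
  have "k \<noteq> 0" using k assms by (intro notI) simp
  then obtain m where m: "k = Suc m" by (cases k) auto
  have "\<not> 1 / \<nu> ^ m < 1 - z" using not_less_Least[of m "\<lambda>m. 1 / \<nu> ^ m < 1 - z"] m k_def by simp
  then have 1: "(1 - z) * \<nu> ^ m \<le> 1" using n_real by (simp add: field_simps)
  have 2: "1 < (1 - z) * \<nu> ^ m * \<nu>" using k n_real by (simp add: m field_simps)
  define x where "x = real m * real N + \<nu> * (1 - (1 - z) * \<nu> ^ m)"
  have "0 \<le> \<nu> * (1 - (1 - z) * \<nu> ^ m)" using 1 n_real by (intro mult_nonneg_nonneg) auto
  moreover have "\<nu> * (1 - (1 - z) * \<nu> ^ m) \<le> real N" using 2 n_real by (simp add: algebra_simps)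
  ultimately have x: "real m * real N \<le> x" "x \<le> (real m + 1) * real N" by (auto simp: x_def algebra_simps)
  have "\<theta> x = z" using \<theta>_piece[OF x] n_real by (simp add: x_def)
  moreover have "0 \<le> x" using x(1) order_trans[of 0 "real m * real N" x] by simp
  ultimately show ?thesis using that by blast
qed

definition \<theta>inv :: "real \<Rightarrow> real" where
  "\<theta>inv z = (THE x. 0 \<le> x \<and> \<theta> x = z)"

lemma \<theta>inv_\<theta> [simp]: "0 \<le> x \<Longrightarrow> \<theta>inv (\<theta> x) = x"
  unfolding \<theta>inv_def by (rule the_equality) (auto intro: order.antisym simp: \<theta>_le_iff[symmetric])

lemma \<theta>_\<theta>inv: "0 \<le> z \<Longrightarrow> z < 1 \<Longrightarrow> \<theta> (\<theta>inv z) = z \<and> 0 \<le> \<theta>inv z"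
  by (metis \<theta>_surj \<theta>inv_\<theta>)

end

context thompson
begin

abbreviation H :: "(real \<Rightarrow> real) set" where "H \<equiv> generate line_group (range gen)"

lemma incr_H: "u \<in> H \<Longrightarrow> incr_bij u"
  by (rule chain.incr_G)

lemma H_fix: "u \<in> H \<Longrightarrow> x \<le> 0 \<Longrightarrow> u x = x"
  using chain.G_fix[of u x] by simp

lemma H_nonneg: "u \<in> H \<Longrightarrow> 0 \<le> u x \<longleftrightarrow> 0 \<le> x"
  using incr_bij.le_iff[OF incr_H, of u 0 x] H_fix[of u 0] by simp

subsection \<open>Generation\<close>

text \<open>A subdivision of the unit interval into \<open>n\<close>-adic cells, each the image of a unit interval of
  the half-line, with a tail that is a copy of \<open>\<theta>\<close>. Among the cells of maximal depth there are
  \<open>n\<close> consecutive ones with a common parent. Merging them amounts to composition with a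
  generator, or to absorbing them into the tail.\<close>

definition subdivision :: "nat \<Rightarrow> (real \<Rightarrow> real) \<Rightarrow> bool" where
  "subdivision m g \<longleftrightarrow> g 0 = 0 \<and>
     (\<forall>k<m * N. \<exists>A d :: nat. \<forall>u\<in>{0..1}. g (real k + u) = (real A + u) / \<nu> ^ d) \<and>
     (\<exists>e. \<forall>x\<ge>real (m * N). g x = 1 - (1 - \<theta> (x - real (m * N))) / \<nu> ^ e)"

text \<open>Take the leftmost cell \<open>j\<close> of maximal depth. If it has a predecessor, this
  is coarser, so \<open>A j\<close> is a multiple of \<open>n\<close>. A return to smaller depth, or
  the end of the subdivision, can occur only at a multiple of \<open>n\<close> again, so the next
  \<open>n - 1\<close> cells have the same depth.\<close>

lemma sibling_run:
  fixes A d :: "nat \<Rightarrow> nat"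
  assumes K: "1 \<le> K" and A0: "A 0 = 0"
    and next_cell: "\<And>k. k < K \<Longrightarrow> (real (A k) + 1) / \<nu> ^ d k = real (A (Suc k)) / \<nu> ^ d (Suc k)"
    and last: "real (A K) + 1 = \<nu> ^ d K"
  obtains j where "j + N \<le> K" "1 \<le> d j" "n dvd A j" "\<And>r. r < n \<Longrightarrow> d (j + r) = d j \<and> A (j + r) = A j + r"
proof -
  define Dm where "Dm = Max (d ` {..K})"
  have le: "d k \<le> Dm" if "k \<le> K" for k using that by (simp add: Dm_def)
  have "Dm \<in> d ` {..K}" unfolding Dm_def by (intro Max_in) auto
  then have ex: "\<exists>k. k \<le> K \<and> d k = Dm" by auto
  have nat_next: "(A k + 1) * n ^ (Dm - d k) = A (Suc k) * n ^ (Dm - d (Suc k))" if "k < K" for k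
  proof -
    have pow: "z * \<nu> ^ (Dm - i) = z / \<nu> ^ i * \<nu> ^ Dm" if "i \<le> Dm" for i :: nat and z
    proof -
      have "\<nu> ^ Dm = \<nu> ^ i * \<nu> ^ (Dm - i)" using that by (simp flip: power_add)
      then show ?thesis using n_real by simp
    qed
    have "(real (A k) + 1) * \<nu> ^ (Dm - d k) = real (A (Suc k)) * \<nu> ^ (Dm - d (Suc k))"
      unfolding pow[OF le[OF less_imp_le[OF that]]] pow[OF le[OF Suc_leI[OF that]]] next_cell[OF that] ..
    then have "real ((A k + 1) * n ^ (Dm - d k)) = real (A (Suc k) * n ^ (Dm - d (Suc k)))"
      by (simp add: \<nu>_def algebra_simps)
    then show ?thesis by (simp only: of_nat_eq_iff)
  qed
  have last': "A K + 1 = n ^ d K"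
  proof -
    have "real (A K + 1) = real (n ^ d K)" using last by (simp add: \<nu>_def)
    then show ?thesis by (simp only: of_nat_eq_iff)
  qed
  have D1: "1 \<le> Dm"
  proof (rule ccontr)
    assume "\<not> 1 \<le> Dm"
    then have "Dm = 0" by simp
    then have 0: "Dm = 0" "\<And>k. k \<le> K \<Longrightarrow> d k = 0" using le by fastforce+
    have "k \<le> K \<Longrightarrow> A k = k" for k
    proof (induction k)
      case (Suc k)
      then show ?case using nat_next[of k] 0 by simp
    qed (rule A0)
    then show False using last' 0 K by auto
  qed
  define j where "j = (LEAST k. k \<le> K \<and> d k = Dm)"
  have j: "j \<le> K" "d j = Dm" using LeastI_ex[OF ex] by (auto simp: j_def)
  have dvd: "n dvd A j"
  proof (cases j)
    case (Suc i)
    have "d i \<noteq> Dm" using not_less_Least[of i "\<lambda>k. k \<le> K \<and> d k = Dm"] Suc j by (auto simp: j_def)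
    then have "d i < Dm" using le[of i] Suc j by simp
    then have "n dvd n ^ (Dm - d i)" by (intro dvd_power) simp
    moreover have "(A i + 1) * n ^ (Dm - d i) = A j" using nat_next[of i] Suc j by simp
    ultimately show ?thesis by (metis dvd_mult)
  qed (use A0 in simp)
  have run: "j + r \<le> K \<and> d (j + r) = Dm \<and> A (j + r) = A j + r" if "r < n" for r
    using that
  proof (induction r)
    case (Suc r)
    then have IH: "j + r \<le> K" "d (j + r) = Dm" "A (j + r) = A j + r" by auto
    have nd: "\<not> n dvd A j + r + 1"
    proof
      assume "n dvd A j + r + 1"
      then have "n dvd r + 1" using dvd by (metis add.assoc dvd_add_right_iff)
      then show False using Suc.prems by (auto dest: dvd_imp_le)
    qed
    have "j + r \<noteq> K"
    proof
      assume "j + r = K"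
      then have "A j + r + 1 = n ^ Dm" using last' IH by auto
      then show False using nd D1 by (auto intro: dvd_power)
    qed
    then have lt: "j + r < K" using IH by simp
    have e: "A j + r + 1 = A (Suc (j + r)) * n ^ (Dm - d (Suc (j + r)))"
      using nat_next[OF lt] IH by simp
    have "d (Suc (j + r)) = Dm"
    proof (rule ccontr)
      assume "d (Suc (j + r)) \<noteq> Dm"
      then have "d (Suc (j + r)) < Dm" using le[of "Suc (j + r)"] lt by simp
      then have "n dvd n ^ (Dm - d (Suc (j + r)))" by (intro dvd_power) simp
      then show False using nd e by simp
    qed
    then show ?case using lt e by simp
  qed (use j in simp)
  have "j + N \<le> K" using run[of N] n_ge by (simp add: N_def)
  then show ?thesis using that[of j] run j D1 dvd by auto
qed

lemma floor_split:
  assumes "0 \<le> v" "v < \<nu>" obtains r u where "r < n" "v = real r + u" "u \<in> {0..1}"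
proof -
  define r where "r = nat \<lfloor>v\<rfloor>"
  have "real r \<le> v" "v < real r + 1" using assms by (auto simp: r_def)
  moreover from this have "real r < real n" using assms(2) unfolding \<nu>_def by linarith
  ultimately show ?thesis using that[of r "v - real r"] by auto
qed

lemma subdivision_in_H: "subdivision m g \<Longrightarrow> \<exists>u\<in>H. \<forall>x\<ge>0. g x = \<theta> (u x)"
proof (induction m arbitrary: g)
  case 0
  then obtain e where e: "g 0 = 0" "\<And>x. 0 \<le> x \<Longrightarrow> g x = 1 - (1 - \<theta> x) / \<nu> ^ e"
    by (auto simp: subdivision_def)
  \<comment> \<open>The tail already starts at \<open>0\<close>, so \<open>g 0 = 0\<close> leaves no
    contraction.\<close>
  then have "\<nu> ^ e = 1" using e(2)[of 0] n_real by (simp add: field_simps)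
  then have "\<forall>x\<ge>0. g x = \<theta> (id x)" using e(2) by simp
  then show ?case using generate_id by blast
next
  case (Suc m)
  define K where "K = Suc m * N"
  have K: "real K = real (m * N) + real N" "1 \<le> K" using n_ge by (auto simp: K_def N_def)
  obtain e where g0: "g 0 = 0" and tail: "\<And>x. real K \<le> x \<Longrightarrow> g x = 1 - (1 - \<theta> (x - real K)) / \<nu> ^ e"
    and "\<forall>k<K. \<exists>A d :: nat. \<forall>u\<in>{0..1}. g (real k + u) = (real A + u) / \<nu> ^ d"
    using Suc.prems by (auto simp: subdivision_def K_def)
  then obtain A' d' where cell': "\<And>k u. k < K \<Longrightarrow> u \<in> {0..1} \<Longrightarrow> g (real k + u) = (real (A' k) + u) / \<nu> ^ d' k"
    by metis
  \<comment> \<open>The tail counts as cell number \<open>K\<close>, the last one of depth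
    \<open>e\<close>, so that a family of siblings may include it.\<close>
  define A where "A k = (if k < K then A' k else n ^ e - 1)" for k
  define d where "d k = (if k < K then d' k else e)" for k
  have cell: "g (real k + u) = (real (A k) + u) / \<nu> ^ d k" if "k < K" "u \<in> {0..1}" for k u
    using cell' that by (simp add: A_def d_def)
  have AK: "real (A K) + 1 = \<nu> ^ d K"
    using n_ge by (simp add: A_def d_def \<nu>_def of_nat_diff)
  have start: "g (real k) = real (A k) / \<nu> ^ d k" if "k \<le> K" for k
  proof (cases "k < K")
    case True
    then show ?thesis using cell[of k 0] by simp
  next
    case False
    then have "k = K" using that by simp
    then have "g (real k) = 1 - 1 / \<nu> ^ e" using tail[of "real K"] by simp
    moreover have "real (A k) = \<nu> ^ e - 1" "d k = e" using AK \<open>k = K\<close> by (auto simp: d_def)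
    ultimately show ?thesis using n_real by (simp add: field_simps)
  qed
  have next_cell: "(real (A k) + 1) / \<nu> ^ d k = real (A (Suc k)) / \<nu> ^ d (Suc k)" if "k < K" for k
    using cell[OF that, of 1] start[of "Suc k"] that by (simp add: add.commute)
  have "A 0 = 0" using start[of 0] g0 n_real by simp
  then obtain j where j: "j + N \<le> K" "1 \<le> d j" "n dvd A j"
    "\<And>r. r < n \<Longrightarrow> d (j + r) = d j \<and> A (j + r) = A j + r"
    using sibling_run[of K A d] K(2) next_cell AK by blast
  have run: "g (real j + v) = (real (A j) + v) / \<nu> ^ d j" if v: "0 \<le> v" "v < \<nu>" "real j + v \<le> real K" for v
  proof -
    obtain r u where r: "r < n" "v = real r + u" "u \<in> {0..1}" using floor_split[OF v(1,2)] .
    show ?thesis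
    proof (cases "j + r < K")
      case True
      then show ?thesis using cell[of "j + r" u] j(4)[OF r(1)] r by (simp add: add.assoc)
    next
      case False
      then have "real j + v = real (j + r)" "j + r = K" "v = real r" using r v by auto
      then show ?thesis using start[of "j + r"] j(4)[OF r(1)] by (simp flip: of_nat_add)
    qed
  qed
  show ?case
  proof (cases "j + N = K")
    \<comment> \<open>The last sibling is the tail. The other \<open>N\<close> become the first
      block of a larger copy of \<open>\<theta>\<close>, whose exponent is
      \<open>e - 1\<close>.\<close>
    case True
    have jm: "real j = real (m * N)" "j = m * N" using True by (auto simp: K_def)
    have dj: "d j = e" "real (A j) + \<nu> = \<nu> ^ e"
      using j(4)[of N] True AK n_ge n_real by (auto simp: d_def N_def \<nu>_def)
    have "subdivision m g"
      unfolding subdivision_def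
    proof (intro conjI g0)
      have "\<forall>u\<in>{0..1}. g (real k + u) = (real (A k) + u) / \<nu> ^ d k" if "k < m * N" for k
        using cell[of k] that jm(2) j(1) by auto
      then show "\<forall>k<m * N. \<exists>A d :: nat. \<forall>u\<in>{0..1}. g (real k + u) = (real A + u) / \<nu> ^ d"
        by blast
      show "\<exists>e. \<forall>x\<ge>real (m * N). g x = 1 - (1 - \<theta> (x - real (m * N))) / \<nu> ^ e"
      proof (intro exI allI impI)
        fix x assume x: "real (m * N) \<le> x"
        obtain e' where e': "e = Suc e'" using j(2) dj by (cases e) auto
        show "g x = 1 - (1 - \<theta> (x - real (m * N))) / \<nu> ^ (e - 1)"
        proof (cases "x \<le> real K")
          case True
          then have v: "0 \<le> x - real j" "x - real j \<le> real N" "x - real j < \<nu>" using K jm x n_real by auto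
          have "g x = (real (A j) + (x - real j)) / \<nu> ^ e" using run[of "x - real j"] v True dj by simp
          also have "\<dots> = (\<nu> ^ e - \<nu> + (x - real j)) / \<nu> ^ e" using dj by (simp add: algebra_simps)
          also have "\<dots> = 1 - (1 - (x - real j) / \<nu>) / \<nu> ^ e'" using n_real by (simp add: e' field_simps)
          finally show ?thesis using \<theta>_first[OF v(1,2)] jm by (simp add: e')
        next
          case False
          have "x - real (m * N) = (x - real K) + real N" using K by simp
          then have "\<theta> (x - real (m * N)) = \<theta> ((x - real K) + real N)" by (rule arg_cong)
          also have "\<dots> = 1 - (1 - \<theta> (x - real K)) / \<nu>" using False by (intro \<theta>_shift) simp
          finally have "1 - \<theta> (x - real (m * N)) = (1 - \<theta> (x - real K)) / \<nu>" by linarith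
          then show ?thesis using tail[of x] False by (simp only: e') simp
        qed
      qed
    qed
    then show ?thesis by (rule Suc.IH)
  next
    case False
    then have jK: "j + N < K" "j + n \<le> K" using j(1) n_ge by (auto simp: N_def)
    \<comment> \<open>Precomposition with \<open>gen j\<close> merges the siblings: the unit
      interval number \<open>j\<close> of the new map runs through all \<open>n\<close> old
      ones.\<close>
    have "subdivision m (g \<circ> gen j)"
      unfolding subdivision_def
    proof (intro conjI)
      show "(g \<circ> gen j) 0 = 0" using g0 by (simp add: gen_simps)
      have "j + 1 \<le> m * N" using jK by (simp add: K_def)
      then have mN: "real j + 1 \<le> real (m * N)" by linarith
      have "(g \<circ> gen j) x = 1 - (1 - \<theta> (x - real (m * N))) / \<nu> ^ e" if "real (m * N) \<le> x" for x
      proof -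
        have "gen j x = x + real N" using that mN by (intro gen_simps(3)) linarith
        then show ?thesis using tail[of "x + real N"] K(1) that by simp
      qed
      then show "\<exists>e. \<forall>x\<ge>real (m * N). (g \<circ> gen j) x = 1 - (1 - \<theta> (x - real (m * N))) / \<nu> ^ e"
        by blast
      have "\<exists>A d :: nat. \<forall>u\<in>{0..1}. (g \<circ> gen j) (real k + u) = (real A + u) / \<nu> ^ d" if k: "k < m * N" for k
      proof -
        consider "k < j" | "k = j" | "j < k" by linarith
        then show ?thesis
        proof cases
          case 1
          then have "\<forall>u\<in>{0..1}. (g \<circ> gen j) (real k + u) = (real (A k) + u) / \<nu> ^ d k"
            using cell[of k] jK by (auto simp: gen_simps(1))
          then show ?thesis by blast
        next
          case 2
          obtain a where a: "A j = n * a" using j(3) by blast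
          obtain d0 where d0: "d j = Suc d0" using j(2) by (cases "d j") auto
          have "(g \<circ> gen j) (real k + u) = (real a + u) / \<nu> ^ d0" if u: "u \<in> {0..1}" for u
          proof -
            have gj: "gen j (real j + u) = real j + \<nu> * u" using u by (simp add: gen_simps(2))
            have "g (real j + \<nu> * u) = (real (A j) + \<nu> * u) / \<nu> ^ d j"
            \<comment> \<open>\<open>run\<close> stops short of \<open>v = \<nu>\<close>; the right
              end of the merged cell is that of the last sibling.\<close>
            proof (cases "u = 1")
              case True
              have "g (real (j + N) + 1) = (real (A j + N) + 1) / \<nu> ^ d j"
                using cell[OF jK(1), of 1] j(4)[of N] n_ge by (simp add: N_def)
              moreover have "real (j + N) + 1 = real j + \<nu>" "real (A j + N) + 1 = real (A j) + \<nu>" using n_real by auto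
              ultimately show ?thesis using True by (simp only: mult_1_right)
            next
              case False
              then have "\<nu> * u < \<nu> * 1" using u n_real by (intro mult_strict_left_mono) auto
              moreover have "0 \<le> \<nu> * u" using u n_real by simp
              moreover have "real j + \<nu> \<le> real K" using jK(2) unfolding \<nu>_def by linarith
              ultimately show ?thesis using run[of "\<nu> * u"] by linarith
            qed
            also have "\<dots> = \<nu> * (real a + u) / (\<nu> * \<nu> ^ d0)"
              by (simp add: a d0 \<nu>_def[symmetric] distrib_left)
            also have "\<dots> = (real a + u) / \<nu> ^ d0" using n_real by (intro mult_divide_mult_cancel_left) simp
            finally show ?thesis using 2 gj by simp
          qed
          then show ?thesis by blast
        next
          case 3
          have "(g \<circ> gen j) (real k + u) = (real (A (k + N)) + u) / \<nu> ^ d (k + N)" if "u \<in> {0..1}" for u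
          proof -
            have "gen j (real k + u) = real (k + N) + u" using 3 that by (simp add: gen_simps(3))
            moreover have "k + N < K" using k by (simp add: K_def)
            ultimately show ?thesis using cell[of "k + N" u] that by simp
          qed
          then show ?thesis by blast
        qed
      qed
      then show "\<forall>k<m * N. \<exists>A d :: nat. \<forall>u\<in>{0..1}. (g \<circ> gen j) (real k + u) = (real A + u) / \<nu> ^ d"
        by blast
    qed
    then obtain u where u: "u \<in> H" "\<And>x. 0 \<le> x \<Longrightarrow> g (gen j x) = \<theta> (u x)"
      using Suc.IH[OF \<open>subdivision m (g \<circ> gen j)\<close>] unfolding comp_apply by blast
    have inv0: "0 \<le> fun_inv (gen j) x" if "0 \<le> x" for x
      using that gen_simps(1)[of 0 j] by (simp add: gen.le_inv)
    have "u \<circ> fun_inv (gen j) \<in> H" by (intro generate_comp u chain.inv_G chain.y_in_G)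
    moreover have "g x = \<theta> ((u \<circ> fun_inv (gen j)) x)" if "0 \<le> x" for x
      using u(2)[OF inv0[OF that]] by simp
    ultimately show ?thesis by blast
  qed
qed

end

context thompson
begin

subsection \<open>Arithmetic of piecewise linear maps\<close>

abbreviation Zn :: "real set" where "Zn \<equiv> Z_inverse n"

lemma ZnI: "of_int a / \<nu> ^ k \<in> Zn"
  by (auto simp: Z_inverse_def \<nu>_def)

lemma ZnE: assumes "x \<in> Zn" obtains a :: int and k :: nat where "x = of_int a / \<nu> ^ k"
  using assms by (auto simp: Z_inverse_def \<nu>_def)

lemma Zn_raise: "of_int a / \<nu> ^ k = of_int (a * int n ^ l) / \<nu> ^ (k + l)"
  using n_real by (simp add: power_add \<nu>_def[symmetric])

lemma Zn_raise_le: "k \<le> l \<Longrightarrow> \<exists>b :: int. of_int a / \<nu> ^ k = of_int b / \<nu> ^ l"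
  using Zn_raise[of a k "l - k"] by (intro exI[of _ "a * int n ^ (l - k)"]) simp

lemma Zn_add: "x \<in> Zn \<Longrightarrow> z \<in> Zn \<Longrightarrow> x + z \<in> Zn"
proof -
  assume "x \<in> Zn" "z \<in> Zn"
  then obtain a k b l where ab: "x = of_int a / \<nu> ^ k" "z = of_int b / \<nu> ^ l" by (metis ZnE)
  obtain a' where a': "x = of_int a' / \<nu> ^ (k + l)" using Zn_raise_le[of k "k + l" a] ab by auto
  obtain b' where b': "z = of_int b' / \<nu> ^ (k + l)" using Zn_raise_le[of l "k + l" b] ab by auto
  have "x + z = of_int (a' + b') / \<nu> ^ (k + l)" by (simp add: a' b' add_divide_distrib)
  then show "x + z \<in> Zn" using ZnI by metis
qed

lemma Zn_mult: "x \<in> Zn \<Longrightarrow> z \<in> Zn \<Longrightarrow> x * z \<in> Zn"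
proof -
  assume "x \<in> Zn" "z \<in> Zn"
  then obtain a k b l where "x = of_int a / \<nu> ^ k" "z = of_int b / \<nu> ^ l" by (metis ZnE)
  then have "x * z = of_int (a * b) / \<nu> ^ (k + l)" by (simp add: power_add)
  then show "x * z \<in> Zn" using ZnI by metis
qed

lemma Zn_of_int: "of_int a \<in> Zn"
  using ZnI[of a 0] by simp

lemma Zn_of_nat: "of_nat a \<in> Zn"
  using Zn_of_int[of "int a"] by simp

lemma Zn_uminus: "x \<in> Zn \<Longrightarrow> - x \<in> Zn"
  using Zn_mult[OF Zn_of_int[of "-1"], of x] by simp

lemma Zn_diff: "x \<in> Zn \<Longrightarrow> z \<in> Zn \<Longrightarrow> x - z \<in> Zn"
  using Zn_add[OF _ Zn_uminus, of x z] by simp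

lemma Zn_inverse_pow: "1 / \<nu> ^ k \<in> Zn"
  using ZnI[of 1 k] by simp

lemma Zn_pow: "\<nu> ^ k \<in> Zn"
  using Zn_of_nat[of "n ^ k"] by (simp add: \<nu>_def)

lemma Zn_powi: "\<nu> powi k \<in> Zn"
  using Zn_pow Zn_inverse_pow[of "nat (- k)"] by (simp add: power_int_def inverse_eq_divide power_divide)

lemma Zn_div_pow: "x \<in> Zn \<Longrightarrow> x / \<nu> ^ k \<in> Zn"
  using Zn_mult[OF _ Zn_inverse_pow, of x k] by simp

lemma common_denominator:
  assumes "finite P" "P \<subseteq> Zn" obtains e where "\<And>p. p \<in> P \<Longrightarrow> \<exists>a :: int. p = of_int a / \<nu> ^ e"
proof -
  have "\<exists>e. \<forall>p\<in>P. \<exists>a :: int. p = of_int a / \<nu> ^ e"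
    using assms
  proof (induction P rule: finite_induct)
    case (insert p P)
    then obtain e where e: "\<forall>p\<in>P. \<exists>a :: int. p = of_int a / \<nu> ^ e" by auto
    obtain a k where a: "p = of_int a / \<nu> ^ k" using insert.prems by (auto elim: ZnE)
    have "\<exists>b :: int. q = of_int b / \<nu> ^ (e + k)" if q: "q \<in> insert p P" for q
    proof (cases "q = p")
      case True
      then show ?thesis using Zn_raise_le[of k "e + k" a] a by auto
    next
      case False
      then obtain b where "q = of_int b / \<nu> ^ e" using q e by auto
      then show ?thesis using Zn_raise_le[of e "e + k" b] by auto
    qed
    then show ?case by blast
  qed simp
  then show ?thesis using that by blast
qed

section \<open>Piecewise linear homeomorphisms of the unit interval\<close>

lemma unit_homeo:
  assumes "f \<in> homeo_plus {0..1}"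
  shows "f 0 = 0" "f 1 = 1" "x \<in> {0..1} \<Longrightarrow> f x \<in> {0..1}" "f ` {0..1} = {0..1}"
    "x \<in> {0..1} \<Longrightarrow> z \<in> {0..1} \<Longrightarrow> f x < f z \<longleftrightarrow> x < z" "f \<in> extensional {0..1}"
proof -
  have sm: "strict_mono_on {0..1} f" and bij: "bij_betw f {0..1} {0..1}" and ext: "f \<in> extensional {0..1}"
    using assms by (auto simp: homeo_plus_def Bij_def)
  show img: "f ` {0..1} = {0..1}" using bij by (simp add: bij_betw_def)
  show less: "x \<in> {0..1} \<Longrightarrow> z \<in> {0..1} \<Longrightarrow> f x < f z \<longleftrightarrow> x < z" for x z
    using strict_mono_onD[OF sm, of x z] strict_mono_onD[OF sm, of z x] by (cases x z rule: linorder_cases) auto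
  show "f x \<in> {0..1}" if "x \<in> {0..1}" for x using img that by auto
  then have b: "f 0 \<in> {0..1}" "f 1 \<in> {0..1}" by auto
  obtain x0 where x0: "x0 \<in> {0..1}" "f x0 = 0" using img by (metis atLeastAtMost_iff imageE order_refl zero_le_one)
  obtain x1 where x1: "x1 \<in> {0..1}" "f x1 = 1" using img by (metis atLeastAtMost_iff imageE order_refl zero_le_one)
  show "f 0 = 0" using less[of 0 x0] x0 b by (cases "x0 = 0") auto
  show "f 1 = 1" using less[of x1 1] x1 b by (cases "x1 = 1") auto
  show "f \<in> extensional {0..1}" by (rule ext)
qed

lemma thompson_homeo: "f \<in> thompson_carrier n \<Longrightarrow> f \<in> homeo_plus {0..1}"
  by (simp add: thompson_carrier_def)

definition linear_off :: "real set \<Rightarrow> (real \<Rightarrow> real) \<Rightarrow> bool" where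
  "linear_off P f \<longleftrightarrow> (\<forall>s t. 0 \<le> s \<and> s < t \<and> t \<le> 1 \<and> {s<..<t} \<inter> P = {} \<longrightarrow>
     (\<exists>(k::int) c. \<forall>x\<in>{s..t}. f x = \<nu> powi k * x + c))"

lemma thompson_iff:
  "f \<in> thompson_carrier n \<longleftrightarrow> f \<in> homeo_plus {0..1} \<and> (\<exists>P. finite P \<and> P \<subseteq> Zn \<and> linear_off P f)"
  by (simp add: thompson_carrier_def linear_off_def \<nu>_def)

lemma linear_offD:
  "linear_off P f \<Longrightarrow> 0 \<le> s \<Longrightarrow> s < t \<Longrightarrow> t \<le> 1 \<Longrightarrow> {s<..<t} \<inter> P = {} \<Longrightarrow>
     \<exists>(k::int) c. \<forall>x\<in>{s..t}. f x = \<nu> powi k * x + c"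
  unfolding linear_off_def by blast

text \<open>Once \<open>e\<close> clears the denominators of all breakpoints, these are grid points
  and never interior to a cell.\<close>

lemma grid_pieces:
  assumes "f \<in> thompson_carrier n"
  obtains e \<kappa> c where "\<And>l x. l < n ^ e \<Longrightarrow> real l / \<nu> ^ e \<le> x \<Longrightarrow> x \<le> (real l + 1) / \<nu> ^ e \<Longrightarrow>
    f x = \<nu> powi \<kappa> l * x + c l"
proof -
  obtain P where P: "finite P" "P \<subseteq> Zn" "linear_off P f"
    using assms unfolding thompson_iff by blast
  obtain e where e: "\<And>p. p \<in> P \<Longrightarrow> \<exists>a :: int. p = of_int a / \<nu> ^ e" using common_denominator[OF P(1,2)] by blast
  have pos: "0 < \<nu> ^ e" using n_real by simp
  have "\<exists>(k::int) c. \<forall>x\<in>{real l / \<nu> ^ e..(real l + 1) / \<nu> ^ e}. f x = \<nu> powi k * x + c" if l: "l < n ^ e" for l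
  proof (rule linear_offD[OF P(3)])
    have "real l + 1 \<le> real (n ^ e)" using l by linarith
    then have "real l + 1 \<le> \<nu> ^ e" by (simp add: \<nu>_def)
    then show "(real l + 1) / \<nu> ^ e \<le> 1" using pos by simp
    show "0 \<le> real l / \<nu> ^ e" "real l / \<nu> ^ e < (real l + 1) / \<nu> ^ e"
      using pos by (auto simp: divide_strict_right_mono)
    show "{real l / \<nu> ^ e<..<(real l + 1) / \<nu> ^ e} \<inter> P = {}"
    proof (rule ccontr)
      assume "{real l / \<nu> ^ e<..<(real l + 1) / \<nu> ^ e} \<inter> P \<noteq> {}"
      then obtain p where p: "p \<in> P" "real l / \<nu> ^ e < p" "p < (real l + 1) / \<nu> ^ e" by auto
      obtain a :: int where "p = of_int a / \<nu> ^ e" using e[OF p(1)] by blast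
      then have "real l < of_int a" "of_int a < real l + 1" using p pos by (auto simp: divide_less_cancel)
      then have "real_of_int (int l) < of_int a" "real_of_int a < of_int (int l + 1)" by auto
      then show False unfolding of_int_less_iff by linarith
    qed
  qed
  then show ?thesis using that[of e] by (metis atLeastAtMost_iff)
qed

lemma cells:
  assumes f: "f \<in> thompson_carrier n"
  obtains e where "\<And>l. l < n ^ e \<Longrightarrow> \<exists>A d :: nat. \<forall>u\<in>{0..1}. f ((real l + u) / \<nu> ^ e) = (real A + u) / \<nu> ^ d"
proof -
  note h = unit_homeo[OF thompson_homeo[OF f]]
  obtain e0 \<kappa> c where piece: "\<And>l x. l < n ^ e0 \<Longrightarrow> real l / \<nu> ^ e0 \<le> x \<Longrightarrow> x \<le> (real l + 1) / \<nu> ^ e0 \<Longrightarrow>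
    f x = \<nu> powi \<kappa> l * x + c l"
    using grid_pieces[OF f] by blast
  have pos: "0 < \<nu> ^ k" for k using n_real by simp
  have vals: "l \<le> n ^ e0 \<Longrightarrow> f (real l / \<nu> ^ e0) \<in> Zn" for l
  proof (induction l)
    case 0
    then show ?case using h(1) Zn_of_int[of 0] by simp
  next
    case (Suc l)
    have "f (real l / \<nu> ^ e0) = \<nu> powi \<kappa> l * (real l / \<nu> ^ e0) + c l"
      "f (real (Suc l) / \<nu> ^ e0) = \<nu> powi \<kappa> l * (real (Suc l) / \<nu> ^ e0) + c l"
      using piece[of l "real l / \<nu> ^ e0"] piece[of l "real (Suc l) / \<nu> ^ e0"] Suc pos[of e0]
      by (auto simp: divide_right_mono)
    then have "f (real (Suc l) / \<nu> ^ e0) = f (real l / \<nu> ^ e0) + \<nu> powi \<kappa> l * (1 / \<nu> ^ e0)"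
      by (simp add: algebra_simps add_divide_distrib)
    moreover have "f (real l / \<nu> ^ e0) \<in> Zn" using Suc by simp
    ultimately show ?case by (simp only: of_nat_Suc) (intro Zn_add Zn_mult Zn_powi Zn_inverse_pow)
  qed
  have "finite ((\<lambda>l. f (real l / \<nu> ^ e0)) ` {..n ^ e0})" "(\<lambda>l. f (real l / \<nu> ^ e0)) ` {..n ^ e0} \<subseteq> Zn"
    using vals by auto
  then obtain e1 where "\<And>p. p \<in> (\<lambda>l. f (real l / \<nu> ^ e0)) ` {..n ^ e0} \<Longrightarrow> \<exists>a :: int. p = of_int a / \<nu> ^ e1"
    using common_denominator by blast
  then have e1: "\<And>l. l \<le> n ^ e0 \<Longrightarrow> \<exists>a :: int. f (real l / \<nu> ^ e0) = of_int a / \<nu> ^ e1" by blast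
  define b where "b = (\<Sum>l<n ^ e0. nat \<bar>\<kappa> l\<bar>)"
  have b: "\<bar>\<kappa> l\<bar> \<le> int b" if "l < n ^ e0" for l
  proof -
    have "nat \<bar>\<kappa> l\<bar> \<le> b" unfolding b_def using that by (intro member_le_sum) auto
    then show ?thesis by linarith
  qed
  \<comment> \<open>\<open>e0\<close> puts the breakpoints on the grid, \<open>e1\<close> clears the
    denominators of the values there, and \<open>b\<close> bounds the slope exponents, so that the
    depth \<open>e - \<kappa> l0\<close> of an image cell is at least \<open>e1\<close>.\<close>
  define e where "e = e0 + e1 + b"
  have "\<exists>A d :: nat. \<forall>u\<in>{0..1}. f ((real l + u) / \<nu> ^ e) = (real A + u) / \<nu> ^ d" if l: "l < n ^ e" for l
  proof -
    define q where "q = n ^ (e1 + b)"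
    define l0 where "l0 = l div q"
    define r where "r = l mod q"
    have q: "real q = \<nu> ^ (e1 + b)" "0 < q" using n_ge by (auto simp: q_def \<nu>_def)
    have ne: "n ^ e = q * n ^ e0" by (simp add: e_def q_def power_add)
    have \<nu>e: "\<nu> ^ e = real q * \<nu> ^ e0" by (simp add: e_def q power_add)
    have l0: "l0 < n ^ e0" using l ne q(2) by (simp add: l0_def less_mult_imp_div_less mult.commute)
    have lr: "real l = real l0 * real q + real r"
      unfolding l0_def r_def by (simp flip: of_nat_mult of_nat_add)
    have rq: "real r + 1 \<le> real q" using mod_less_divisor[OF q(2), of l] unfolding r_def by linarith
    define d where "d = nat (int e - \<kappa> l0)"
    have de: "int d = int e - \<kappa> l0" and d1: "e1 \<le> d"
      using b[OF l0] by (auto simp: d_def e_def)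
    have \<nu>d: "\<nu> powi \<kappa> l0 = \<nu> ^ e / \<nu> ^ d"
    proof -
      have "\<nu> powi \<kappa> l0 = \<nu> powi (int e - int d)" using de by simp
      also have "\<dots> = \<nu> ^ e / \<nu> ^ d" using n_real by (simp add: power_int_diff)
      finally show ?thesis .
    qed
    obtain a :: int where a: "f (real l0 / \<nu> ^ e0) = of_int a / \<nu> ^ d"
      using e1[of l0] l0 Zn_raise_le[OF d1] by (metis less_imp_le)
    have "real l0 / \<nu> ^ e0 \<in> {0..1}"
    proof -
      have "real l0 \<le> real (n ^ e0)" using l0 by linarith
      then show ?thesis using pos[of e0] by (simp add: \<nu>_def)
    qed
    then have "0 \<le> of_int a / \<nu> ^ d" using h(3) a by (metis atLeastAtMost_iff)
    then have a0: "0 \<le> a" using pos[of d] by (simp add: zero_le_divide_iff)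
    have "f ((real l + u) / \<nu> ^ e) = (real (nat a + r) + u) / \<nu> ^ d" if u: "u \<in> {0..1}" for u
    proof -
      define x where "x = (real l + u) / \<nu> ^ e"
      have x: "x = real l0 / \<nu> ^ e0 + (real r + u) / \<nu> ^ e"
      proof -
        have "real l0 / \<nu> ^ e0 = real l0 * real q / (real q * \<nu> ^ e0)" using q(2) by simp
        then show ?thesis unfolding x_def lr \<nu>e by (simp only: add_divide_distrib add.assoc)
      qed
      have "0 \<le> (real r + u) / \<nu> ^ e" using u pos[of e] by simp
      moreover have "(real r + u) / \<nu> ^ e \<le> 1 / \<nu> ^ e0"
      proof -
        have "(real r + u) / \<nu> ^ e \<le> real q / \<nu> ^ e" using u rq pos[of e] by (intro divide_right_mono) auto
        also have "\<dots> = 1 / \<nu> ^ e0" using q(2) by (simp add: \<nu>e)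
        finally show ?thesis .
      qed
      ultimately have "real l0 / \<nu> ^ e0 \<le> x" "x \<le> (real l0 + 1) / \<nu> ^ e0"
        by (auto simp: x add_divide_distrib)
      then have "f x = \<nu> powi \<kappa> l0 * x + c l0" using piece[OF l0] by blast
      moreover have "f (real l0 / \<nu> ^ e0) = \<nu> powi \<kappa> l0 * (real l0 / \<nu> ^ e0) + c l0"
        using piece[OF l0, of "real l0 / \<nu> ^ e0"] pos[of e0] by (simp add: divide_right_mono)
      ultimately have "f x = f (real l0 / \<nu> ^ e0) + \<nu> powi \<kappa> l0 * ((real r + u) / \<nu> ^ e)"
        by (simp add: x algebra_simps)
      also have "\<dots> = of_int a / \<nu> ^ d + (real r + u) / \<nu> ^ d" using a \<nu>d n_real by simp
      also have "\<dots> = (real (nat a + r) + u) / \<nu> ^ d" using a0 by (simp add: add_divide_distrib)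
      finally show ?thesis by (simp add: x_def)
    qed
    then show ?thesis by blast
  qed
  then show ?thesis using that by blast
qed

lemma cell_of:
  assumes "x \<in> {0..1}" obtains l u where "l < n ^ e" "u \<in> {0..1}" "x = (real l + u) / \<nu> ^ e"
proof (cases "x = 1")
  case True
  have "0 < n ^ e" using n_ge by simp
  moreover have "real (n ^ e - 1) + 1 = \<nu> ^ e"
  proof -
    have "n ^ e - 1 + 1 = n ^ e" using \<open>0 < n ^ e\<close> by simp
    then have "real (n ^ e - 1 + 1) = real (n ^ e)" by (rule arg_cong)
    then show ?thesis by (simp add: \<nu>_def)
  qed
  moreover have "0 < \<nu> ^ e" using n_real by simp
  ultimately show ?thesis using that[of "n ^ e - 1" 1] True n_real by simp
next
  case False
  have pos: "0 < \<nu> ^ e" using n_real by simp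
  define l where "l = nat \<lfloor>x * \<nu> ^ e\<rfloor>"
  have "0 \<le> x * \<nu> ^ e" "x * \<nu> ^ e < 1 * \<nu> ^ e" using assms False pos by (auto intro!: mult_strict_right_mono)
  then have "real l \<le> x * \<nu> ^ e" "x * \<nu> ^ e < real l + 1" "real l < \<nu> ^ e" by (auto simp: l_def) linarith+
  moreover from this have "l < n ^ e" unfolding \<nu>_def by (metis of_nat_less_iff of_nat_power)
  ultimately show ?thesis using that[of l "x * \<nu> ^ e - real l"] n_real by auto
qed

text \<open>Within a cell only integers are added and powers of \<open>n\<close> divided out, which
  is reversible in \<open>Z[1/n]\<close>. It keeps the breakpoints of composites and inverses
  \<open>n\<close>-adic.\<close>

lemma thompson_Zn:
  assumes f: "f \<in> thompson_carrier n" and x: "x \<in> {0..1}"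
  shows "f x \<in> Zn \<longleftrightarrow> x \<in> Zn"
proof -
  obtain e where e: "\<And>l. l < n ^ e \<Longrightarrow> \<exists>A d :: nat. \<forall>u\<in>{0..1}. f ((real l + u) / \<nu> ^ e) = (real A + u) / \<nu> ^ d"
    using cells[OF f] by blast
  have iff: "(real A + u) / \<nu> ^ d \<in> Zn \<longleftrightarrow> u \<in> Zn" for A d u
  proof
    assume "(real A + u) / \<nu> ^ d \<in> Zn"
    then have "(real A + u) / \<nu> ^ d * \<nu> ^ d - real A \<in> Zn" by (intro Zn_diff Zn_mult Zn_pow Zn_of_nat)
    then show "u \<in> Zn" using n_real by simp
  qed (intro Zn_div_pow Zn_add Zn_of_nat)
  obtain l u where lu: "l < n ^ e" "u \<in> {0..1}" "x = (real l + u) / \<nu> ^ e" using cell_of[OF x] .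
  obtain A d :: nat where "f x = (real A + u) / \<nu> ^ d" using e[OF lu(1)] lu by blast
  then show ?thesis using iff lu(3) by simp
qed

end

context thompson
begin

subsection \<open>The action on the half-line\<close>

definition lift :: "(real \<Rightarrow> real) \<Rightarrow> real \<Rightarrow> real" where
  "lift f x = (if x < 0 then x else \<theta>inv (f (\<theta> x)))"

lemma unit_homeo_less_1:
  assumes "f \<in> homeo_plus {0..1}" "0 \<le> z" "z < 1" shows "0 \<le> f z" "f z < 1"
  using unit_homeo(3)[OF assms(1), of z] unit_homeo(5)[OF assms(1), of z 1] unit_homeo(2)[OF assms(1)] assms by auto

lemma \<theta>_lift:
  assumes "f \<in> homeo_plus {0..1}" "0 \<le> x"
  shows "\<theta> (lift f x) = f (\<theta> x)" "0 \<le> lift f x"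
  using \<theta>_\<theta>inv[of "f (\<theta> x)"] unit_homeo_less_1[OF assms(1), of "\<theta> x"] \<theta>_nonneg[OF assms(2)] \<theta>_less_1[OF assms(2)] assms(2)
  by (auto simp: lift_def)

lemma lift_eqI:
  assumes "f \<in> homeo_plus {0..1}" "\<And>x. x < 0 \<Longrightarrow> u x = x" "\<And>x. 0 \<le> x \<Longrightarrow> 0 \<le> u x \<and> f (\<theta> x) = \<theta> (u x)"
  shows "lift f = u"
proof
  fix x show "lift f x = u x"
    using assms(2,3)[of x] by (cases "x < 0") (auto simp: lift_def)
qed

lemma lift_compose:
  assumes f: "f \<in> homeo_plus {0..1}" and g: "g \<in> homeo_plus {0..1}" and fg: "compose {0..1} f g \<in> homeo_plus {0..1}"
  shows "lift (compose {0..1} f g) = lift f \<circ> lift g"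
proof (rule lift_eqI[OF fg])
  fix x :: real
  show "x < 0 \<Longrightarrow> (lift f \<circ> lift g) x = x" by (simp add: lift_def)
  assume x: "0 \<le> x"
  show "0 \<le> (lift f \<circ> lift g) x \<and> compose {0..1} f g (\<theta> x) = \<theta> ((lift f \<circ> lift g) x)"
    using \<theta>_lift[OF g x] \<theta>_lift[OF f \<theta>_lift(2)[OF g x]] \<theta>_nonneg[OF x] \<theta>_less_1[OF x] by (simp add: compose_eq)
qed

lemma lift_inject:
  assumes f: "f \<in> homeo_plus {0..1}" and g: "g \<in> homeo_plus {0..1}" and e: "lift f = lift g"
  shows "f = g"
proof (rule extensionalityI[OF unit_homeo(6)[OF f] unit_homeo(6)[OF g]])
  fix z :: real assume z: "z \<in> {0..1}"
  show "f z = g z"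
  proof (cases "z = 1")
    case True
    then show ?thesis using unit_homeo(2)[OF f] unit_homeo(2)[OF g] by simp
  next
    case False
    then obtain x where "0 \<le> x" "\<theta> x = z" using \<theta>_surj[of z] z by auto
    then show ?thesis using \<theta>_lift(1)[OF f, of x] \<theta>_lift(1)[OF g, of x] e by simp
  qed
qed

text \<open>The tree pair of \<open>f\<close>: \<open>W\<close> parametrises the regular grid of
  level \<open>e\<close> with a copy of \<open>\<theta>\<close> in the last cell, and
  \<open>f \<circ> W\<close> is again a subdivision with equally many cells. Hence \<open>W\<close>
  is \<open>\<theta> \<circ> v\<close> and \<open>f \<circ> W\<close> is
  \<open>\<theta> \<circ> u\<close> on the half-line with \<open>u\<close>, \<open>v\<close> in
  \<open>H\<close>, and \<open>u \<circ> fun_inv v\<close> is the lift.\<close>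

lemma lift_in_H:
  assumes f: "f \<in> thompson_carrier n" shows "lift f \<in> H"
proof -
  note fh = thompson_homeo[OF f] and h = unit_homeo[OF thompson_homeo[OF f]]
  obtain e where e: "\<And>l. l < n ^ e \<Longrightarrow> \<exists>A d :: nat. \<forall>u\<in>{0..1}. f ((real l + u) / \<nu> ^ e) = (real A + u) / \<nu> ^ d"
    using cells[OF f] by blast
  \<comment> \<open>As \<open>n\<close> is \<open>1\<close> modulo \<open>N\<close>, the full grid
    consists of \<open>m * N\<close> ordinary cells and one more for the tail.\<close>
  obtain m where m: "n ^ e = Suc (m * N)"
  proof -
    have nN: "n = Suc N" using n_ge by (simp add: N_def)
    have "\<exists>m. n ^ k = Suc (m * N)" for k
    proof (induction k)
      case (Suc k)
      then obtain m where "n ^ k = Suc (m * N)" by blast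
      then have "n ^ Suc k = n * m * N + n" by simp
      then have "n ^ Suc k = Suc ((n * m + 1) * N)" using nN by simp
      then show ?case by blast
    qed (intro exI[of _ 0], simp)
    then show ?thesis using that by blast
  qed
  have \<nu>e: "\<nu> ^ e = real (m * N) + 1" using m by (metis \<nu>_def of_nat_Suc of_nat_power add.commute)
  have pos: "0 < \<nu> ^ k" for k using n_real by simp
  define W where "W x = (if x \<le> real (m * N) then x / \<nu> ^ e else 1 - (1 - \<theta> (x - real (m * N))) / \<nu> ^ e)" for x
  have W_tail: "W x = (real (m * N) + \<theta> (x - real (m * N))) / \<nu> ^ e" if "real (m * N) \<le> x" for x
    using that pos[of e] by (cases "x = real (m * N)") (auto simp: W_def field_simps \<nu>e)
  have W_cell: "W (real k + u) = (real k + u) / \<nu> ^ e" if "k < m * N" "u \<in> {0..1}" for k u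
  proof -
    have "real k + u \<le> real (m * N)" using that by (simp flip: of_nat_Suc of_nat_mult)
    then show ?thesis by (simp add: W_def)
  qed
  have "subdivision m W"
    unfolding subdivision_def
  proof (intro conjI)
    show "W 0 = 0" by (simp add: W_def)
    show "\<forall>k<m * N. \<exists>A d :: nat. \<forall>u\<in>{0..1}. W (real k + u) = (real A + u) / \<nu> ^ d" using W_cell by blast
    have "W x = 1 - (1 - \<theta> (x - real (m * N))) / \<nu> ^ e" if "real (m * N) \<le> x" for x
      using W_tail[OF that] pos[of e] \<nu>e by (simp add: field_simps)
    then show "\<exists>e. \<forall>x\<ge>real (m * N). W x = 1 - (1 - \<theta> (x - real (m * N))) / \<nu> ^ e" by blast
  qed
  then obtain v where v: "v \<in> H" "\<And>x. 0 \<le> x \<Longrightarrow> W x = \<theta> (v x)" using subdivision_in_H by blast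
  have "subdivision m (f \<circ> W)"
    unfolding subdivision_def
  proof (intro conjI)
    show "(f \<circ> W) 0 = 0" using h(1) by (simp add: W_def)
    show "\<forall>k<m * N. \<exists>A d :: nat. \<forall>u\<in>{0..1}. (f \<circ> W) (real k + u) = (real A + u) / \<nu> ^ d"
    proof (intro allI impI)
      fix k assume k: "k < m * N"
      then obtain A d :: nat where "\<forall>u\<in>{0..1}. f ((real k + u) / \<nu> ^ e) = (real A + u) / \<nu> ^ d" using e[of k] m by auto
      then show "\<exists>A d :: nat. \<forall>u\<in>{0..1}. (f \<circ> W) (real k + u) = (real A + u) / \<nu> ^ d" using W_cell[OF k] by auto
    qed
    obtain A d :: nat where Ad: "\<And>u. u \<in> {0..1} \<Longrightarrow> f ((real (m * N) + u) / \<nu> ^ e) = (real A + u) / \<nu> ^ d"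
      using e[of "m * N"] m by auto
    \<comment> \<open>Since \<open>f 1 = 1\<close>, the last cell goes to the last cell of its
      depth.\<close>
    have "real A + 1 = \<nu> ^ d" using Ad[of 1] h(2) pos[of d] pos[of e] \<nu>e by (simp add: field_simps)
    then have A: "real A = \<nu> ^ d - 1" by simp
    have "(f \<circ> W) x = 1 - (1 - \<theta> (x - real (m * N))) / \<nu> ^ d" if x: "real (m * N) \<le> x" for x
    proof -
      have "\<theta> (x - real (m * N)) \<in> {0..1}"
        using x \<theta>_nonneg[of "x - real (m * N)"] \<theta>_less_1[of "x - real (m * N)"] by simp
      from Ad[OF this] have "(f \<circ> W) x = (real A + \<theta> (x - real (m * N))) / \<nu> ^ d"
        using W_tail[OF x] by simp
      also have "\<dots> = 1 - (1 - \<theta> (x - real (m * N))) / \<nu> ^ d"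
        unfolding A using n_real by (simp add: diff_divide_distrib add_divide_distrib)
      finally show ?thesis .
    qed
    then show "\<exists>e. \<forall>x\<ge>real (m * N). (f \<circ> W) x = 1 - (1 - \<theta> (x - real (m * N))) / \<nu> ^ e" by blast
  qed
  then obtain u where u: "u \<in> H" "\<And>x. 0 \<le> x \<Longrightarrow> f (W x) = \<theta> (u x)"
    using subdivision_in_H unfolding comp_apply by blast
  interpret v: incr_bij v by (rule incr_H[OF v(1)])
  have "lift f = u \<circ> fun_inv v"
  proof (rule lift_eqI[OF fh])
    fix x :: real
    have w: "0 \<le> fun_inv v x \<longleftrightarrow> 0 \<le> x" using H_fix[OF v(1), of 0] by (simp add: v.le_inv)
    show "x < 0 \<Longrightarrow> (u \<circ> fun_inv v) x = x"
      using H_fix[OF u(1), of x] H_fix[OF v(1), of x] v.inv_eq[of x x] by simp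
    assume x: "0 \<le> x"
    have "f (\<theta> x) = \<theta> (u (fun_inv v x))" using u(2)[of "fun_inv v x"] v(2)[of "fun_inv v x"] w x by simp
    then show "0 \<le> (u \<circ> fun_inv v) x \<and> f (\<theta> x) = \<theta> ((u \<circ> fun_inv v) x)"
      using H_nonneg[OF u(1)] w x by simp
  qed
  then show ?thesis using u(1) v(1) chain.inv_G by (simp add: generate_comp)
qed

end

section \<open>Homeomorphisms of an interval\<close>

definition extend :: "real set \<Rightarrow> (real \<Rightarrow> real) \<Rightarrow> real \<Rightarrow> real" where
  "extend I f x = (if x \<in> I then f x else x)"

lemma incr_extend:
  assumes I: "is_interval I" and f: "f \<in> Bij I" "strict_mono_on I f"
  shows "incr_bij (extend I f)"
proof
  have img: "f ` I = I" using f by (auto simp: Bij_def bij_betw_def)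
  have mem: "x \<in> I \<Longrightarrow> f x \<in> I" for x using img by auto
  show "strict_mono (extend I f)"
  proof (rule strict_monoI)
    fix x z :: real assume xz: "x < z"
    consider "x \<in> I" "z \<in> I" | "x \<in> I" "z \<notin> I" | "x \<notin> I" "z \<in> I" | "x \<notin> I" "z \<notin> I" by blast
    then show "extend I f x < extend I f z"
    proof cases
      case 1
      then show ?thesis using strict_mono_onD[OF f(2) _ _ xz] by (simp add: extend_def)
    next
      case 2
      have "f x < z"
        using mem_is_interval_1_I[OF I 2(1) mem[OF 2(1)], of z] 2 xz by (metis less_imp_le not_less)
      then show ?thesis using 2 by (simp add: extend_def)
    next
      case 3
      have "x < f z"
        using mem_is_interval_1_I[OF I mem[OF 3(2)] 3(2), of x] 3 xz by (metis less_imp_le not_less)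
      then show ?thesis using 3 by (simp add: extend_def)
    qed (simp add: extend_def xz)
  qed
  have "\<exists>x. extend I f x = z" for z
  proof (cases "z \<in> I")
    case True
    then obtain x where "x \<in> I" "f x = z" using img by (metis imageE)
    then show ?thesis by (intro exI[of _ x]) (simp add: extend_def)
  next
    case False
    then show ?thesis by (intro exI[of _ z]) (simp add: extend_def)
  qed
  then show "surj (extend I f)" by (metis surjI)
qed

lemma incr_continuous: "incr_bij f \<Longrightarrow> continuous_on A f"
proof -
  assume "incr_bij f"
  then interpret incr_bij f .
  have "continuous_on UNIV f" using surj by (intro continuous_onI_mono) auto
  then show ?thesis by (rule continuous_on_subset) simp
qed

lemma Bij_inv_mono:
  fixes I :: "real set"
  assumes f: "f \<in> Bij I" "strict_mono_on I f"
  shows "restrict (inv_into I f) I \<in> Bij I \<and> strict_mono_on I (restrict (inv_into I f) I)"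
proof
  have b: "bij_betw f I I" using f by (simp add: Bij_def)
  show "restrict (inv_into I f) I \<in> Bij I" by (rule restrict_inv_into_Bij[OF f(1)])
  show "strict_mono_on I (restrict (inv_into I f) I)"
  proof (rule strict_mono_onI)
    fix x z assume xz: "x \<in> I" "z \<in> I" "x < z"
    have m: "inv_into I f x \<in> I" "inv_into I f z \<in> I" "f (inv_into I f x) = x" "f (inv_into I f z) = z"
      using b xz by (auto simp: bij_betw_def inv_into_into f_inv_into_f)
    then have "inv_into I f x < inv_into I f z"
      using xz(3) strict_mono_onD[OF f(2) m(2,1)]
      by (cases "inv_into I f x" "inv_into I f z" rule: linorder_cases) auto
    then show "restrict (inv_into I f) I x < restrict (inv_into I f) I z" using xz by simp
  qed
qed

text \<open>Continuity comes from monotonicity: extended by the identity, the map is an increasing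
  surjection of the line. The inverse is of the same kind.\<close>

lemma homeo_plus_interval:
  assumes I: "is_interval I"
  shows "homeo_plus I = {f \<in> Bij I. strict_mono_on I f}"
proof
  show "homeo_plus I \<subseteq> {f \<in> Bij I. strict_mono_on I f}" by (auto simp: homeo_plus_def)
  have cont: "continuous_on I f" if "f \<in> Bij I" "strict_mono_on I f" for f
    using incr_continuous[OF incr_extend[OF I that], of I]
    by (rule continuous_on_eq) (simp add: extend_def)
  show "{f \<in> Bij I. strict_mono_on I f} \<subseteq> homeo_plus I"
  proof
    fix f assume "f \<in> {f \<in> Bij I. strict_mono_on I f}"
    then have f: "f \<in> Bij I" "strict_mono_on I f" by auto
    let ?g = "restrict (inv_into I f) I"
    have b: "bij_betw f I I" using f by (simp add: Bij_def)
    have "homeomorphism I I f ?g"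
    proof (rule homeomorphismI)
      show "continuous_on I f" by (rule cont[OF f])
      show "continuous_on I ?g" using cont Bij_inv_mono[OF f] by blast
    qed (use b in \<open>auto simp: bij_betw_def inv_into_into f_inv_into_f\<close>)
    then show "f \<in> homeo_plus I" using f by (auto simp: homeo_plus_def)
  qed
qed

lemma inv_BijGroup: "f \<in> Bij I \<Longrightarrow> inv\<^bsub>BijGroup I\<^esub> f = restrict (inv_into I f) I"
  using Bij_compose_restrict_eq[of f I] restrict_inv_into_Bij[of f I]
  by (intro group.inv_equality[OF group_BijGroup]) (auto simp: BijGroup_def)

lemma subgroup_homeo_plus:
  assumes I: "is_interval I" shows "subgroup (homeo_plus I) (BijGroup I)"
proof (rule group.subgroupI[OF group_BijGroup])
  show "homeo_plus I \<subseteq> carrier (BijGroup I)" by (auto simp: homeo_plus_interval[OF I] BijGroup_def)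
  have "(\<lambda>x\<in>I. x) \<in> homeo_plus I"
    by (simp add: homeo_plus_interval[OF I] id_Bij strict_mono_on_def)
  then show "homeo_plus I \<noteq> {}" by blast
  fix f assume "f \<in> homeo_plus I"
  then have f: "f \<in> Bij I" "strict_mono_on I f" by (auto simp: homeo_plus_interval[OF I])
  then show "inv\<^bsub>BijGroup I\<^esub> f \<in> homeo_plus I"
    using Bij_inv_mono[OF f] by (simp add: inv_BijGroup homeo_plus_interval[OF I])
  fix g assume "g \<in> homeo_plus I"
  then have g: "g \<in> Bij I" "strict_mono_on I g" by (auto simp: homeo_plus_interval[OF I])
  have "strict_mono_on I (compose I f g)"
  proof (rule strict_mono_onI)
    fix x z assume xz: "x \<in> I" "z \<in> I" "x < z"
    have "g x \<in> I" "g z \<in> I" using Bij_imp_funcset[OF g(1)] xz by auto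
    then show "compose I f g x < compose I f g z"
      using strict_mono_onD[OF f(2) _ _ strict_mono_onD[OF g(2) xz]] xz by (simp add: compose_eq)
  qed
  then show "f \<otimes>\<^bsub>BijGroup I\<^esub> g \<in> homeo_plus I"
    using f g by (simp add: BijGroup_def homeo_plus_interval[OF I] compose_Bij)
qed

lemma group_homeo_group: "is_interval I \<Longrightarrow> group (homeo_group I)"
  unfolding homeo_group_def
  by (rule subgroup.subgroup_is_group[OF subgroup_homeo_plus group_BijGroup])

lemma carrier_homeo_group [simp]: "carrier (homeo_group I) = homeo_plus I"
  by (simp add: homeo_group_def)

lemma mult_homeo_group:
  "f \<in> homeo_plus I \<Longrightarrow> g \<in> homeo_plus I \<Longrightarrow> f \<otimes>\<^bsub>homeo_group I\<^esub> g = compose I f g"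
  by (simp add: homeo_group_def BijGroup_def homeo_plus_def)

lemma compose_homeo_plus:
  "is_interval I \<Longrightarrow> f \<in> homeo_plus I \<Longrightarrow> g \<in> homeo_plus I \<Longrightarrow> compose I f g \<in> homeo_plus I"
  using monoid.m_closed[OF group.is_monoid[OF group_homeo_group], of I f g] by (simp add: mult_homeo_group)

section \<open>Thompson's group as a group of maps of the line\<close>

lemma unit_interval: "is_interval {0..1::real}"
  by (simp add: is_interval_cc)

context thompson
begin

lemma thompson_id: "(\<lambda>x\<in>{0..1}. x) \<in> thompson_carrier n"
proof -
  have "linear_off {} (\<lambda>x\<in>{0..1}. x)"
    unfolding linear_off_def
  proof (intro allI impI)
    fix s t :: real assume "0 \<le> s \<and> s < t \<and> t \<le> 1 \<and> {s<..<t} \<inter> {} = {}"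
    then show "\<exists>k c. \<forall>x\<in>{s..t}. (\<lambda>x\<in>{0..1}. x) x = \<nu> powi k * x + c"
      by (intro exI[of _ 0]) auto
  qed
  moreover have "(\<lambda>x\<in>{0..1}. x) \<in> homeo_plus {0..1}"
    by (simp add: homeo_plus_interval[OF unit_interval] id_Bij strict_mono_on_def)
  ultimately show ?thesis unfolding thompson_iff by blast
qed

lemma thompson_compose:
  assumes f: "f \<in> thompson_carrier n" and g: "g \<in> thompson_carrier n"
  shows "compose {0..1} f g \<in> thompson_carrier n"
proof -
  note fh = thompson_homeo[OF f] and gh = thompson_homeo[OF g]
  note g' = unit_homeo[OF gh]
  obtain Pf where Pf: "finite Pf" "Pf \<subseteq> Zn" "linear_off Pf f" using f unfolding thompson_iff by blast
  obtain Pg where Pg: "finite Pg" "Pg \<subseteq> Zn" "linear_off Pg g" using g unfolding thompson_iff by blast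
  define P where "P = Pg \<union> (g -` Pf \<inter> {0..1})"
  have "inj_on g {0..1}" using gh by (auto simp: homeo_plus_def Bij_def bij_betw_def)
  then have "finite P" unfolding P_def using Pf Pg finite_vimage_IntI by blast
  moreover have "P \<subseteq> Zn" using Pf(2) Pg(2) thompson_Zn[OF g] by (auto simp: P_def)
  moreover have "linear_off P (compose {0..1} f g)"
    unfolding linear_off_def
  proof (intro allI impI)
    fix s t :: real assume st: "0 \<le> s \<and> s < t \<and> t \<le> 1 \<and> {s<..<t} \<inter> P = {}"
    then obtain k c where g1: "\<forall>x\<in>{s..t}. g x = \<nu> powi k * x + c"
      using linear_offD[OF Pg(3), of s t] by (auto simp: P_def)
    have mem: "s \<in> {0..1}" "t \<in> {0..1}" using st by auto
    have "{g s<..<g t} \<inter> Pf = {}"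
    proof (rule ccontr)
      assume "{g s<..<g t} \<inter> Pf \<noteq> {}"
      then obtain p where p: "p \<in> Pf" "g s < p" "p < g t" by auto
      have "p \<in> {0..1}" using p g'(3)[OF mem(1)] g'(3)[OF mem(2)] by auto
      then obtain x where x: "x \<in> {0..1}" "g x = p" using g'(4) by (metis imageE)
      then have "s < x" "x < t" using p g'(5)[OF mem(1) x(1)] g'(5)[OF x(1) mem(2)] by auto
      then show False using st x p by (auto simp: P_def)
    qed
    then obtain k' c' where f1: "\<forall>x\<in>{g s..g t}. f x = \<nu> powi k' * x + c'"
      using linear_offD[OF Pf(3), of "g s" "g t"] g'(3)[OF mem(1)] g'(3)[OF mem(2)] g'(5)[OF mem] st by auto
    have "compose {0..1} f g x = \<nu> powi (k' + k) * x + (\<nu> powi k' * c + c')" if x: "x \<in> {s..t}" for x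
    proof -
      have xm: "x \<in> {0..1}" using x st by auto
      have "g s \<le> g x" "g x \<le> g t"
        using g'(5)[OF xm mem(1)] g'(5)[OF mem(2) xm] x by (auto simp: not_less[symmetric])
      then have "f (g x) = \<nu> powi k' * (\<nu> powi k * x + c) + c'" using f1 g1 x by auto
      then show ?thesis using xm n_real by (simp add: compose_eq power_int_add algebra_simps)
    qed
    then show "\<exists>k c. \<forall>x\<in>{s..t}. compose {0..1} f g x = \<nu> powi k * x + c" by blast
  qed
  ultimately show ?thesis unfolding thompson_iff using compose_homeo_plus[OF unit_interval fh gh] by blast
qed

lemma thompson_inverse:
  assumes f: "f \<in> thompson_carrier n"
  shows "restrict (inv_into {0..1} f) {0..1} \<in> thompson_carrier n"
proof -
  note fh = thompson_homeo[OF f]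
  note f' = unit_homeo[OF fh]
  let ?h = "restrict (inv_into {0..1} f) {0..1}"
  have fB: "f \<in> Bij {0..1}" "strict_mono_on {0..1} f" using fh by (auto simp: homeo_plus_def)
  have hh: "?h \<in> homeo_plus {0..1}" using Bij_inv_mono[OF fB] by (simp add: homeo_plus_interval[OF unit_interval])
  have fi: "f (?h y) = y" "?h y \<in> {0..1}" if "y \<in> {0..1}" for y
    using that f'(4) f_inv_into_f[of y f "{0..1}"] inv_into_into[of y f "{0..1}"] by simp_all
  obtain P where P: "finite P" "P \<subseteq> Zn" "linear_off P f" using f unfolding thompson_iff by blast
  have "finite (f ` (P \<inter> {0..1}))" using P by simp
  moreover have "f ` (P \<inter> {0..1}) \<subseteq> Zn" using P(2) thompson_Zn[OF f] by auto
  moreover have "linear_off (f ` (P \<inter> {0..1})) ?h"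
    unfolding linear_off_def
  proof (intro allI impI)
    fix s t :: real assume st: "0 \<le> s \<and> s < t \<and> t \<le> 1 \<and> {s<..<t} \<inter> f ` (P \<inter> {0..1}) = {}"
    define a b where "a = ?h s" and "b = ?h t"
    have mem: "s \<in> {0..1}" "t \<in> {0..1}" using st by auto
    have ab: "a \<in> {0..1}" "b \<in> {0..1}" "f a = s" "f b = t" using fi mem unfolding a_def b_def by blast+
    have "{a<..<b} \<inter> P = {}"
    proof (rule ccontr)
      assume "{a<..<b} \<inter> P \<noteq> {}"
      then obtain p where p: "p \<in> P" "a < p" "p < b" by auto
      then have pm: "p \<in> {0..1}" using ab by auto
      then have "s < f p" "f p < t" using p f'(5)[OF ab(1) pm] f'(5)[OF pm ab(2)] ab by auto
      then show False using st p pm by auto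
    qed
    moreover have "a < b" using f'(5)[OF ab(1,2)] ab st by simp
    ultimately obtain k c where f1: "\<forall>x\<in>{a..b}. f x = \<nu> powi k * x + c"
      using linear_offD[OF P(3), of a b] ab by auto
    have "?h y = \<nu> powi (- k) * y + (- (\<nu> powi (- k) * c))" if y: "y \<in> {s..t}" for y
    proof -
      have ym: "y \<in> {0..1}" using y st by auto
      have "\<not> f (?h y) < f a" "\<not> f b < f (?h y)" using fi[OF ym] ab y by auto
      then have "\<not> ?h y < a" "\<not> b < ?h y"
        using f'(5)[OF fi(2)[OF ym] ab(1)] f'(5)[OF ab(2) fi(2)[OF ym]] by blast+
      then have "?h y \<in> {a..b}" unfolding atLeastAtMost_iff not_less by blast
      then have "y = \<nu> powi k * ?h y + c" using f1 fi[OF ym] by metis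
      then have "\<nu> powi (- k) * (y - c) = \<nu> powi (- k) * (\<nu> powi k * ?h y)" by simp
      also have "\<dots> = ?h y" using n_real by (simp add: power_int_minus)
      finally show ?thesis by (simp add: algebra_simps)
    qed
    then show "\<exists>k c. \<forall>x\<in>{s..t}. ?h x = \<nu> powi k * x + c" by blast
  qed
  ultimately show ?thesis unfolding thompson_iff using hh by blast
qed

definition unit_gen :: "nat \<Rightarrow> real \<Rightarrow> real" where
  "unit_gen j = (\<lambda>z\<in>{0..1}. if z = 1 then 1 else \<theta> (gen j (\<theta>inv z)))"

lemma gen_nonneg: "0 \<le> x \<Longrightarrow> 0 \<le> gen j x"
  using gen_ge[of x j] by simp

lemma unit_gen_\<theta>: "0 \<le> x \<Longrightarrow> unit_gen j (\<theta> x) = \<theta> (gen j x)"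
  using \<theta>_less_1[of x] \<theta>_nonneg[of x] by (simp add: unit_gen_def)

lemma unit_cases:
  assumes "z \<in> {0..1}" obtains "z = 1" | x where "0 \<le> x" "z = \<theta> x"
proof (cases "z = 1")
  case False
  then have "0 \<le> z" "z < 1" using assms by auto
  then obtain x where "0 \<le> x" "\<theta> x = z" by (rule \<theta>_surj)
  then show ?thesis using that by blast
qed (use that in blast)

lemma unit_gen_homeo: "unit_gen j \<in> homeo_plus {0..1}"
proof -
  have one: "unit_gen j 1 = 1" by (simp add: unit_gen_def)
  have val: "unit_gen j z \<in> {0..1}" if "z \<in> {0..1}" for z
    using that
  proof (cases rule: unit_cases)
    case (2 x)
    then show ?thesis using \<theta>_nonneg[OF gen_nonneg[of x j]] \<theta>_less_1[OF gen_nonneg[of x j]] by (simp add: unit_gen_\<theta>)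
  qed (simp add: one)
  have mono: "strict_mono_on {0..1} (unit_gen j)"
  proof (rule strict_mono_onI)
    fix z w :: real assume zw: "z \<in> {0..1}" "w \<in> {0..1}" "z < w"
    then have "z \<noteq> 1" by auto
    then obtain x where x: "0 \<le> x" "z = \<theta> x" using unit_cases[OF zw(1)] by metis
    show "unit_gen j z < unit_gen j w"
      using zw(2)
    proof (cases rule: unit_cases)
      case 1
      then show ?thesis using x \<theta>_less_1[OF gen_nonneg[of x j]] by (simp add: one unit_gen_\<theta>)
    next
      case (2 v)
      then show ?thesis using x zw(3) by (simp add: unit_gen_\<theta> \<theta>_less_iff gen_nonneg)
    qed
  qed
  have "\<exists>z\<in>{0..1}. unit_gen j z = w" if "w \<in> {0..1}" for w
    using that
  proof (cases rule: unit_cases)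
    case 1
    then show ?thesis using one by (intro bexI[of _ 1]) auto
  next
    case (2 x)
    have i: "0 \<le> fun_inv (gen j) x" using 2 gen_simps(1)[of 0 j] by (simp add: gen.le_inv)
    then have "unit_gen j (\<theta> (fun_inv (gen j) x)) = w" using 2 by (simp add: unit_gen_\<theta>)
    then show ?thesis using \<theta>_nonneg[OF i] \<theta>_less_1[OF i] by (intro bexI[of _ "\<theta> (fun_inv (gen j) x)"]) auto
  qed
  then have "unit_gen j ` {0..1} = {0..1}" using val by blast
  then have "bij_betw (unit_gen j) {0..1} {0..1}"
    using strict_mono_on_imp_inj_on[OF mono] by (simp add: bij_betw_def)
  then show ?thesis using mono by (simp add: homeo_plus_interval[OF unit_interval] Bij_def unit_gen_def)
qed

lemma \<theta>_Zn: "x \<in> Zn \<Longrightarrow> 0 \<le> x \<Longrightarrow> \<theta> x \<in> Zn"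
proof -
  assume x: "x \<in> Zn" "0 \<le> x"
  obtain m where m: "real m * real N \<le> x" "x < (real m + 1) * real N" using piece_exists[OF x(2)] .
  have "\<theta> x = 1 - (1 - (x - real m * real N) / \<nu> ^ 1) / \<nu> ^ m" using \<theta>_piece m by simp
  also have "\<dots> \<in> Zn"
    using Zn_of_nat[of 1] by (intro Zn_diff Zn_div_pow Zn_mult Zn_of_nat x) simp_all
  finally show ?thesis .
qed

text \<open>Between the breakpoints for \<open>j\<close> and \<open>j + 1\<close> there is a third
  one. The image of this unit interval under \<open>gen j\<close> reaches the block boundary
  \<open>(real m + 1) * real N\<close>, where \<open>\<theta>\<close> changes its slope, and
  \<open>x1\<close> is the preimage of that boundary. The slopes in turn are \<open>1\<close>,
  \<open>\<nu>\<close>, \<open>1\<close> and \<open>1 / \<nu>\<close>.\<close>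

lemma unit_gen_thompson: "unit_gen j \<in> thompson_carrier n"
proof -
  obtain m where m: "real m * real N \<le> real j" "real j < (real m + 1) * real N" using piece_exists[of "real j"] by auto
  have jm: "real j + 1 \<le> (real m + 1) * real N"
  proof -
    have "real j < real (Suc m * N)" using m(2) by (simp add: algebra_simps)
    then have "j + 1 \<le> Suc m * N" unfolding of_nat_less_iff by simp
    then have "real (j + 1) \<le> real (Suc m * N)" unfolding of_nat_le_iff .
    then show ?thesis by (simp add: algebra_simps)
  qed
  define x1 where "x1 = real j + ((real m + 1) * real N - real j) / \<nu>"
  have v: "0 \<le> ((real m + 1) * real N - real j) / \<nu>" "((real m + 1) * real N - real j) / \<nu> \<le> 1"
  proof -
    show "0 \<le> ((real m + 1) * real N - real j) / \<nu>" using m n_real by simp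
    have "(real m + 1) * real N - real j \<le> \<nu>" using m(1) n_real unfolding distrib_right by linarith
    then show "((real m + 1) * real N - real j) / \<nu> \<le> 1" using n_real by simp
  qed
  then have x1: "real j \<le> x1" "x1 \<le> real j + 1" by (auto simp: x1_def)
  have \<nu>x1: "\<nu> * (x1 - real j) = (real m + 1) * real N - real j" using n_real by (simp add: x1_def)
  have \<theta>j: "\<theta> x - \<theta> z = (x - z) / (\<nu> * \<nu> ^ k)"
    if "real k * real N \<le> x" "x \<le> (real k + 1) * real N" "real k * real N \<le> z" "z \<le> (real k + 1) * real N" for x z k
    using \<theta>_piece[of k x] \<theta>_piece[of k z] that n_real by (simp add: field_simps)
  have jx: "x \<le> (real m + 1) * real N" "real m * real N \<le> x" if "real j \<le> x" "x \<le> real j + 1" for x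
    using that jm m by linarith+
  have piece2: "\<theta> (gen j x) = \<nu> * \<theta> x + (\<theta> j - \<nu> * \<theta> j)" if x: "real j \<le> x" "x \<le> x1" for x
  proof -
    have g: "gen j x = j + \<nu> * (x - j)" using x x1 by (simp add: gen_simps)
    have "\<nu> * (x - j) \<le> \<nu> * (x1 - j)" "0 \<le> \<nu> * (x - j)" using x n_real by (auto intro: mult_left_mono)
    then have b: "real m * real N \<le> gen j x" "gen j x \<le> (real m + 1) * real N"
      using m \<nu>x1 g by linarith+
    have "\<theta> (gen j x) - \<theta> j = \<nu> * (x - j) / (\<nu> * \<nu> ^ m)"
      using \<theta>j[of m "gen j x" "real j"] b m g by simp
    moreover have "\<theta> x - \<theta> j = (x - j) / (\<nu> * \<nu> ^ m)"
      using \<theta>j[of m x "real j"] jx[of x] x x1 m by simp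
    ultimately have "\<theta> (gen j x) - \<theta> j = \<nu> * (\<theta> x - \<theta> j)" by simp
    then show ?thesis by (simp add: algebra_simps)
  qed
  have piece3: "\<theta> (gen j x) = \<theta> x + (\<theta> (gen j x1) - \<theta> x1)" if x: "x1 \<le> x" "x \<le> real j + 1" for x
  proof -
    have g: "gen j z = (real m + 1) * real N + \<nu> * (z - x1)" if "x1 \<le> z" "z \<le> real j + 1" for z
      using that x1 \<nu>x1 by (simp add: gen_simps algebra_simps)
    have b: "real (Suc m) * real N \<le> gen j z" "gen j z \<le> (real (Suc m) + 1) * real N"
      if z: "x1 \<le> z" "z \<le> real j + 1" for z
    proof -
      have "0 \<le> \<nu> * (z - x1)" using z n_real by simp
      then show "real (Suc m) * real N \<le> gen j z" using g[OF z] by (simp add: algebra_simps)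
      have "gen j z \<le> gen j (real j + 1)" using z by simp
      also have "\<dots> = real j + 1 + real N" by (simp add: gen_simps(3))
      finally show "gen j z \<le> (real (Suc m) + 1) * real N" using jm by (simp add: algebra_simps)
    qed
    have "\<theta> (gen j x) - \<theta> (gen j x1) = (gen j x - gen j x1) / (\<nu> * \<nu> ^ Suc m)"
      using \<theta>j[of "Suc m"] b[OF x] b[of x1] x1 by simp
    also have "\<dots> = (x - x1) / (\<nu> * \<nu> ^ m)" using g[OF x] g[of x1] x1 n_real by simp
    also have "\<dots> = \<theta> x - \<theta> x1" using \<theta>j[of m x x1] jx[of x] jx[of x1] x x1 by simp
    finally show ?thesis by simp
  qed
  define P where "P = {\<theta> j, \<theta> x1, \<theta> (real j + 1)}"
  have "x1 = j + (of_nat (Suc m) * of_nat N - of_nat j) / \<nu> ^ 1" by (simp add: x1_def algebra_simps)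
  also have "\<dots> \<in> Zn" by (intro Zn_add Zn_of_nat Zn_div_pow Zn_diff Zn_mult)
  finally have "x1 \<in> Zn" .
  moreover have "real j + 1 \<in> Zn" using Zn_of_nat[of "j + 1"] by (simp add: add.commute)
  ultimately have "P \<subseteq> Zn" using x1 Zn_of_nat[of j] by (auto simp: P_def intro!: \<theta>_Zn)
  moreover have "linear_off P (unit_gen j)"
    unfolding linear_off_def
  proof (intro allI impI)
    fix s t :: real assume st: "0 \<le> s \<and> s < t \<and> t \<le> 1 \<and> {s<..<t} \<inter> P = {}"
    have lin: "\<exists>k c. \<forall>x\<in>{s..t}. unit_gen j x = \<nu> powi k * x + c"
      if "\<And>x. 0 \<le> x \<Longrightarrow> s \<le> \<theta> x \<Longrightarrow> \<theta> x \<le> t \<Longrightarrow> \<theta> (gen j x) = \<nu> powi k * \<theta> x + c" "t = 1 \<Longrightarrow> 1 = \<nu> powi k + c" for k c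
    proof (intro exI ballI)
      fix z assume z: "z \<in> {s..t}"
      then have "z \<in> {0..1}" using st by auto
      then show "unit_gen j z = \<nu> powi k * z + c"
      proof (cases rule: unit_cases)
        case 1
        then show ?thesis using that(2) z st by (simp add: unit_gen_def)
      next
        case (2 x)
        then show ?thesis using that(1)[of x] z by (simp add: unit_gen_\<theta>)
      qed
    qed
    have t1: "\<theta> j < 1" "\<theta> x1 < 1" "\<theta> (real j + 1) < 1" using \<theta>_less_1 x1 by auto
    have le: "\<theta> a \<le> \<theta> b \<Longrightarrow> 0 \<le> a \<Longrightarrow> 0 \<le> b \<Longrightarrow> a \<le> b" for a b by (simp add: \<theta>_le_iff)
    have "\<theta> j \<le> s \<or> t \<le> \<theta> j" "\<theta> x1 \<le> s \<or> t \<le> \<theta> x1" "\<theta> (real j + 1) \<le> s \<or> t \<le> \<theta> (real j + 1)"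
      using st by (auto simp: P_def not_le)
    then consider "t \<le> \<theta> j" | "\<theta> j \<le> s" "t \<le> \<theta> x1" | "\<theta> x1 \<le> s" "t \<le> \<theta> (real j + 1)" | "\<theta> (real j + 1) \<le> s"
      by blast
    then show "\<exists>k c. \<forall>x\<in>{s..t}. unit_gen j x = \<nu> powi k * x + c"
    proof cases
      case 1
      show ?thesis
      proof (rule lin[of 0 0])
        fix x assume x: "0 \<le> x" "s \<le> \<theta> x" "\<theta> x \<le> t"
        then have "x \<le> j" using 1 le[of x j] by simp
        then show "\<theta> (gen j x) = \<nu> powi 0 * \<theta> x + 0" by (simp add: gen_simps)
      qed (use 1 t1 in simp)
    next
      case 2
      show ?thesis
      proof (rule lin[of 1 "\<theta> j - \<nu> * \<theta> j"])
        fix x assume x: "0 \<le> x" "s \<le> \<theta> x" "\<theta> x \<le> t"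
        then have xx: "j \<le> x" "x \<le> x1" using 2 le[of j x] le[of x x1] x1 by auto
        then show "\<theta> (gen j x) = \<nu> powi 1 * \<theta> x + (\<theta> j - \<nu> * \<theta> j)" using piece2[OF xx] by simp
      qed (use 2 t1 in simp)
    next
      case 3
      show ?thesis
      proof (rule lin[of 0 "\<theta> (gen j x1) - \<theta> x1"])
        fix x assume x: "0 \<le> x" "s \<le> \<theta> x" "\<theta> x \<le> t"
        then have xx: "x1 \<le> x" "x \<le> real j + 1" using 3 le[of x1 x] le[of x "real j + 1"] x1 by auto
        then show "\<theta> (gen j x) = \<nu> powi 0 * \<theta> x + (\<theta> (gen j x1) - \<theta> x1)" using piece3[OF xx] by simp
      qed (use 3 t1 in simp)
    next
      case 4
      show ?thesis
      proof (rule lin[of "-1" "1 - 1 / \<nu>"])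
        fix x assume x: "0 \<le> x" "s \<le> \<theta> x" "\<theta> x \<le> t"
        then have "real j + 1 \<le> x" using 4 le[of "real j + 1" x] by simp
        then have "\<theta> (gen j x) = 1 - (1 - \<theta> x) / \<nu>" using x(1) by (simp add: gen_simps \<theta>_shift)
        then show "\<theta> (gen j x) = \<nu> powi (- 1) * \<theta> x + (1 - 1 / \<nu>)"
          by (simp add: power_int_minus diff_divide_distrib inverse_eq_divide)
      qed (simp add: power_int_minus inverse_eq_divide)
    qed
  qed
  moreover have "finite P" by (simp add: P_def)
  ultimately show ?thesis unfolding thompson_iff using unit_gen_homeo by blast
qed

lemma lift_unit_gen: "lift (unit_gen j) = gen j"
  by (rule lift_eqI[OF unit_gen_homeo]) (auto simp: gen_simps(1) unit_gen_\<theta> gen_nonneg)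

lemma H_lift: "u \<in> H \<Longrightarrow> u \<in> lift ` thompson_carrier n"
proof (induction rule: generate.induct)
  case one
  have "lift (\<lambda>x\<in>{0..1}. x) = id"
    using \<theta>_nonneg \<theta>_less_1 by (intro lift_eqI thompson_homeo thompson_id) (auto simp: less_imp_le)
  then show ?case using thompson_id by (metis imageI line_group_simps(2))
next
  case (incl h)
  then obtain j where "h = gen j" by auto
  then show ?case using lift_unit_gen unit_gen_thompson by (metis imageI)
next
  case (inv h)
  then obtain j where j: "h = gen j" by auto
  let ?f = "restrict (inv_into {0..1} (unit_gen j)) {0..1}"
  note fh = thompson_homeo[OF thompson_inverse[OF unit_gen_thompson[of j]]]
  have "lift ?f = fun_inv (gen j)"
  proof (rule lift_eqI[OF fh])
    fix x :: real
    show "x < 0 \<Longrightarrow> fun_inv (gen j) x = x" using gen_simps(1)[of x j] by (simp add: gen.inv_eq)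
    assume x: "0 \<le> x"
    have i: "0 \<le> fun_inv (gen j) x" using x gen_simps(1)[of 0 j] by (simp add: gen.le_inv)
    have inj: "inj_on (unit_gen j) {0..1}" using unit_gen_homeo by (auto simp: homeo_plus_def Bij_def bij_betw_def)
    have "\<theta> x = unit_gen j (\<theta> (fun_inv (gen j) x))" using i by (simp add: unit_gen_\<theta>)
    moreover have "\<theta> (fun_inv (gen j) x) \<in> {0..1}" "\<theta> x \<in> {0..1}"
      using \<theta>_nonneg[OF i] \<theta>_less_1[OF i] \<theta>_nonneg[OF x] \<theta>_less_1[OF x] by auto
    ultimately have "?f (\<theta> x) = \<theta> (fun_inv (gen j) x)" using inj by (metis inv_into_f_f restrict_apply')
    then show "0 \<le> fun_inv (gen j) x \<and> ?f (\<theta> x) = \<theta> (fun_inv (gen j) x)" using i by simp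
  qed
  moreover have "inv\<^bsub>line_group\<^esub> h = fun_inv (gen j)" unfolding j by (rule gen.m_inv)
  ultimately show ?case using thompson_inverse[OF unit_gen_thompson[of j]] by (metis imageI)
next
  case (eng h1 h2)
  then obtain f g where fg: "f \<in> thompson_carrier n" "g \<in> thompson_carrier n" "h1 = lift f" "h2 = lift g" by auto
  then have "lift (compose {0..1} f g) = h1 \<circ> h2"
    by (simp add: lift_compose thompson_homeo thompson_compose)
  then show ?case using thompson_compose[OF fg(1,2)] by (metis imageI line_group_simps(1))
qed

theorem lift_iso: "lift \<in> iso (thompson_group n) (line_group\<lparr>carrier := H\<rparr>)"
proof -
  have "lift ` thompson_carrier n = H" using lift_in_H H_lift by blast
  moreover have "inj_on lift (thompson_carrier n)" by (rule inj_onI) (rule lift_inject; simp add: thompson_homeo)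
  moreover have "lift (f \<otimes>\<^bsub>thompson_group n\<^esub> g) = lift f \<circ> lift g"
    if "f \<in> thompson_carrier n" "g \<in> thompson_carrier n" for f g
    using that by (simp add: thompson_group_def mult_homeo_group thompson_homeo lift_compose thompson_compose)
  ultimately show ?thesis
    by (auto simp: iso_def hom_def bij_betw_def thompson_group_def)
qed

end

section \<open>Bounded supports\<close>

abbreviation J :: "real set" where "J \<equiv> {- (pi / 2)<..<pi / 2}"

text \<open>Conjugation by \<open>arctan\<close>: a positive bump may have an infinite support,
  while the locale \<open>bump\<close> works with two real end points.\<close>

definition squeeze :: "(real \<Rightarrow> real) \<Rightarrow> real \<Rightarrow> real" where
  "squeeze f = extend J (\<lambda>x\<in>J. arctan (f (tan x)))"

lemma arctan_J: "arctan x \<in> J"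
  using arctan_lbound[of x] arctan_ubound[of x] by simp

lemma squeeze_arctan [simp]: "squeeze f (arctan x) = arctan (f x)"
  using arctan_J[of x] by (simp add: squeeze_def extend_def tan_arctan)

lemma squeeze_outside: "x \<notin> J \<Longrightarrow> squeeze f x = x"
  by (simp only: squeeze_def extend_def if_False)

lemma arctan_cases: obtains z where "x = arctan z" | "x \<notin> J"
  using arctan_tan[of x] by (cases "x \<in> J") (auto, metis)

lemma incr_squeeze:
  assumes "incr_bij f" shows "incr_bij (squeeze f)"
proof -
  interpret incr_bij f by fact
  let ?g = "\<lambda>x\<in>J. arctan (f (tan x))"
  have sm: "strict_mono_on J ?g"
    by (rule strict_mono_onI) (simp add: arctan_less_iff tan_monotone)
  have "\<exists>x\<in>J. ?g x = w" if "w \<in> J" for w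
    using that arctan_J[of "fun_inv f (tan w)"] arctan_tan[of w]
    by (intro bexI[of _ "arctan (fun_inv f (tan w))"]) (simp_all add: tan_arctan)
  then have "?g ` J = J" using arctan_J by fastforce
  then have "?g \<in> Bij J" using strict_mono_on_imp_inj_on[OF sm] by (simp add: Bij_def bij_betw_def)
  then show ?thesis unfolding squeeze_def by (intro incr_extend sm) (simp add: is_interval_oo)
qed

lemma squeeze_comp: "squeeze (f \<circ> g) = squeeze f \<circ> squeeze g"
proof
  fix x show "squeeze (f \<circ> g) x = (squeeze f \<circ> squeeze g) x"
    by (rule arctan_cases[of x]) (simp_all add: squeeze_outside)
qed

definition to_line :: "real set \<Rightarrow> (real \<Rightarrow> real) \<Rightarrow> real \<Rightarrow> real" where
  "to_line I f = squeeze (extend I f)"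

lemma to_line_arctan: "to_line I f (arctan x) = (if x \<in> I then arctan (f x) else arctan x)"
  by (simp add: to_line_def extend_def)

lemma to_line_outside: "x \<notin> J \<Longrightarrow> to_line I f x = x"
  by (simp add: to_line_def squeeze_outside)

lemma incr_to_line: "is_interval I \<Longrightarrow> f \<in> homeo_plus I \<Longrightarrow> incr_bij (to_line I f)"
  unfolding to_line_def by (intro incr_squeeze incr_extend) (auto simp: homeo_plus_def)

lemma to_line_hom:
  assumes I: "is_interval I" shows "group_hom (homeo_group I) line_group (to_line I)"
proof (intro group_hom.intro group_hom_axioms.intro group_homeo_group I group_line homI)
  fix f g assume "f \<in> carrier (homeo_group I)" "g \<in> carrier (homeo_group I)"
  then have fg: "f \<in> homeo_plus I" "g \<in> homeo_plus I" by auto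
  show "to_line I f \<in> carrier line_group" using incr_to_line[OF I fg(1)] by (simp add: incr_bij_line)
  have "g x \<in> I" if "x \<in> I" for x using fg(2) that by (auto simp: homeo_plus_def Bij_def bij_betw_def)
  then have "extend I (compose I f g) = extend I f \<circ> extend I g"
    by (auto simp: fun_eq_iff extend_def compose_def)
  then show "to_line I (f \<otimes>\<^bsub>homeo_group I\<^esub> g) = to_line I f \<otimes>\<^bsub>line_group\<^esub> to_line I g"
    using fg by (simp add: mult_homeo_group to_line_def squeeze_comp)
qed

lemma to_line_inj: "inj_on (to_line I) (homeo_plus I)"
proof (rule inj_onI)
  fix f g assume fg: "f \<in> homeo_plus I" "g \<in> homeo_plus I" "to_line I f = to_line I g"
  have "f x = g x" if "x \<in> I" for x
    using fun_cong[OF fg(3), of "arctan x"] that by (simp add: to_line_arctan arctan_eq_iff)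
  then show "f = g" using fg by (intro extensionalityI[of f I g]) (auto simp: homeo_plus_def Bij_def)
qed

lemma bump_group_iso:
  assumes I: "is_interval I" and B: "B \<subseteq> homeo_plus I"
  shows "bump_group I B \<cong> line_group\<lparr>carrier := generate line_group (to_line I ` B)\<rparr>"
proof -
  interpret h: group_hom "homeo_group I" line_group "to_line I" by (rule to_line_hom[OF I])
  have B': "B \<subseteq> carrier (homeo_group I)" using B by simp
  have c: "carrier (bump_group I B) = generate (homeo_group I) B"
    using B by (simp add: bump_group_def carrier_subgroup_generated Int_absorb1)
  have sub: "generate (homeo_group I) B \<subseteq> homeo_plus I"
    using h.G.generate_incl[OF B'] by simp
  have img: "to_line I ` generate (homeo_group I) B = generate line_group (to_line I ` B)"
    by (rule h.generate_img[OF B', symmetric])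
  have "to_line I \<in> iso (bump_group I B) (line_group\<lparr>carrier := generate line_group (to_line I ` B)\<rparr>)"
  proof -
    have hm: "to_line I (f \<otimes>\<^bsub>bump_group I B\<^esub> g) = to_line I f \<circ> to_line I g"
      if "f \<in> generate (homeo_group I) B" "g \<in> generate (homeo_group I) B" for f g
      using h.hom_mult[of f g] subsetD[OF sub that(1)] subsetD[OF sub that(2)] by (simp add: bump_group_def)
    have "inj_on (to_line I) (generate (homeo_group I) B)" using to_line_inj sub by (rule inj_on_subset)
    then have "bij_betw (to_line I) (generate (homeo_group I) B) (generate line_group (to_line I ` B))"
      using img by (simp add: bij_betw_def)
    moreover have "to_line I \<in> generate (homeo_group I) B \<rightarrow> generate line_group (to_line I ` B)" using img by auto
    ultimately show ?thesis using hm by (simp add: iso_def hom_def c)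
  qed
  then show ?thesis by (rule is_isoI)
qed

definition moved :: "(real \<Rightarrow> real) \<Rightarrow> real set" where "moved f = {x. f x \<noteq> x}"

lemma moved_to_line: "moved (to_line I f) = arctan ` supp I f"
proof
  show "moved (to_line I f) \<subseteq> arctan ` supp I f"
  proof
    fix x assume x: "x \<in> moved (to_line I f)"
    then have "x \<in> J" using to_line_outside by (auto simp: moved_def)
    then obtain z where "x = arctan z" by (metis arctan_cases)
    then show "x \<in> arctan ` supp I f"
      using x by (auto simp: moved_def supp_def to_line_arctan split: if_splits)
  qed
qed (auto simp: moved_def supp_def to_line_arctan arctan_eq_iff)

section \<open>Real end points of supports and feet\<close>

lemma open_interval_eq:
  fixes S :: "real set"
  assumes S: "S \<noteq> {}" "bdd_above S" "bdd_below S" "is_interval S"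
    and no_min: "\<And>x. x \<in> S \<Longrightarrow> \<exists>z\<in>S. z < x" and no_max: "\<And>x. x \<in> S \<Longrightarrow> \<exists>z\<in>S. x < z"
  shows "S = {Inf S<..<Sup S}"
proof
  show "S \<subseteq> {Inf S<..<Sup S}"
  proof
    fix x assume "x \<in> S"
    then obtain v w where "v \<in> S" "v < x" "w \<in> S" "x < w" using no_min no_max by blast
    then show "x \<in> {Inf S<..<Sup S}"
      using cInf_lower[of v S] cSup_upper[of w S] S by auto
  qed
  show "{Inf S<..<Sup S} \<subseteq> S"
  proof
    fix x assume "x \<in> {Inf S<..<Sup S}"
    then obtain v w where "v \<in> S" "v < x" "w \<in> S" "x < w"
      using cInf_lessD[OF S(1), of x] less_cSupD[OF S(1), of x] by auto
    then show "x \<in> S" using mem_is_interval_1_I[OF S(4), of v w x] by simp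
  qed
qed

definition left_end :: "(real \<Rightarrow> real) \<Rightarrow> real" where "left_end f = Inf (moved f)"
definition right_end :: "(real \<Rightarrow> real) \<Rightarrow> real" where "right_end f = Sup (moved f)"

lemma bump_to_line:
  assumes I: "is_interval I" and b: "positive_bump I b"
  shows "arctan ` supp I b = {left_end (to_line I b)<..<right_end (to_line I b)}"
    and "bump (to_line I b) (left_end (to_line I b)) (right_end (to_line I b))"
proof -
  let ?b = "to_line I b" and ?S = "arctan ` supp I b"
  have b': "b \<in> homeo_plus I" "supp I b \<noteq> {}" "open (supp I b)" "is_interval (supp I b)"
    "\<And>x. x \<in> supp I b \<Longrightarrow> x < b x"
    using b by (auto simp: positive_bump_def)
  have near: "\<exists>z\<in>supp I b. z < x" "\<exists>z\<in>supp I b. x < z" if x: "x \<in> supp I b" for x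
  proof -
    obtain e where e: "0 < e" "ball x e \<subseteq> supp I b" using openE[OF b'(3) x] .
    then have "x - e / 2 \<in> supp I b" "x + e / 2 \<in> supp I b" by (auto simp: dist_real_def subset_iff)
    then show "\<exists>z\<in>supp I b. z < x" "\<exists>z\<in>supp I b. x < z"
      using e by (intro bexI[of _ "x - e / 2"] bexI[of _ "x + e / 2"]; simp)+
  qed
  have "?S = {Inf ?S<..<Sup ?S}"
  proof (rule open_interval_eq)
    have SJ: "?S \<subseteq> J" using arctan_J by auto
    show "bdd_above ?S" "bdd_below ?S"
      using SJ bdd_above_mono[of J ?S] bdd_below_mono[of J ?S] by auto
    show "is_interval ?S"
      unfolding is_interval_1
    proof (intro ballI allI impI)
      fix v w x assume vw: "v \<in> ?S" "w \<in> ?S" "v \<le> x \<and> x \<le> w"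
      obtain v' w' where v': "v' \<in> supp I b" "v = arctan v'" "w' \<in> supp I b" "w = arctan w'" using vw by auto
      have "x \<in> J" using vw SJ by force
      then obtain z where z: "x = arctan z" by (metis arctan_cases)
      then have "z \<in> supp I b"
        using mem_is_interval_1_I[OF b'(4) v'(1,3), of z] vw v' by (simp add: arctan_le_iff)
      then show "x \<in> ?S" using z by simp
    qed
    show "?S \<noteq> {}" using b'(2) by simp
    fix x assume "x \<in> ?S"
    then obtain z where z: "z \<in> supp I b" "x = arctan z" by auto
    show "\<exists>w\<in>?S. w < x" "\<exists>w\<in>?S. x < w" using near[OF z(1)] z(2) by (auto simp: arctan_less_iff)
  qed
  then show S: "?S = {left_end ?b<..<right_end ?b}" by (simp add: left_end_def right_end_def moved_to_line)
  then have m: "moved ?b = {left_end ?b<..<right_end ?b}" by (simp add: moved_to_line)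
  have "{left_end ?b<..<right_end ?b} \<noteq> {}" using S b'(2) by auto
  then have lt: "left_end ?b < right_end ?b" by simp
  interpret b: incr_bij ?b by (rule incr_to_line[OF I b'(1)])
  show "bump ?b (left_end ?b) (right_end ?b)"
  proof unfold_locales
    fix x
    have "x \<notin> moved ?b \<Longrightarrow> ?b x = x" by (simp add: moved_def)
    then show "x \<le> left_end ?b \<Longrightarrow> ?b x = x" "right_end ?b \<le> x \<Longrightarrow> ?b x = x" using m by auto
    assume "left_end ?b < x" "x < right_end ?b"
    then have "x \<in> ?S" using S by simp
    then obtain z where "z \<in> supp I b" "x = arctan z" by auto
    then show "x < ?b x" using b'(5)[of z] by (simp add: to_line_arctan arctan_less_iff supp_def)
  qed (rule lt)
qed

text \<open>Interior points of the feet are enough for the comparisons that follow, because an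
  overlap or a wrong order of two intervals is already witnessed by such points.\<close>

lemma bump_marker:
  assumes I: "is_interval I" and b: "positive_bump I b" and m: "m \<in> supp I b"
  defines "f \<equiv> to_line I b"
  shows "left_end f < arctan m" "arctan m < right_end f" "f (arctan m) < right_end f"
    "x \<in> {left_end f<..<arctan m} \<Longrightarrow> tan x \<in> left_foot I b m"
    "x \<in> {f (arctan m)<..<right_end f} \<Longrightarrow> tan x \<in> right_foot I b m"
proof -
  note S = bump_to_line(1)[OF I b, folded f_def]
  interpret bump f "left_end f" "right_end f" unfolding f_def by (rule bump_to_line(2)[OF I b])
  have mI: "m \<in> I" using m by (simp add: supp_def)
  then have fm: "f (arctan m) = arctan (b m)" by (simp add: f_def to_line_arctan)
  have "arctan m \<in> {left_end f<..<right_end f}" using S m by blast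
  then show lr: "left_end f < arctan m" "arctan m < right_end f" by auto
  then show "f (arctan m) < right_end f" by (intro less_c)
  have in_supp: "tan x \<in> supp I b \<and> arctan (tan x) = x" if x: "x \<in> {left_end f<..<right_end f}" for x
  proof -
    have "x \<in> arctan ` supp I b" unfolding S by (rule x)
    then obtain z where "z \<in> supp I b" "x = arctan z" by (rule imageE)
    then show ?thesis by (simp add: tan_arctan)
  qed
  show "tan x \<in> left_foot I b m" if "x \<in> {left_end f<..<arctan m}"
  proof -
    have x: "tan x \<in> supp I b" "arctan (tan x) = x" using in_supp that lr by auto
    then have "arctan (tan x) < arctan m" using that by simp
    then have "tan x < m" unfolding arctan_less_iff .
    then show ?thesis using x by (simp add: left_foot_def)
  qed
  show "tan x \<in> right_foot I b m" if "x \<in> {f (arctan m)<..<right_end f}"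
  proof -
    have "left_end f < f (arctan m)" using lr a_less by blast
    then have x: "tan x \<in> supp I b" "arctan (tan x) = x" using in_supp[of x] that by auto
    then have "arctan (b m) < arctan (tan x)" using that fm by simp
    then have "b m < tan x" unfolding arctan_less_iff .
    then show ?thesis using x by (simp add: right_foot_def)
  qed
qed

lemma before_of_disjoint:
  assumes "l < h" "l' < h'" "A \<inter> A' = {}" "\<And>x. x \<in> {l<..<h} \<Longrightarrow> tan x \<in> A" "\<And>x. x \<in> {l'<..<h'} \<Longrightarrow> tan x \<in> A'"
  shows "before (l, h) (l', h') \<or> before (l', h') (l, h)"
proof (rule ccontr)
  assume "\<not> ?thesis"
  then have "max l l' < min h h'" using assms(1,2) by (auto simp: before_def)
  then obtain x where "max l l' < x" "x < min h h'" using dense by blast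
  then have "tan x \<in> A \<inter> A'" using assms(4)[of x] assms(5)[of x] by simp
  then show False using assms(3) by simp
qed

text \<open>Otherwise a point \<open>x\<close> of the first interval would lie to the right of a
  point \<open>w\<close> of the second. Both are in \<open>J\<close>, where \<open>tan\<close> is
  increasing, which contradicts \<open>left_of\<close>.\<close>

lemma le_of_left_of:
  assumes "l < h" "l' < h'" "left_of A A'" "\<And>x. x \<in> {l<..<h} \<Longrightarrow> tan x \<in> A" "\<And>x. x \<in> {l'<..<h'} \<Longrightarrow> tan x \<in> A'"
    and J: "h \<le> pi / 2" "- (pi / 2) \<le> l'"
  shows "h \<le> l'"
proof (rule ccontr)
  assume "\<not> h \<le> l'"
  then obtain x where x: "max l l' < x" "x < h" using dense[of "max l l'" h] assms(1) by auto
  then obtain w where w: "l' < w" "w < min x h'" using dense[of l' "min x h'"] assms(2) by auto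
  have "tan x < tan w" using assms(3-5) x w by (auto simp: left_of_def)
  moreover have "tan w < tan x" using x w J by (intro tan_monotone) auto
  ultimately show False by simp
qed

lemma ends_in_J:
  assumes I: "is_interval I" and b: "positive_bump I b"
  shows "- (pi / 2) \<le> left_end (to_line I b)" "right_end (to_line I b) \<le> pi / 2"
proof -
  have "moved (to_line I b) \<subseteq> J" "moved (to_line I b) \<noteq> {}"
    using arctan_J b by (auto simp: moved_to_line positive_bump_def)
  moreover from this have "- (pi / 2) \<le> x" "x \<le> pi / 2" if "x \<in> moved (to_line I b)" for x
    using that by (auto simp: subset_iff less_imp_le)
  ultimately show "- (pi / 2) \<le> left_end (to_line I b)" "right_end (to_line I b) \<le> pi / 2"
    unfolding left_end_def right_end_def by (blast intro: cInf_greatest cSup_least)+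
qed

lemma crossing_ends:
  assumes I: "is_interval I" and pb: "positive_bump I b" "positive_bump I b'"
    and m: "m b \<in> supp I b" "m b' \<in> supp I b'"
    and o: "left_of (left_foot I b (m b)) (left_foot I b' (m b'))"
      "left_of (left_foot I b' (m b')) (right_foot I b (m b))"
      "left_of (right_foot I b (m b)) (right_foot I b' (m b'))"
  shows "left_end (to_line I b) < left_end (to_line I b') \<and> left_end (to_line I b') < right_end (to_line I b) \<and>
    right_end (to_line I b) < right_end (to_line I b')"
proof -
  let ?f = "to_line I b" and ?g = "to_line I b'"
  note f = bump_marker[OF I pb(1) m(1)] and g = bump_marker[OF I pb(2) m(2)]
  note J = ends_in_J[OF I pb(1)] ends_in_J[OF I pb(2)]
  interpret f: bump ?f "left_end ?f" "right_end ?f" by (rule bump_to_line(2)[OF I pb(1)])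
  interpret g: bump ?g "left_end ?g" "right_end ?g" by (rule bump_to_line(2)[OF I pb(2)])
  have fg: "left_end ?f < ?f (arctan (m b))" "left_end ?g < ?g (arctan (m b'))"
    using f.a_less f(1) g.a_less g(1) by blast+
  have "arctan (m b) \<le> left_end ?g"
    using f(1,2) J by (intro le_of_left_of[OF f(1) g(1) o(1) f(4) g(4)]) auto
  moreover have "arctan (m b') \<le> ?f (arctan (m b))"
    using g(1,2) J fg by (intro le_of_left_of[OF g(1) f(3) o(2) g(4) f(5)]) auto
  moreover have "right_end ?f \<le> ?g (arctan (m b'))"
    using J fg by (intro le_of_left_of[OF f(3) g(3) o(3) f(5) g(5)]) auto
  ultimately show ?thesis using f(1,3) g(1,3) by linarith
qed

lemma fast_family_to_line:
  assumes I: "is_interval I" and fast: "geometrically_fast I B" and irr: "bumps_irreducible I B"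
  shows "\<exists>mk. fast_family (to_line I ` B) left_end mk right_end"
proof -
  obtain m where fin: "finite B" and pb: "\<And>b. b \<in> B \<Longrightarrow> positive_bump I b" and fm: "fast_marking I B m"
    using fast by (auto simp: geometrically_fast_def)
  have BI: "B \<subseteq> homeo_plus I" using pb by (auto simp: positive_bump_def)
  have inj: "inj_on (to_line I) B" using to_line_inj BI by (rule inj_on_subset)
  define mk where "mk f = arctan (m (inv_into B (to_line I) f))" for f
  have mk: "mk (to_line I b) = arctan (m b)" if "b \<in> B" for b
    using inj that by (simp add: mk_def)
  have ms: "m b \<in> supp I b" if "b \<in> B" for b using fm that by (simp add: fast_marking_def)
  have dis: "disjoint_family_on (case_sum (\<lambda>b. left_foot I b (m b)) (\<lambda>b. right_foot I b (m b))) (B <+> B)"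
    using fm by (simp add: fast_marking_def)
  note bm = bump_marker[OF I pb ms]
  have "fast_family (to_line I ` B) left_end mk right_end"
  proof (rule fast_family.intro)
    show "finite (to_line I ` B)" using fin by simp
    show "bump f (left_end f) (right_end f)" if "f \<in> to_line I ` B" for f
      using that bump_to_line(2)[OF I pb] by auto
    show "left_end f < mk f" "mk f < right_end f" if "f \<in> to_line I ` B" for f
      using that bm(1,2) mk by auto
    show "before (left_end f, mk f) (left_end g, mk g) \<or> before (left_end g, mk g) (left_end f, mk f)"
      if fg: "f \<in> to_line I ` B" "g \<in> to_line I ` B" "f \<noteq> g" for f g
    proof -
      obtain b b' where b: "b \<in> B" "f = to_line I b" "b' \<in> B" "g = to_line I b'" using fg by auto
      then have "b \<noteq> b'" using fg by auto
      then have d: "left_foot I b (m b) \<inter> left_foot I b' (m b') = {}"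
        using disjoint_family_onD[OF dis InlI[OF b(1)] InlI[OF b(3)]] \<open>b \<noteq> b'\<close> by simp
      show ?thesis unfolding b(2,4) mk[OF b(1)] mk[OF b(3)]
        by (rule before_of_disjoint[OF bm(1)[OF b(1) b(1)] bm(1)[OF b(3) b(3)] d bm(4)[OF b(1) b(1)] bm(4)[OF b(3) b(3)]])
    qed
    show "before (f (mk f), right_end f) (g (mk g), right_end g) \<or> before (g (mk g), right_end g) (f (mk f), right_end f)"
      if fg: "f \<in> to_line I ` B" "g \<in> to_line I ` B" "f \<noteq> g" for f g
    proof -
      obtain b b' where b: "b \<in> B" "f = to_line I b" "b' \<in> B" "g = to_line I b'" using fg by auto
      then have "b \<noteq> b'" using fg by auto
      then have d: "right_foot I b (m b) \<inter> right_foot I b' (m b') = {}"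
        using disjoint_family_onD[OF dis InrI[OF b(1)] InrI[OF b(3)]] \<open>b \<noteq> b'\<close> by simp
      show ?thesis unfolding b(2,4) mk[OF b(1)] mk[OF b(3)]
        by (rule before_of_disjoint[OF bm(3)[OF b(1) b(1)] bm(3)[OF b(3) b(3)] d bm(5)[OF b(1) b(1)] bm(5)[OF b(3) b(3)]])
    qed
    show "before (left_end f, mk f) (g (mk g), right_end g) \<or> before (g (mk g), right_end g) (left_end f, mk f)"
      if fg: "f \<in> to_line I ` B" "g \<in> to_line I ` B" for f g
    proof -
      obtain b b' where b: "b \<in> B" "f = to_line I b" "b' \<in> B" "g = to_line I b'" using fg by auto
      have d: "left_foot I b (m b) \<inter> right_foot I b' (m b') = {}"
        using disjoint_family_onD[OF dis InlI[OF b(1)] InrI[OF b(3)]] by simp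
      show ?thesis unfolding b(2,4) mk[OF b(1)] mk[OF b(3)]
        by (rule before_of_disjoint[OF bm(1)[OF b(1) b(1)] bm(3)[OF b(3) b(3)] d bm(4)[OF b(1) b(1)] bm(5)[OF b(3) b(3)]])
    qed
    fix C assume C: "C \<subseteq> to_line I ` B" "C \<noteq> {}" "C \<noteq> to_line I ` B"
    define A where "A = {b \<in> B. to_line I b \<in> C}"
    obtain x where x: "x \<in> A" using C by (auto simp: A_def)
    obtain z where z: "z \<in> B" "z \<notin> A" using C by (auto simp: A_def)
    have "(x, z) \<in> (crossing_edges I B)\<^sup>*" using irr x z by (auto simp: bumps_irreducible_def A_def)
    \<comment> \<open>A path in the crossing graph that starts in \<open>A\<close> and ends outside
      has an edge leaving \<open>A\<close>.\<close>
    then have "z \<notin> A \<longrightarrow> (\<exists>v w. v \<in> A \<and> w \<notin> A \<and> (v, w) \<in> crossing_edges I B)"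
      using x by (induction rule: rtrancl_induct) blast+
    then obtain v w where vw: "v \<in> A" "w \<notin> A" "(v, w) \<in> crossing_edges I B" using z by blast
    then have B: "v \<in> B" "w \<in> B" "crosses I B v w" by (auto simp: crossing_edges_def)
    \<comment> \<open>The marking that witnesses the crossing may differ from \<open>m\<close>; only
      the order of end points is extracted from it.\<close>
    then obtain m' where m': "fast_marking I B m'"
      "left_of (left_foot I v (m' v)) (left_foot I w (m' w)) \<and> left_of (left_foot I w (m' w)) (right_foot I v (m' v)) \<and>
         left_of (right_foot I v (m' v)) (right_foot I w (m' w)) \<or>
       left_of (left_foot I w (m' w)) (left_foot I v (m' v)) \<and> left_of (left_foot I v (m' v)) (right_foot I w (m' w)) \<and>
         left_of (right_foot I w (m' w)) (right_foot I v (m' v))"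
      unfolding crosses_def Let_def by blast
    have ms': "m' v \<in> supp I v" "m' w \<in> supp I w" using m'(1) B by (auto simp: fast_marking_def)
    have "to_line I w \<in> to_line I ` B - C" "to_line I v \<in> C" using vw B by (auto simp: A_def)
    moreover have "left_end (to_line I w) < left_end (to_line I v) \<and> left_end (to_line I v) < right_end (to_line I w) \<and>
         right_end (to_line I w) < right_end (to_line I v) \<or>
       left_end (to_line I v) < left_end (to_line I w) \<and> left_end (to_line I w) < right_end (to_line I v) \<and>
         right_end (to_line I v) < right_end (to_line I w)"
      using m'(2) crossing_ends[OF I pb[OF B(1)] pb[OF B(2)], of m'] crossing_ends[OF I pb[OF B(2)] pb[OF B(1)], of m'] ms'
      by blast
    ultimately show "\<exists>f\<in>to_line I ` B - C. \<exists>g\<in>C. left_end f < left_end g \<and> left_end g < right_end f \<and> right_end f < right_end g \<or>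
        left_end g < left_end f \<and> left_end f < right_end g \<and> right_end g < right_end f"
      by blast
  qed
  then show ?thesis by blast
qed

text \<open>Closure of the source suffices to invert a bijective homomorphism, which avoids a
  separate proof of the group axioms for \<open>thompson_group n\<close>.\<close>

lemma iso_symI:
  assumes f: "f \<in> iso G H" and closed: "\<And>x z. x \<in> carrier G \<Longrightarrow> z \<in> carrier G \<Longrightarrow> x \<otimes>\<^bsub>G\<^esub> z \<in> carrier G"
  shows "H \<cong> G"
proof -
  let ?g = "inv_into (carrier G) f"
  have b: "bij_betw f (carrier G) (carrier H)" using f by (simp add: iso_def)
  then have inj: "inj_on f (carrier G)" and img: "f ` carrier G = carrier H" by (auto simp: bij_betw_def)
  have "?g (x \<otimes>\<^bsub>H\<^esub> z) = ?g x \<otimes>\<^bsub>G\<^esub> ?g z" if xz: "x \<in> carrier H" "z \<in> carrier H" for x z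
  proof -
    have m: "?g x \<in> carrier G" "?g z \<in> carrier G" "f (?g x) = x" "f (?g z) = z"
      using xz img by (auto simp: inv_into_into f_inv_into_f)
    then have "f (?g x \<otimes>\<^bsub>G\<^esub> ?g z) = x \<otimes>\<^bsub>H\<^esub> z" using f by (auto simp: iso_def hom_def)
    then show ?thesis using inv_into_f_f[OF inj closed[OF m(1,2)]] by simp
  qed
  moreover have "?g \<in> carrier H \<rightarrow> carrier G" using img by (auto simp: inv_into_into)
  ultimately have "?g \<in> iso H G" using bij_betw_inv_into[OF b] by (auto simp: iso_def hom_def)
  then show ?thesis by (rule is_isoI)
qed

theorem bump_group_iso_thompson:
  assumes n: "2 \<le> n" and I: "is_interval I" and fast: "geometrically_fast I B"
    and irr: "bumps_irreducible I B" and card: "card B = n"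
  shows "bump_group I B \<cong> thompson_group n"
proof -
  interpret thompson n using n by unfold_locales
  have BI: "B \<subseteq> homeo_plus I" using fast by (auto simp: geometrically_fast_def positive_bump_def)
  let ?B = "to_line I ` B"
  have cardB: "card ?B = n" using card_image[OF inj_on_subset[OF to_line_inj BI]] card by simp
  obtain mk where "fast_family ?B left_end mk right_end" using fast_family_to_line[OF I fast irr] by blast
  then obtain y s t where y: "bump_chain N y s t" "generate line_group (range y) = generate line_group ?B"
    using fast_family.chain_of_fast_family[of ?B left_end mk right_end] cardB n by (auto simp: N_def)
  interpret y: bump_chain N y s t by (rule y(1))
  have "line_group\<lparr>carrier := generate line_group ?B\<rparr> \<cong> line_group\<lparr>carrier := H\<rparr>"
    using iso_of_faithful_shift_sequences[OF y.faithful_shift_sequence_axioms chain.faithful_shift_sequence_axioms] y(2)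
    by simp
  moreover have "line_group\<lparr>carrier := H\<rparr> \<cong> thompson_group n"
    using lift_iso by (rule iso_symI) (simp add: thompson_group_def mult_homeo_group thompson_homeo thompson_compose)
  ultimately show ?thesis using bump_group_iso[OF I BI] iso_trans by blast
qed

section \<open>A chain of bumps on the line\<close>

text \<open>A witness that the class is nonempty. The supports from \<open>2 i\<close> to
  \<open>2 i + 3\<close> overlap only for neighbours. Slopes \<open>5\<close> and
  \<open>1 / 5\<close> take the marker \<open>1 / 2\<close> to \<open>5 / 2\<close>, so all feet
  have length \<open>1 / 2\<close>, and the left foot of bump \<open>i + 1\<close> ends exactly
  where the right foot of bump \<open>i\<close> begins.\<close>

definition model_bump :: "nat \<Rightarrow> real \<Rightarrow> real" where
  "model_bump i x = (let u = x - 2 * real i in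
     if u \<le> 0 \<or> 3 \<le> u then x else if u \<le> 1 / 2 then 2 * real i + 5 * u else 2 * real i + (u + 12) / 5)"

lemma incr_model_bump: "incr_bij (model_bump i)"
proof
  show "strict_mono (model_bump i)"
    by (rule strict_monoI) (auto simp: model_bump_def Let_def add_divide_distrib diff_divide_distrib)
  have "\<exists>x. model_bump i x = z" for z
  proof -
    define w where "w = z - 2 * real i"
    have z: "z = 2 * real i + w" by (simp add: w_def)
    consider "w \<le> 0 \<or> 3 \<le> w" | "0 < w" "w \<le> 5 / 2" | "5 / 2 < w" "w < 3" by linarith
    then show ?thesis
    proof cases
      case 1
      then show ?thesis by (intro exI[of _ z]) (auto simp: model_bump_def z)
    next
      case 2
      then show ?thesis by (intro exI[of _ "2 * real i + w / 5"]) (simp add: model_bump_def z)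
    next
      case 3
      then show ?thesis by (intro exI[of _ "2 * real i + (5 * w - 12)"]) (simp add: model_bump_def z)
    qed
  qed
  then show "surj (model_bump i)" by (metis surjI)
qed

lemma supp_model_bump: "supp UNIV (model_bump i) = {2 * real i<..<2 * real i + 3}"
  by (auto simp: supp_def model_bump_def Let_def add_divide_distrib diff_divide_distrib)

lemma model_bump_UNIV: "model_bump i \<in> homeo_plus UNIV"
proof -
  interpret incr_bij "model_bump i" by (rule incr_model_bump)
  have "bij (model_bump i)" using inj_line[OF smono] surj by (simp add: bij_def)
  then show ?thesis using smono by (simp add: homeo_plus_interval is_interval_univ Bij_def)
qed

lemma positive_model_bump: "positive_bump UNIV (model_bump i)"
proof -
  have "x < model_bump i x" if "x \<in> supp UNIV (model_bump i)" for x
    using that unfolding supp_model_bump by (auto simp: model_bump_def Let_def add_divide_distrib diff_divide_distrib)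
  then show ?thesis
    using model_bump_UNIV[of i] by (simp add: positive_bump_def supp_model_bump is_interval_oo)
qed

lemma model_bump_inject: "model_bump i = model_bump j \<longleftrightarrow> i = j"
proof
  assume "model_bump i = model_bump j"
  then have "{2 * real i<..<2 * real i + 3} = {2 * real j<..<2 * real j + 3}"
    using supp_model_bump by metis
  then show "i = j" by (simp add: greaterThanLessThan_eq_iff)
qed simp

definition model_family :: "nat \<Rightarrow> (real \<Rightarrow> real) set" where
  "model_family n = model_bump ` {..<n}"

text \<open>The family is a set of functions, so the marker has to be read off from the function and
  not from its index.\<close>

definition model_marker :: "(real \<Rightarrow> real) \<Rightarrow> real" where
  "model_marker b = Inf (supp UNIV b) + 1 / 2"

lemma model_marker: "model_marker (model_bump i) = 2 * real i + 1 / 2"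
  by (simp add: model_marker_def supp_model_bump)

lemma model_feet:
  "left_foot UNIV (model_bump i) (model_marker (model_bump i)) = {2 * real i<..<2 * real i + 1 / 2}"
  "right_foot UNIV (model_bump i) (model_marker (model_bump i)) = {2 * real i + 5 / 2..<2 * real i + 3}"
  unfolding left_foot_def right_foot_def model_marker supp_model_bump
  by (auto simp: model_bump_def)

lemma model_marking: "fast_marking UNIV (model_family n) model_marker"
proof -
  have "model_marker b \<in> supp UNIV b" if "b \<in> model_family n" for b
    using that by (auto simp: model_family_def model_marker supp_model_bump)
  moreover have "disjoint_family_on
    (case_sum (\<lambda>b. left_foot UNIV b (model_marker b)) (\<lambda>b. right_foot UNIV b (model_marker b)))
    (model_family n <+> model_family n)"
    unfolding disjoint_family_on_def
  proof (intro ballI impI)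
    have LL: "i = j" if "2 * real i < x" "x < 2 * real i + 1 / 2" "2 * real j < x" "x < 2 * real j + 1 / 2" for i j x
    proof -
      have "real i < real (j + 1)" "real j < real (i + 1)" using that by auto
      then show ?thesis unfolding of_nat_less_iff by simp
    qed
    have RR: "i = j" if "2 * real i + 5 / 2 \<le> x" "x < 2 * real i + 3" "2 * real j + 5 / 2 \<le> x" "x < 2 * real j + 3" for i j x
    proof -
      have "real i < real (j + 1)" "real j < real (i + 1)" using that by auto
      then show ?thesis unfolding of_nat_less_iff by simp
    qed
    \<comment> \<open>A common point would give \<open>j + 1 < i < j + 2\<close>, impossible for
      integers.\<close>
    have LR: False if "2 * real i < x" "x < 2 * real i + 1 / 2" "2 * real j + 5 / 2 \<le> x" "x < 2 * real j + 3" for i j x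
    proof -
      have "real (j + 1) < real i" "real i < real (j + 2)" using that by auto
      then show False unfolding of_nat_less_iff by simp
    qed
    fix u v assume uv: "u \<in> model_family n <+> model_family n" "v \<in> model_family n <+> model_family n" "u \<noteq> v"
    show "case_sum (\<lambda>b. left_foot UNIV b (model_marker b)) (\<lambda>b. right_foot UNIV b (model_marker b)) u \<inter>
      case_sum (\<lambda>b. left_foot UNIV b (model_marker b)) (\<lambda>b. right_foot UNIV b (model_marker b)) v = {}"
      (is "?f u \<inter> ?f v = {}")
    proof (rule equals0I)
      fix x assume x: "x \<in> ?f u \<inter> ?f v"
      have cases: "(\<exists>i. w = Inl (model_bump i)) \<or> (\<exists>i. w = Inr (model_bump i))"
        if "w \<in> model_family n <+> model_family n" for w
        using that by (elim PlusE) (auto simp: model_family_def)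
      from cases[OF uv(1)] show False
      proof (elim disjE exE)
        fix i assume u: "u = Inl (model_bump i)"
        from cases[OF uv(2)] show False
        proof (elim disjE exE)
          fix j assume v: "v = Inl (model_bump j)"
          have "i = j" using x LL[of i x j] unfolding u v by (simp add: model_feet)
          then show False using uv(3) u v by simp
        next
          fix j assume v: "v = Inr (model_bump j)"
          show False using x LR[of i x j] unfolding u v by (simp add: model_feet)
        qed
      next
        fix i assume u: "u = Inr (model_bump i)"
        from cases[OF uv(2)] show False
        proof (elim disjE exE)
          fix j assume v: "v = Inl (model_bump j)"
          show False using x LR[of j x i] unfolding u v by (simp add: model_feet)
        next
          fix j assume v: "v = Inr (model_bump j)"
          have "i = j" using x RR[of i x j] unfolding u v by (simp add: model_feet)
          then show False using uv(3) u v by simp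
        qed
      qed
    qed
  qed
  ultimately show ?thesis by (simp add: fast_marking_def)
qed

lemma model_fast: "geometrically_fast UNIV (model_family n)"
  using model_marking positive_model_bump by (auto simp: geometrically_fast_def model_family_def)

lemma model_crosses:
  "crosses UNIV (model_family n) (model_bump i) (model_bump (Suc i))"
  "crosses UNIV (model_family n) (model_bump (Suc i)) (model_bump i)"
  unfolding crosses_def Let_def
  by (intro exI[of _ model_marker] conjI model_marking; simp add: model_feet left_of_def)+

lemma model_irreducible: "bumps_irreducible UNIV (model_family n)"
proof -
  let ?E = "crossing_edges UNIV (model_family n)"
  have step: "(model_bump i, model_bump (Suc i)) \<in> ?E" "(model_bump (Suc i), model_bump i) \<in> ?E" if "Suc i < n" for i
    using that model_crosses by (auto simp: crossing_edges_def model_family_def)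
  have "i < n \<Longrightarrow> (model_bump 0, model_bump i) \<in> ?E\<^sup>* \<and> (model_bump i, model_bump 0) \<in> ?E\<^sup>*" for i
  proof (induction i)
    case (Suc i)
    then show ?case using step[of i] by (meson Suc_lessD converse_rtrancl_into_rtrancl rtrancl.rtrancl_into_rtrancl)
  qed simp
  then show ?thesis by (auto simp: bumps_irreducible_def model_family_def intro: rtrancl_trans)
qed

lemma card_model_family: "card (model_family n) = n"
  unfolding model_family_def by (subst card_image) (auto simp: inj_on_def model_bump_inject)

theorem mainTheorem1:
  fixes n :: nat
  assumes "n \<ge> 2"
  shows "(\<forall>I B. is_interval I \<and> geometrically_fast I B \<and> bumps_irreducible I B \<and> card B = n
            \<longrightarrow> bump_group I B \<cong> thompson_group n) \<and>
         bump_group_class n \<noteq> {} \<and> (\<forall>G\<in>bump_group_class n. G \<cong> thompson_group n)"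
proof -
  have iso: "bump_group I B \<cong> thompson_group n"
    if "is_interval I" "geometrically_fast I B" "bumps_irreducible I B" "card B = n" for I B
    using bump_group_iso_thompson[OF assms that] .
  have "bump_group UNIV (model_family n) \<in> bump_group_class n"
    using model_fast model_irreducible card_model_family is_interval_univ
    unfolding bump_group_class_def by blast
  then show ?thesis using iso unfolding bump_group_class_def by blast
qed

end
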